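(* Let $\delta>1$, let $w\in A_s$, let $\mathcal A$ satisfy the structural conditions listed in the context, and let $f\in L^1(\Omega)$, $f\ge0$, $f\not\equiv0$. Let $u\in W^{1,p}_{loc}(\Omega,w)$ be the weak solution of $$-\operatorname{div}(\mathcal A(x,\nabla u))=\frac{f(x)}{u^\delta}\ \text{in }\Omega,\qquad u>0\ \text{in }\Omega,\qquad u=0\ \text{on }\partial\Omega$$ with $u^{\frac{\delta+p-1}p}\in X=W_0^{1,p}(\Omega,w)$ obtained as the limit of the approximating solutions $u_n$ (see context). Then: (a) Suppose $1\le p_s<N$. (i) If $f\in L^m(\Omega)$ for some $m\in\left(1,\frac{p_s^*}{p_s^*-p}\right)$, then $u\in L^t(\Omega)$ with $t=p_s^*\gamma$, where $\gamma=\frac{(\delta+p-1)m'}{pm'-p_s^*}$. (ii) If $f\in L^m(\Omega)$ for some $m>\frac{p_s^*}{p_s^*-p}$, then $u\in L^\infty(\Omega)$. (b) Suppose $p_s=N$ and let $q>p$. If $f\in L^m(\Omega)$ for some $m\in\left(1,\frac q{q-p}\right)$, then $u\in L^t(\Omega)$ with $t=q\gamma$, where $\gamma=\frac{(\delta+p-1)m'}{pm'-q}$. (c) If $p_s>N$ and $f\in L^1(\Omega)$, then $u\in L^\infty(\Omega)$.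
   Context: Setting: $N\ge 2$, $\Omega\subset\mathbb R^N$ is a bounded smooth domain, $1<p<\infty$. Weights: a locally integrable $w:\mathbb R^N\to(0,\infty)$ (with $0<w<\infty$ a.e.) belongs to $A_p$ if there is $c_{p,w}>0$ such that $\left(\frac1{|B|}\int_B w\,dx\right)\left(\frac1{|B|}\int_B w^{-\frac1{p-1}}dx\right)^{p-1}\le c_{p,w}$ for all balls $B\subset\mathbb R^N$. Fix $s\in[\frac1{p-1},\infty)\cap(\frac Np,\infty)$; $w\in A_s$ means $w\in A_p$ and $w^{-s}\in L^1(\Omega)$. Set $p_s=\frac{ps}{s+1}\in[1,p)$ and, if $p_s<N$, $p_s^*=\frac{Np_s}{N-p_s}$ (then $p_s^*>p$). For an exponent $r$, $r'$ is the Hölder conjugate. Spaces: $W^{1,p}(\Omega,w)$ is the space of (weakly differentiable) measurable $u$ with $\|u\|_{1,p,w}=(\int_\Omega|u|^pw\,dx)^{1/p}+(\int_\Omega|\nabla u|^pw\,dx)^{1/p}<\infty$; $X=W^{1,p}_0(\Omega,w)$ is the closure of $C_c^\infty(\Omega)$ in it, and $\left(\int_\Omega|\nabla u|^pw\,dx\right)^{1/p}$ is an equivalent norm on $X$. $u\in W^{1,p}_{loc}(\Omega,w)$ means $u\in W^{1,p}(\Omega',w)$ for every $\Omega'\Subset\Omega$. Operator: $\mathcal A:\Omega\times\mathbb R^N\to\mathbb R^N$ is Carathéodory ($\mathcal A(\cdot,\zeta)$ measurable for every $\zeta$; $\mathcal A(x,\cdot)$ continuous for a.e. $x$), and for a.e.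 $x\in\Omega$ and all vectors in $\mathbb R^N$: (growth) $|\mathcal A(x,\zeta)|\le|\zeta|^{p-1}w(x)$; (degeneracy) $\mathcal A(x,\zeta)\cdot\zeta\ge|\zeta|^pw(x)$; (homogeneity) $\mathcal A(x,t\zeta)=t|t|^{p-2}\mathcal A(x,\zeta)$ for $t\in\mathbb R\setminus\{0\}$; (strong monotonicity) with $\gamma_0=\max\{p,2\}$ and some constant $c>0$, for $\zeta_1\ne\zeta_2$, $\langle\mathcal A(x,\zeta_1)-\mathcal A(x,\zeta_2),\zeta_1-\zeta_2\rangle\ge c|\zeta_1-\zeta_2|^{\gamma_0}\{\overline{\mathcal A}(x,\zeta_1,\zeta_2)\}^{1-\frac{\gamma_0}p}w(x)$, where $\overline{\mathcal A}(x,\zeta_1,\zeta_2)=\frac1{w(x)}(\langle\mathcal A(x,\zeta_1),\zeta_1\rangle+\langle\mathcal A(x,\zeta_2),\zeta_2\rangle)$. Weak solution: $u\in W^{1,p}_{loc}(\Omega,w)$ is a weak solution of the problem if for every $K\Subset\Omega$ there is $c_K>0$ with $u\ge c_K$ in $K$; for all $\phi\in C_c^1(\Omega)$, $\int_\Omega\mathcal A(x,\nabla u)\cdot\nabla\phi\,dx=\int_\Omega\frac{f}{u^\delta}\phi\,dx$; $u>0$ in $\Omega$; and $u=0$ on $\partial\Omega$ in the sense that $u^\alpha\in X$ for some $\alpha\ge1$. Approximating solutions: for $n\in\mathbb N$ let $f_n=\min\{f,n\}$. There is a unique $u_n\in X\cap L^\infty(\Omega)$ with $u_n>0$ in $\Omega$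 and $\int_\Omega\mathcal A(x,\nabla u_n)\cdot\nabla\phi\,dx=\int_\Omega\frac{f_n}{(u_n+\frac1n)^\delta}\phi\,dx$ for all $\phi\in X$; moreover $u_n\le u_{n+1}$. The solution $u$ in the claim is the pointwise a.e. limit of $u_n$, which is a weak solution in $W^{1,p}_{loc}(\Omega,w)$ with $u^{\frac{\delta+p-1}p}\in X$ for every nonnegative $f\in L^1(\Omega)$, $f\not\equiv0$. *)

theory Defs
  imports "HOL-Analysis.Analysis"
begin

text \<open>Used only with \<open>S\<close> open: continuity of all partial derivatives of order at most \<open>k\<close>.\<close>

primrec Ck_on :: "nat \<Rightarrow> 'a::euclidean_space set \<Rightarrow> ('a \<Rightarrow> real) \<Rightarrow> bool" where
  "Ck_on 0 S g \<longleftrightarrow> continuous_on S g"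
| "Ck_on (Suc k) S g \<longleftrightarrow> (\<forall>x\<in>S. g differentiable (at x)) \<and>
     (\<forall>b\<in>Basis. Ck_on k S (\<lambda>x. frechet_derivative g (at x) b))"

definition smooth_on :: "'a::euclidean_space set \<Rightarrow> ('a \<Rightarrow> real) \<Rightarrow> bool" where
  "smooth_on S g \<longleftrightarrow> (\<forall>k. Ck_on k S g)"

definition grad :: "('a::euclidean_space \<Rightarrow> real) \<Rightarrow> 'a \<Rightarrow> 'a" where
  "grad g x = (\<Sum>b\<in>Basis. frechet_derivative g (at x) b *\<^sub>R b)"

text \<open>Near each boundary point, \<open>\<Omega>\<close> is the sublevel set of a smooth function without
  critical points, so it lies locally on one side of a smooth hypersurface.\<close>

definition bounded_smooth_domain :: "'a::euclidean_space set \<Rightarrow> bool" where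
  "bounded_smooth_domain \<Omega> \<longleftrightarrow>
     open \<Omega> \<and> connected \<Omega> \<and> \<Omega> \<noteq> {} \<and> bounded \<Omega> \<and>
     (\<forall>z\<in>frontier \<Omega>. \<exists>U \<rho>. open U \<and> z \<in> U \<and> smooth_on U \<rho> \<and>
        (\<forall>x\<in>U. grad \<rho> x \<noteq> 0) \<and> \<Omega> \<inter> U = {x\<in>U. \<rho> x < 0})"

text \<open>Test functions of class \<open>C\<^sup>1\<close> and \<open>C\<^sup>\<infinity>\<close>, extended by zero to the whole space.\<close>

definition compact_support_in :: "'a::euclidean_space set \<Rightarrow> ('a \<Rightarrow> real) \<Rightarrow> bool" where
  "compact_support_in \<Omega> \<phi> \<longleftrightarrow> compact (closure {x. \<phi> x \<noteq> 0}) \<and> closure {x. \<phi> x \<noteq> 0} \<subseteq> \<Omega>"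

definition Cc1 :: "'a::euclidean_space set \<Rightarrow> ('a \<Rightarrow> real) set" where
  "Cc1 \<Omega> = {\<phi>. Ck_on 1 UNIV \<phi> \<and> compact_support_in \<Omega> \<phi>}"

definition Cc_infty :: "'a::euclidean_space set \<Rightarrow> ('a \<Rightarrow> real) set" where
  "Cc_infty \<Omega> = {\<phi>. smooth_on UNIV \<phi> \<and> compact_support_in \<Omega> \<phi>}"

text \<open>Function spaces are sets of representatives \<open>'a \<Rightarrow> real\<close>; values outside \<open>\<Omega>\<close>
  are irrelevant.\<close>

definition Lp :: "real \<Rightarrow> 'a::euclidean_space set \<Rightarrow> ('a \<Rightarrow> real) set" where
  "Lp m \<Omega> = {g \<in> borel_measurable (lebesgue_on \<Omega>).
     integrable (lebesgue_on \<Omega>) (\<lambda>x. \<bar>g x\<bar> powr m)}"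

definition L_infty :: "'a::euclidean_space set \<Rightarrow> ('a \<Rightarrow> real) set" where
  "L_infty \<Omega> = {g \<in> borel_measurable (lebesgue_on \<Omega>).
     \<exists>C. AE x in lebesgue_on \<Omega>. \<bar>g x\<bar> \<le> C}"

definition locally_integrable_on ::
    "('a::euclidean_space \<Rightarrow> 'b::{banach, second_countable_topology}) \<Rightarrow> 'a set \<Rightarrow> bool" where
  "locally_integrable_on g \<Omega> \<longleftrightarrow> (\<forall>K. compact K \<and> K \<subseteq> \<Omega> \<longrightarrow> integrable (lebesgue_on K) g)"

definition conj_exp :: "real \<Rightarrow> real" where
  "conj_exp r = r / (r - 1)"

definition ball_avg :: "'a::euclidean_space \<Rightarrow> real \<Rightarrow> ('a \<Rightarrow> real) \<Rightarrow> real" where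
  "ball_avg z r g = (1 / measure lebesgue (ball z r)) * integral\<^sup>L (lebesgue_on (ball z r)) g"

text \<open>The Bochner integral of a non-integrable function is \<open>0\<close>, so the finiteness of the
  second average has to be required separately.\<close>

definition Ap_weight :: "real \<Rightarrow> ('a::euclidean_space \<Rightarrow> real) \<Rightarrow> bool" where
  "Ap_weight p w \<longleftrightarrow>
     locally_integrable_on w UNIV \<and> (AE x in lebesgue. 0 < w x) \<and>
     (\<exists>c>0. \<forall>z. \<forall>r>0.
        integrable (lebesgue_on (ball z r)) (\<lambda>x. w x powr (- 1 / (p - 1))) \<and>
        ball_avg z r w * (ball_avg z r (\<lambda>x. w x powr (- 1 / (p - 1)))) powr (p - 1) \<le> c)"

definition As_weight ::
    "real \<Rightarrow> real \<Rightarrow> 'a::euclidean_space set \<Rightarrow> ('a \<Rightarrow> real) \<Rightarrow> bool" where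
  "As_weight p s \<Omega> w \<longleftrightarrow> Ap_weight p w \<and> integrable (lebesgue_on \<Omega>) (\<lambda>x. w x powr (- s))"

definition is_weak_grad ::
    "'a::euclidean_space set \<Rightarrow> ('a \<Rightarrow> real) \<Rightarrow> ('a \<Rightarrow> 'a) \<Rightarrow> bool" where
  "is_weak_grad \<Omega> u g \<longleftrightarrow>
     locally_integrable_on u \<Omega> \<and> locally_integrable_on g \<Omega> \<and>
     (\<forall>\<phi>\<in>Cc_infty \<Omega>. integral\<^sup>L (lebesgue_on \<Omega>) (\<lambda>x. u x *\<^sub>R grad \<phi> x)
        = - integral\<^sup>L (lebesgue_on \<Omega>) (\<lambda>x. \<phi> x *\<^sub>R g x))"

text \<open>Weak gradients are unique up to null sets; \<open>wgrad\<close> picks a representative.\<close>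

definition wgrad :: "'a::euclidean_space set \<Rightarrow> ('a \<Rightarrow> real) \<Rightarrow> 'a \<Rightarrow> 'a" where
  "wgrad \<Omega> u = (SOME g. is_weak_grad \<Omega> u g)"

definition W1p :: "real \<Rightarrow> 'a::euclidean_space set \<Rightarrow> ('a \<Rightarrow> real) \<Rightarrow> ('a \<Rightarrow> real) set" where
  "W1p p \<Omega> w = {u. (\<exists>g. is_weak_grad \<Omega> u g) \<and>
     integrable (lebesgue_on \<Omega>) (\<lambda>x. \<bar>u x\<bar> powr p * w x) \<and>
     integrable (lebesgue_on \<Omega>) (\<lambda>x. norm (wgrad \<Omega> u x) powr p * w x)}"

definition W1p_norm ::
    "real \<Rightarrow> 'a::euclidean_space set \<Rightarrow> ('a \<Rightarrow> real) \<Rightarrow> ('a \<Rightarrow> real) \<Rightarrow> real" where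
  "W1p_norm p \<Omega> w u =
     (integral\<^sup>L (lebesgue_on \<Omega>) (\<lambda>x. \<bar>u x\<bar> powr p * w x)) powr (1 / p) +
     (integral\<^sup>L (lebesgue_on \<Omega>) (\<lambda>x. norm (wgrad \<Omega> u x) powr p * w x)) powr (1 / p)"

definition W1p_0 :: "real \<Rightarrow> 'a::euclidean_space set \<Rightarrow> ('a \<Rightarrow> real) \<Rightarrow> ('a \<Rightarrow> real) set" where
  "W1p_0 p \<Omega> w = {u \<in> W1p p \<Omega> w.
     \<forall>e>0. \<exists>\<phi>\<in>Cc_infty \<Omega>. W1p_norm p \<Omega> w (\<lambda>x. u x - \<phi> x) < e}"

definition W1p_loc :: "real \<Rightarrow> 'a::euclidean_space set \<Rightarrow> ('a \<Rightarrow> real) \<Rightarrow> ('a \<Rightarrow> real) set" where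
  "W1p_loc p \<Omega> w = {u. \<forall>\<Omega>'. open \<Omega>' \<and> compact (closure \<Omega>') \<and> closure \<Omega>' \<subseteq> \<Omega> \<longrightarrow>
     u \<in> W1p p \<Omega>' w}"

definition Abar ::
    "('a::euclidean_space \<Rightarrow> real) \<Rightarrow> ('a \<Rightarrow> 'a \<Rightarrow> 'a) \<Rightarrow> 'a \<Rightarrow> 'a \<Rightarrow> 'a \<Rightarrow> real" where
  "Abar w A x \<zeta>1 \<zeta>2 = (1 / w x) * (A x \<zeta>1 \<bullet> \<zeta>1 + A x \<zeta>2 \<bullet> \<zeta>2)"

definition caratheodory :: "'a::euclidean_space set \<Rightarrow> ('a \<Rightarrow> 'a \<Rightarrow> 'a) \<Rightarrow> bool" where
  "caratheodory \<Omega> A \<longleftrightarrow>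
     (\<forall>\<zeta>. (\<lambda>x. A x \<zeta>) \<in> borel_measurable (lebesgue_on \<Omega>)) \<and>
     (AE x in lebesgue_on \<Omega>. continuous_on UNIV (A x))"

definition structure_conditions ::
    "real \<Rightarrow> 'a::euclidean_space set \<Rightarrow> ('a \<Rightarrow> real) \<Rightarrow> ('a \<Rightarrow> 'a \<Rightarrow> 'a) \<Rightarrow> bool" where
  "structure_conditions p \<Omega> w A \<longleftrightarrow>
     caratheodory \<Omega> A \<and>
     (AE x in lebesgue_on \<Omega>. \<forall>\<zeta>. norm (A x \<zeta>) \<le> norm \<zeta> powr (p - 1) * w x) \<and>
     (AE x in lebesgue_on \<Omega>. \<forall>\<zeta>. A x \<zeta> \<bullet> \<zeta> \<ge> norm \<zeta> powr p * w x) \<and>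
     (AE x in lebesgue_on \<Omega>. \<forall>\<zeta> t. t \<noteq> 0 \<longrightarrow>
        A x (t *\<^sub>R \<zeta>) = (t * \<bar>t\<bar> powr (p - 2)) *\<^sub>R A x \<zeta>) \<and>
     (let \<gamma>0 = max p 2 in
      \<exists>c>0. AE x in lebesgue_on \<Omega>. \<forall>\<zeta>1 \<zeta>2. \<zeta>1 \<noteq> \<zeta>2 \<longrightarrow>
        (A x \<zeta>1 - A x \<zeta>2) \<bullet> (\<zeta>1 - \<zeta>2) \<ge>
          c * norm (\<zeta>1 - \<zeta>2) powr \<gamma>0 * (Abar w A x \<zeta>1 \<zeta>2) powr (1 - \<gamma>0 / p) * w x)"

text \<open>Pointwise conditions on Sobolev functions are understood almost everywhere. All
  integrands below are integrable under the standing assumptions, so that the junk value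
  of the Bochner integral plays no role.\<close>

definition weak_solution ::
    "real \<Rightarrow> 'a::euclidean_space set \<Rightarrow> ('a \<Rightarrow> real) \<Rightarrow> ('a \<Rightarrow> 'a \<Rightarrow> 'a) \<Rightarrow> real \<Rightarrow>
     ('a \<Rightarrow> real) \<Rightarrow> ('a \<Rightarrow> real) \<Rightarrow> bool" where
  "weak_solution p \<Omega> w A \<delta> f u \<longleftrightarrow>
     u \<in> W1p_loc p \<Omega> w \<and>
     (\<forall>K. compact K \<and> K \<subseteq> \<Omega> \<longrightarrow> (\<exists>c>0. AE x in lebesgue_on K. u x \<ge> c)) \<and>
     (\<forall>\<phi>\<in>Cc1 \<Omega>. integral\<^sup>L (lebesgue_on \<Omega>) (\<lambda>x. A x (wgrad \<Omega> u x) \<bullet> grad \<phi> x)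
        = integral\<^sup>L (lebesgue_on \<Omega>) (\<lambda>x. f x / u x powr \<delta> * \<phi> x)) \<and>
     (AE x in lebesgue_on \<Omega>. 0 < u x) \<and>
     (\<exists>\<alpha>\<ge>1. (\<lambda>x. u x powr \<alpha>) \<in> W1p_0 p \<Omega> w)"

text \<open>The solution of the \<open>n\<close>-th approximating problem (\<open>n \<ge> 1\<close>), which is unique up to
  null sets.\<close>

definition approx_solution ::
    "real \<Rightarrow> 'a::euclidean_space set \<Rightarrow> ('a \<Rightarrow> real) \<Rightarrow> ('a \<Rightarrow> 'a \<Rightarrow> 'a) \<Rightarrow> real \<Rightarrow>
     ('a \<Rightarrow> real) \<Rightarrow> nat \<Rightarrow> ('a \<Rightarrow> real) \<Rightarrow> bool" where
  "approx_solution p \<Omega> w A \<delta> f n v \<longleftrightarrow>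
     v \<in> W1p_0 p \<Omega> w \<inter> L_infty \<Omega> \<and>
     (AE x in lebesgue_on \<Omega>. 0 < v x) \<and>
     (\<forall>\<phi>\<in>W1p_0 p \<Omega> w.
        integral\<^sup>L (lebesgue_on \<Omega>) (\<lambda>x. A x (wgrad \<Omega> v x) \<bullet> wgrad \<Omega> \<phi> x)
        = integral\<^sup>L (lebesgue_on \<Omega>)
            (\<lambda>x. min (f x) (real n) / (v x + 1 / real n) powr \<delta> * \<phi> x))"

definition p_sub :: "real \<Rightarrow> real \<Rightarrow> real" where
  "p_sub p s = p * s / (s + 1)"

definition sobolev_conj :: "real \<Rightarrow> real \<Rightarrow> real" where
  "sobolev_conj N q = N * q / (N - q)"

end

theory Submission
  imports Defs
begin

text \<open>
Testing the equation of the approximating solution \<open>v\<close> with \<open>v powr \<theta>\<close>,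
  \<open>\<theta> = p (\<gamma> - 1) + 1\<close>, bounds the energy of \<open>v powr \<gamma>\<close> by \<open>\<integral> f v powr (\<theta> - \<delta>)\<close>. Sobolev's
  inequality on the left and Hoelder's on the right produce the same integral of \<open>v powr (q \<gamma>)\<close>
  on both sides, with a smaller power on the right, hence a bound that does not depend on \<open>n\<close>; Fatou's
  lemma passes it to \<open>u\<close>. For large \<open>m\<close> one tests instead with a \<open>C\<^sup>1\<close> version of \<open>max 0 (v - k)\<close>,
  \<open>k \<ge> 1\<close>, and applies Stampacchia's iteration to the measures of the superlevel sets. For
  \<open>p_sub p s > N\<close> the space \<open>X\<close> embeds into \<open>L_infty\<close>, so it suffices that a power of \<open>u\<close>
  lies in \<open>X\<close>.

  The weight enters only through \<open>\<integral> \<bar>\<nabla>\<phi>\<bar> powr p_sub p s \<le> C (\<integral> \<bar>\<nabla>\<phi>\<bar> powr p * w) powr (s / (s + 1))\<close>, which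
  is Hoelder's inequality with \<open>w powr - s\<close> integrable, and reduces everything to the unweighted
  Sobolev inequality. That one follows from the case of exponent \<open>1\<close> applied to powers, and the case
  of exponent \<open>1\<close> from integrating over lines in the coordinate directions.
\<close>

subsection \<open>Hoelder's inequality and the grid-lines inequality\<close>

text \<open>All exponents are forced. Since |grad v^\<gamma>|^p = \<gamma>^p v^(p (\<gamma> - 1))
  |grad v|^p, the test function must satisfy \<theta> - 1 = p (\<gamma> - 1); Hoelder reproduces the
  integral of v^(q \<gamma>) exactly when (\<theta> - \<delta>) m' = q \<gamma>. Both equations
  together give the stated \<gamma>. The power (1 - 1/m) q/p left on the right is below 1 exactly
  for m < q/(q - p), and Stampacchia's exponent exceeds 1 exactly for m > q/(q - p). From \<delta> >
  1 come \<gamma> > 1 and \<theta> > 1, so that the powers used are of class C^1; on levels k \<ge>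
  1 the singular factor v^(-\<delta>) is at most 1. The obstacle is the admissibility of the test
  functions: X is only a closure of test functions, and those approximating a bounded v may be
  unbounded. Hence the chain rule is proved for outer functions with globally bounded derivative,
  and a general C^1 outer function is approximated by such functions on the bounded range of v. If
  p_sub p s = N, there is no Sobolev conjugate; any q > p is instead the conjugate of some r < N,
  and on a bounded domain the gradient bound may be lowered from exponent N to r.\<close>

text \<open>Unlike \<open>powr\<close>, this satisfies \<open>epow 0 0 = 1\<close>. The exponents in \<open>grid_lines\<close> below do degenerate to \<open>0\<close>.\<close>

definition epow :: "ennreal \<Rightarrow> real \<Rightarrow> ennreal" where
  "epow x a = (if a = 0 then 1 else if x = top then top else ennreal (enn2real x powr a))"

lemma epow_0 [simp]: "epow x 0 = 1"
  by (simp add: epow_def)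

lemma epow_ennreal: "0 \<le> x \<Longrightarrow> a \<noteq> 0 \<Longrightarrow> epow (ennreal x) a = ennreal (x powr a)"
  by (simp add: epow_def)

lemma epow_top [simp]: "a \<noteq> 0 \<Longrightarrow> epow top a = top"
  by (simp add: epow_def)

lemma epow_zero [simp]: "a \<noteq> 0 \<Longrightarrow> epow 0 a = 0"
  by (simp add: epow_def)

lemma epow_mult: "epow (x * y) a = epow x a * epow y a"
proof (cases "a = 0")
  case False
  show ?thesis
  proof (cases x; cases y)
    fix r t assume "x = ennreal r" "0 \<le> r" "y = ennreal t" "0 \<le> t"
    then show ?thesis
      using False by (simp add: epow_ennreal powr_mult flip: ennreal_mult)
  next
    fix r assume *: "x = ennreal r" "0 \<le> r" "y = top"
    show ?thesis
      using False * by (cases "r = 0") (simp_all add: epow_ennreal ennreal_mult_top)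
  next
    fix r assume *: "x = top" "y = ennreal r" "0 \<le> r"
    show ?thesis
      using False * by (cases "r = 0") (simp_all add: epow_ennreal ennreal_top_mult)
  qed (use False in \<open>simp\<close>)
qed simp

lemma epow_add:
  assumes "0 \<le> a" "0 \<le> b"
  shows "epow x (a + b) = epow x a * epow x b"
proof (cases "a = 0 \<or> b = 0")
  case False
  then have "a + b \<noteq> 0" using assms by auto
  with False show ?thesis
    by (cases x) (auto simp: epow_ennreal powr_add ennreal_mult ennreal_top_mult)
qed auto

lemma epow_mono:
  assumes "0 \<le> a" "x \<le> y"
  shows "epow x a \<le> epow y a"
proof (cases "a = 0")
  case False
  with assms show ?thesis
    by (cases x; cases y) (auto simp: epow_ennreal top_unique intro!: powr_mono2 ennreal_leI)
qed simp

lemma measurable_epow [measurable]: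
  assumes [measurable]: "f \<in> borel_measurable M"
  shows "(\<lambda>x. epow (f x) a) \<in> borel_measurable M"
  unfolding epow_def by measurable

section \<open>Weighted arithmetic-geometric mean and Hoelder's inequality for finitely many
  factors\<close>

lemma prod_mono_ennreal:
  fixes f g :: "'i \<Rightarrow> ennreal"
  shows "(\<And>i. i \<in> S \<Longrightarrow> f i \<le> g i) \<Longrightarrow> prod f S \<le> prod g S"
  by (induction S rule: infinite_finite_induct) (auto intro!: mult_mono)

text \<open>Jensen's inequality for \<open>exp\<close> at the points
  \<open>ln (x i)\<close>.\<close>

lemma weighted_am_gm_pos:
  fixes x e :: "'i \<Rightarrow> real"
  assumes S: "finite S" and e: "\<And>i. i \<in> S \<Longrightarrow> 0 < e i" "sum e S = 1"
    and x: "\<And>i. i \<in> S \<Longrightarrow> 0 < x i"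
  shows "(\<Prod>i\<in>S. x i powr e i) \<le> (\<Sum>i\<in>S. e i * x i)"
proof -
  have ne: "S \<noteq> {}" using e by auto
  have "(\<Prod>i\<in>S. x i powr e i) = exp (\<Sum>i\<in>S. e i *\<^sub>R ln (x i))"
    using x S by (auto simp: exp_sum powr_def less_imp_neq[symmetric] intro!: prod.cong)
  also have "\<dots> \<le> (\<Sum>i\<in>S. e i * exp (ln (x i)))"
    by (rule convex_on_sum[OF S ne exp_convex]) (use e in \<open>auto simp: less_imp_le\<close>)
  also have "\<dots> = (\<Sum>i\<in>S. e i * x i)"
    using x by simp
  finally show ?thesis .
qed

text \<open>Zero factors are treated before infinite ones: because \<open>0 * top = 0\<close>, a
  single zero factor annihilates the product whatever the others are.\<close>

lemma weighted_am_gm_ennreal: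
  assumes S: "finite S" and e: "\<And>i. i \<in> S \<Longrightarrow> 0 < e i" "sum e S = 1"
  shows "(\<Prod>i\<in>S. epow (x i) (e i)) \<le> (\<Sum>i\<in>S. ennreal (e i) * x i)"
proof (cases "\<exists>i\<in>S. x i = 0")
  case True
  then have "(\<Prod>i\<in>S. epow (x i) (e i)) = 0"
    using S e(1) by (intro prod_zero) (force dest: less_imp_neq)+
  then show ?thesis by (metis zero_le)
next
  case nz: False
  show ?thesis
  proof (cases "\<exists>i\<in>S. x i = top")
    case True
    then obtain i where i: "i \<in> S" "x i = top" by auto
    then have "ennreal (e i) * x i = top"
      using e(1)[OF i(1)] by (simp add: ennreal_mult_top)
    then have "(\<Sum>i\<in>S. ennreal (e i) * x i) = top"
      using S i by (auto intro!: bexI[of _ i])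
    then show ?thesis by simp
  next
    case False
    define y where "y i = enn2real (x i)" for i
    have xy: "x i = ennreal (y i)" "y i > 0" if "i \<in> S" for i
      using nz False that unfolding y_def
      by (auto simp: enn2real_positive_iff less_top zero_less_iff_neq_zero)
    have "(\<Prod>i\<in>S. epow (x i) (e i)) = (\<Prod>i\<in>S. ennreal (y i powr e i))"
      using xy e by (intro prod.cong) (auto simp: epow_ennreal less_imp_neq[symmetric] less_imp_le)
    also have "\<dots> = ennreal (\<Prod>i\<in>S. y i powr e i)"
      by (simp add: prod_ennreal)
    also have "\<dots> \<le> ennreal (\<Sum>i\<in>S. e i * y i)"
      by (intro ennreal_leI weighted_am_gm_pos) (use S e xy in auto)
    also have "\<dots> = (\<Sum>i\<in>S. ennreal (e i * y i))"
      using xy e by (subst sum_ennreal) (auto intro!: mult_nonneg_nonneg simp: less_imp_le)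
    also have "\<dots> = (\<Sum>i\<in>S. ennreal (e i) * x i)"
      using xy e by (intro sum.cong) (auto simp: ennreal_mult less_imp_le)
    finally show ?thesis .
  qed
qed

text \<open>Each \<open>F i\<close> is normalised to integral 1, and the pointwise
  arithmetic-geometric mean inequality is integrated. If some integral is 0, that factor vanishes
  almost everywhere and so does the left side; if none is 0 and one is infinite, the right side is
  \<open>top\<close>.\<close>

lemma Hoelder_prod_pos:
  assumes S: "finite S" and e: "\<And>i. i \<in> S \<Longrightarrow> 0 < e i" "sum e S = 1"
    and F [measurable]: "\<And>i. i \<in> S \<Longrightarrow> F i \<in> borel_measurable M"
  shows "(\<integral>\<^sup>+x. (\<Prod>i\<in>S. epow (F i x) (e i)) \<partial>M) \<le> (\<Prod>i\<in>S. epow (\<integral>\<^sup>+x. F i x \<partial>M) (e i))"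
proof -
  define c where "c i = (\<integral>\<^sup>+x. F i x \<partial>M)" for i
  have meas: "(\<lambda>x. \<Prod>i\<in>S. epow (F i x) (e i)) \<in> borel_measurable M"
    by measurable
  consider "\<exists>i\<in>S. c i = 0" | "\<forall>i\<in>S. c i \<noteq> 0" "\<exists>i\<in>S. c i = top"
    | "\<forall>i\<in>S. c i \<noteq> 0 \<and> c i \<noteq> top" by auto
  then show ?thesis
  proof cases
    case 1
    then obtain i where i: "i \<in> S" "c i = 0" by auto
    then have "AE x in M. F i x = 0"
      unfolding c_def by (subst (asm) nn_integral_0_iff_AE) auto
    then have "AE x in M. (\<Prod>i\<in>S. epow (F i x) (e i)) = 0"
      by eventually_elim (use i S e(1)[OF i(1)] in \<open>auto intro!: prod_zero bexI[of _ i]\<close>)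
    then have "(\<integral>\<^sup>+x. (\<Prod>i\<in>S. epow (F i x) (e i)) \<partial>M) = 0"
      by (subst nn_integral_0_iff_AE) (use meas in auto)
    then show ?thesis by (metis zero_le)
  next
    case 2
    then obtain i where i: "i \<in> S" "c i = top" by auto
    have "epow (c j) (e j) \<noteq> 0" if "j \<in> S" for j
      using 2(1) that e(1)[OF that]
      by (cases "c j") (auto simp: epow_ennreal)
    then have "(\<Prod>i\<in>S. epow (c i) (e i)) = top"
      using S i e(1)[OF i(1)] by (subst ennreal_prod_eq_top) (auto intro!: bexI[of _ i])
    then show ?thesis unfolding c_def by simp
  next
    case 3
    define d where "d i = enn2real (c i)" for i
    have cd: "c i = ennreal (d i)" "d i > 0" if "i \<in> S" for i
      using 3 that unfolding d_def
      by (auto simp: enn2real_positive_iff less_top zero_less_iff_neq_zero)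
    define G where "G i x = ennreal (1 / d i) * F i x" for i x
    have Gm[measurable]: "G i \<in> borel_measurable M" if "i \<in> S" for i
      unfolding G_def using that by measurable
    have F_G: "F i x = c i * G i x" if "i \<in> S" for i x
      unfolding G_def using cd[OF that] by (simp add: ennreal_mult[symmetric] mult.assoc[symmetric])
    have G1: "(\<integral>\<^sup>+x. G i x \<partial>M) = 1" if "i \<in> S" for i
      unfolding G_def using cd[OF that] that
      by (subst nn_integral_cmult) (auto simp: c_def[symmetric] ennreal_mult[symmetric])
    have "(\<integral>\<^sup>+x. (\<Prod>i\<in>S. epow (F i x) (e i)) \<partial>M)
        = (\<integral>\<^sup>+x. (\<Prod>i\<in>S. epow (c i) (e i)) * (\<Prod>i\<in>S. epow (G i x) (e i)) \<partial>M)"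
      by (intro nn_integral_cong) (simp add: F_G epow_mult prod.distrib)
    also have "\<dots> = (\<Prod>i\<in>S. epow (c i) (e i)) * (\<integral>\<^sup>+x. (\<Prod>i\<in>S. epow (G i x) (e i)) \<partial>M)"
      by (rule nn_integral_cmult) measurable
    also have "(\<integral>\<^sup>+x. (\<Prod>i\<in>S. epow (G i x) (e i)) \<partial>M) \<le> (\<integral>\<^sup>+x. (\<Sum>i\<in>S. ennreal (e i) * G i x) \<partial>M)"
      by (intro nn_integral_mono weighted_am_gm_ennreal) (use S e in auto)
    also have "\<dots> = (\<Sum>i\<in>S. ennreal (e i) * (\<integral>\<^sup>+x. G i x \<partial>M))"
      by (subst nn_integral_sum) (auto intro!: sum.cong nn_integral_cmult)
    also have "\<dots> = (\<Sum>i\<in>S. ennreal (e i))"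
      by (intro sum.cong) (auto simp: G1)
    also have "\<dots> = 1"
      using e by (subst sum_ennreal) (auto simp: less_imp_le)
    finally show ?thesis by (simp add: c_def mult_left_mono)
  qed
qed

text \<open>Factors with exponent 0 are constantly 1, even where the base is 0 or
  \<open>top\<close>, and can be discarded on both sides.\<close>

lemma Hoelder_prod:
  assumes S: "finite S" and e: "\<And>i. i \<in> S \<Longrightarrow> 0 \<le> e i" "sum e S = 1"
    and F: "\<And>i. i \<in> S \<Longrightarrow> F i \<in> borel_measurable M"
  shows "(\<integral>\<^sup>+x. (\<Prod>i\<in>S. epow (F i x) (e i)) \<partial>M) \<le> (\<Prod>i\<in>S. epow (\<integral>\<^sup>+x. F i x \<partial>M) (e i))"
proof -
  define S' where "S' = {i\<in>S. e i \<noteq> 0}"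
  have S': "finite S'" "S' \<subseteq> S" "\<And>i. i \<in> S - S' \<Longrightarrow> e i = 0" using S by (auto simp: S'_def)
  have *: "(\<Prod>i\<in>S. epow (X i) (e i)) = (\<Prod>i\<in>S'. epow (X i) (e i))" for X :: "_ \<Rightarrow> ennreal"
    using S' S by (intro prod.mono_neutral_right) auto
  have "sum e S' = 1"
    using e(2) S' S by (subst sum.mono_neutral_left[of S S']) auto
  then show ?thesis
    unfolding * using S'(1,2) e(1) F
    by (intro Hoelder_prod_pos) (auto simp: S'_def less_le)
qed

section \<open>Integration along lines in coordinate directions\<close>

definition line_int :: "'a::euclidean_space \<Rightarrow> ('a \<Rightarrow> ennreal) \<Rightarrow> 'a \<Rightarrow> ennreal" where
  "line_int b f x = (\<integral>\<^sup>+t. f (x + t *\<^sub>R b) \<partial>lborel)"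

lemma measurable_line_int [measurable]:
  assumes [measurable]: "f \<in> borel_measurable borel"
  shows "line_int b f \<in> borel_measurable borel"
  unfolding line_int_def by measurable

lemma line_int_shift:
  assumes [measurable]: "f \<in> borel_measurable borel"
  shows "line_int b f (x + t *\<^sub>R b) = line_int b f x"
proof -
  have "line_int b f x = (\<integral>\<^sup>+r. f (x + (t + 1 * r) *\<^sub>R b) \<partial>lborel)"
    unfolding line_int_def
    by (subst nn_integral_real_affine[where c=1 and t=t]) auto
  then show ?thesis
    by (simp add: line_int_def scaleR_left_distrib add.assoc)
qed

lemma line_int_commute:
  assumes [measurable]: "f \<in> borel_measurable borel"
  shows "line_int a (line_int b f) x = line_int b (line_int a f) x"
proof -
  have "line_int a (line_int b f) x = (\<integral>\<^sup>+t. \<integral>\<^sup>+r. f (x + t *\<^sub>R a + r *\<^sub>R b) \<partial>lborel \<partial>lborel)"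
    by (simp add: line_int_def)
  also have "\<dots> = (\<integral>\<^sup>+r. \<integral>\<^sup>+t. f (x + t *\<^sub>R a + r *\<^sub>R b) \<partial>lborel \<partial>lborel)"
    by (rule lborel_pair.Fubini') measurable
  also have "\<dots> = line_int b (line_int a f) x"
    by (simp add: line_int_def add_ac)
  finally show ?thesis .
qed

lemma line_int_mono: "(\<And>x. f x \<le> g x) \<Longrightarrow> line_int b f x \<le> line_int b g x"
  unfolding line_int_def by (intro nn_integral_mono)

text \<open>The base point stays an argument, so directions can be integrated out one by one without
  splitting the space into a product. After all of \<open>Basis\<close> the result no longer depends
  on it (\<open>lines_int_Basis\<close>).\<close>

fun lines_int :: "'a::euclidean_space list \<Rightarrow> ('a \<Rightarrow> ennreal) \<Rightarrow> 'a \<Rightarrow> ennreal" where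
  "lines_int [] f = f"
| "lines_int (b # bs) f = lines_int bs (line_int b f)"

lemma lines_int_mono: "(\<And>x. f x \<le> g x) \<Longrightarrow> lines_int bs f x \<le> lines_int bs g x"
  by (induction bs arbitrary: f g) (simp_all add: line_int_mono)

lemma lines_int_PiM:
  assumes "distinct bs" "set bs \<subseteq> Basis" "f \<in> borel_measurable borel"
  shows "lines_int bs f x = (\<integral>\<^sup>+y. f (x + (\<Sum>b\<in>set bs. y b *\<^sub>R b)) \<partial>(\<Pi>\<^sub>M b\<in>set bs. lborel))"
  using assms
proof (induction bs arbitrary: f)
  case Nil
  interpret product_sigma_finite "\<lambda>_::'a. lborel :: real measure" ..
  from Nil show ?case by (simp add: PiM_empty nn_integral_count_space_finite)
next
  case (Cons b bs)
  interpret product_sigma_finite "\<lambda>_::'a. lborel :: real measure" ..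
  note [measurable] = Cons.prems(3)
  have b: "b \<notin> set bs" using Cons.prems by auto
  have m: "(\<lambda>y. f (x + (\<Sum>c\<in>insert b (set bs). y c *\<^sub>R c))) \<in> borel_measurable (\<Pi>\<^sub>M b\<in>insert b (set bs). lborel)"
    by measurable
  have "(\<integral>\<^sup>+y. f (x + (\<Sum>c\<in>set (b # bs). y c *\<^sub>R c)) \<partial>(\<Pi>\<^sub>M b\<in>set (b # bs). lborel))
     = (\<integral>\<^sup>+y. \<integral>\<^sup>+t. f (x + (\<Sum>c\<in>insert b (set bs). (y(b := t)) c *\<^sub>R c)) \<partial>lborel \<partial>(\<Pi>\<^sub>M b\<in>set bs. lborel))"
    using product_nn_integral_insert[OF _ b m] by simp
  also have "\<dots> = (\<integral>\<^sup>+y. line_int b f (x + (\<Sum>c\<in>set bs. y c *\<^sub>R c)) \<partial>(\<Pi>\<^sub>M b\<in>set bs. lborel))"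
  proof (intro nn_integral_cong)
    fix y :: "'a \<Rightarrow> real"
    have "(\<Sum>c\<in>insert b (set bs). (y(b := t)) c *\<^sub>R c) = t *\<^sub>R b + (\<Sum>c\<in>set bs. y c *\<^sub>R c)" for t
      using b by (simp, intro sum.cong) auto
    then show "(\<integral>\<^sup>+t. f (x + (\<Sum>c\<in>insert b (set bs). (y(b := t)) c *\<^sub>R c)) \<partial>lborel)
        = line_int b f (x + (\<Sum>c\<in>set bs. y c *\<^sub>R c))"
      by (simp only: line_int_def) (simp add: add_ac)
  qed
  also have "\<dots> = lines_int (b # bs) f x"
    using Cons by simp
  finally show ?case by simp
qed

lemma lines_int_Basis:
  assumes "distinct bs" "set bs = Basis" and [measurable]: "f \<in> borel_measurable borel"
  shows "lines_int bs f x = (\<integral>\<^sup>+y. f y \<partial>lborel)"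
proof -
  have "lines_int bs f x = (\<integral>\<^sup>+y. f (x + (\<Sum>b\<in>Basis. y b *\<^sub>R b)) \<partial>(\<Pi>\<^sub>M b\<in>Basis. lborel))"
    using lines_int_PiM[of bs f x] assms by simp
  also have "\<dots> = (\<integral>\<^sup>+y. f (x + y) \<partial>lborel)"
    by (subst lborel_eq) (simp add: nn_integral_distr)
  also have "\<dots> = (\<integral>\<^sup>+y. f y \<partial>distr lborel borel ((+) x))"
    by (simp add: nn_integral_distr)
  finally show ?thesis by (simp add: lborel_distr_plus)
qed

text \<open>Integrating out one direction at a time, with Hoelder's inequality on each line, bounds
  this functional by a power of the full integral.\<close>

definition grid_lines :: "real \<Rightarrow> ('a::euclidean_space \<Rightarrow> ennreal) \<Rightarrow> 'a list \<Rightarrow> 'a \<Rightarrow> ennreal" where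
  "grid_lines p f bs = lines_int bs
     (\<lambda>x. epow (f x) (1 - (real (length bs) - 1) * p) * (\<Prod>j\<in>set bs. epow (line_int j f x) p))"

text \<open>Along direction \<open>b\<close> the factor \<open>line_int b f\<close> is constant and
  leaves the integral. What remains is \<open>f\<close> with weight \<open>q\<close> and
  \<open>length bs\<close> line integrals with weight \<open>p\<close> each; the weights sum to 1,
  so Hoelder applies. As line integrals commute, each factor becomes a line integral of
  \<open>line_int b f\<close>, and the extracted power \<open>p\<close> joins \<open>q\<close> to
  form the exponent belonging to the shorter list.\<close>

lemma grid_lines_Cons_le:
  assumes d: "distinct (b # bs)" and p: "0 \<le> p" "real (length bs) * p \<le> 1"
    and f[measurable]: "f \<in> borel_measurable borel"
  shows "grid_lines p f (b # bs) x \<le> grid_lines p (line_int b f) bs x"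
proof -
  define q where "q = 1 - real (length bs) * p"
  have q: "0 \<le> q" using p by (simp add: q_def)
  have "line_int b (\<lambda>x. epow (f x) q * (\<Prod>j\<in>set (b # bs). epow (line_int j f x) p)) x
      \<le> epow (line_int b f x) (q + p) * (\<Prod>j\<in>set bs. epow (line_int j (line_int b f) x) p)" for x
  proof -
    \<comment> \<open>The index \<open>None\<close> stands for \<open>f\<close> itself with weight
      \<open>q\<close>, and \<open>Some j\<close> for its line integral in direction
      \<open>j\<close> with weight \<open>p\<close>.\<close>
    define S where "S = insert None (Some ` set bs)"
    define F where "F i t = (case i of None \<Rightarrow> f (x + t *\<^sub>R b) | Some j \<Rightarrow> line_int j f (x + t *\<^sub>R b))" for i t
    define e where "e i = (case i of None \<Rightarrow> q | Some j \<Rightarrow> p)" for i :: "'a option"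
    have S: "finite S" by (simp add: S_def)
    have sumS: "sum g S = g None + (\<Sum>j\<in>set bs. g (Some j))" for g :: "_ \<Rightarrow> real"
      by (simp add: S_def sum.reindex)
    have prodS: "prod g S = g None * (\<Prod>j\<in>set bs. g (Some j))" for g :: "_ \<Rightarrow> ennreal"
      by (simp add: S_def prod.reindex)
    have "line_int b (\<lambda>x. epow (f x) q * (\<Prod>j\<in>set (b # bs). epow (line_int j f x) p)) x
       = (\<integral>\<^sup>+t. epow (line_int b f x) p * (\<Prod>i\<in>S. epow (F i t) (e i)) \<partial>lborel)"
      unfolding line_int_def[of b "\<lambda>x. epow (f x) q * _ x"]
      using d by (intro nn_integral_cong) (simp add: prodS F_def e_def line_int_shift mult_ac)
    also have "\<dots> = epow (line_int b f x) p * (\<integral>\<^sup>+t. (\<Prod>i\<in>S. epow (F i t) (e i)) \<partial>lborel)"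
      by (rule nn_integral_cmult) (auto simp: prodS F_def e_def)
    also have "\<dots> \<le> epow (line_int b f x) p * (\<Prod>i\<in>S. epow (\<integral>\<^sup>+t. F i t \<partial>lborel) (e i))"
    proof (rule mult_left_mono[OF Hoelder_prod[OF S]])
      show "sum e S = 1"
        using d by (simp add: sumS e_def q_def distinct_card)
      show "F i \<in> borel_measurable lborel" for i
        unfolding F_def by (cases i) simp_all
    qed (use p q in \<open>auto simp: e_def split: option.splits\<close>)
    also have "(\<Prod>i\<in>S. epow (\<integral>\<^sup>+t. F i t \<partial>lborel) (e i))
        = epow (line_int b f x) q * (\<Prod>j\<in>set bs. epow (line_int j (line_int b f) x) p)"
      by (simp add: prodS F_def e_def line_int_def[symmetric] line_int_commute[of f b])
    finally show ?thesis
      using p q by (simp add: epow_add mult_ac)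
  qed
  then show ?thesis
    unfolding grid_lines_def q_def
    by (auto intro!: lines_int_mono simp: algebra_simps)
qed

text \<open>For the empty list the exponent of \<open>f\<close> in \<open>grid_lines\<close> is
  \<open>1 - (0 - 1) * p = 1 + p\<close>; this is the exponent on the right.\<close>

lemma grid_lines_le:
  assumes "distinct bs" "0 \<le> p" "(real (length bs) - 1) * p \<le> 1" "f \<in> borel_measurable borel"
  shows "grid_lines p f bs x \<le> epow (lines_int bs f x) (1 + p)"
  using assms
proof (induction bs arbitrary: f)
  case (Cons b bs)
  have "grid_lines p f (b # bs) x \<le> grid_lines p (line_int b f) bs x"
    by (rule grid_lines_Cons_le) (use Cons.prems in auto)
  also have "\<dots> \<le> epow (lines_int bs (line_int b f) x) (1 + p)"
    using Cons.prems by (intro Cons.IH) (auto simp: algebra_simps)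
  finally show ?case by simp
qed (simp add: grid_lines_def)

text \<open>The power N/(N-1) of \<open>g x\<close> is a product of N equal factors, one per
  direction, and each factor is estimated by the line integral in its own direction.\<close>

lemma Gagliardo_Nirenberg_lines:
  fixes f g :: "'a::euclidean_space \<Rightarrow> ennreal"
  assumes dim: "DIM('a) \<ge> 2" and f[measurable]: "f \<in> borel_measurable borel"
    and gm: "g \<in> borel_measurable borel"
    and g: "\<And>b x. b \<in> Basis \<Longrightarrow> g x \<le> line_int b f x"
  shows "(\<integral>\<^sup>+x. epow (g x) (real DIM('a) / (real DIM('a) - 1)) \<partial>lborel)
    \<le> epow (\<integral>\<^sup>+x. f x \<partial>lborel) (real DIM('a) / (real DIM('a) - 1))"
proof -
  define N where "N = real DIM('a)"
  have N: "N \<ge> 2" using dim by (simp add: N_def)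
  \<comment> \<open>With this \<open>p\<close> the exponent \<open>1 - (N - 1) * p\<close> of
    \<open>f\<close> itself in \<open>grid_lines\<close> is 0, so only the line integrals
    remain.\<close>
  define p where "p = 1 / (N - 1)"
  obtain bs :: "'a list" where bs: "set bs = Basis" "distinct bs"
    using finite_distinct_list[OF finite_Basis] by auto
  have len: "real (length bs) = N"
    using bs distinct_card[of bs] by (simp add: N_def)
  have p: "0 \<le> p" "(N - 1) * p = 1" "N / (N - 1) = 1 + p" "N * p = 1 + p"
    using N by (auto simp: p_def field_simps)
  have "epow (g x) (1 + p) \<le> (\<Prod>j\<in>Basis. epow (line_int j f x) p)" for x
  proof -
    have "epow (g x) (N * p) = (\<Prod>j\<in>(Basis :: 'a set). epow (g x) p)"
    proof -
      have "epow y (real n * p) = epow y p ^ n" for y n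
        using p(1) by (induction n) (simp_all add: ring_distribs epow_add)
      then show ?thesis by (simp add: N_def)
    qed
    also have "\<dots> \<le> (\<Prod>j\<in>Basis. epow (line_int j f x) p)"
      by (intro prod_mono_ennreal) (auto intro!: epow_mono g p)
    finally show ?thesis by (simp add: p)
  qed
  then have "lines_int bs (\<lambda>x. epow (g x) (1 + p)) 0 \<le> lines_int bs (\<lambda>x. \<Prod>j\<in>Basis. epow (line_int j f x) p) 0"
    by (rule lines_int_mono)
  also have "\<dots> = grid_lines p f bs 0"
    by (simp add: grid_lines_def len p bs)
  also have "\<dots> \<le> epow (lines_int bs f 0) (1 + p)"
    by (rule grid_lines_le) (use bs p len in auto)
  finally have *: "lines_int bs (\<lambda>x. epow (g x) (1 + p)) 0 \<le> epow (\<integral>\<^sup>+x. f x \<partial>lborel) (1 + p)"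
    by (simp add: lines_int_Basis bs)
  have "(\<lambda>x. epow (g x) (1 + p)) \<in> borel_measurable borel" using gm by simp
  with * bs show ?thesis
    by (simp add: lines_int_Basis p(3) flip: N_def)
qed

subsection \<open>Smooth functions and test functions\<close>

text \<open>Exponents appear as weights \<open>a\<close> and \<open>1 - a\<close> on integrable
  functions, in place of conjugate exponents. Young's inequality supplies the integrable majorant
  \<open>a * F + (1 - a) * G\<close>; applied to \<open>F / c\<close> and \<open>G / d\<close>, it
  supplies the estimate.\<close>

lemma Hoelder_powr:
  fixes F G :: "'b \<Rightarrow> real"
  assumes F: "integrable M F" "AE x in M. 0 \<le> F x" and G: "integrable M G" "AE x in M. 0 \<le> G x"
    and a: "0 < a" "a < 1"
  shows "integrable M (\<lambda>x. F x powr a * G x powr (1 - a))"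
    and "(\<integral>x. F x powr a * G x powr (1 - a) \<partial>M) \<le> (\<integral>x. F x \<partial>M) powr a * (\<integral>x. G x \<partial>M) powr (1 - a)"
proof -
  note [measurable] = borel_measurable_integrable[OF F(1)] borel_measurable_integrable[OF G(1)]
  have young: "s powr a * t powr (1 - a) \<le> a * s + (1 - a) * t" if "0 \<le> s" "0 \<le> t" for s t
  proof (cases "s = 0 \<or> t = 0")
    case False
    then show ?thesis using Youngs_inequality_0[of a "1 - a" s t] a that by simp
  qed (use a that in auto)
  show int: "integrable M (\<lambda>x. F x powr a * G x powr (1 - a))"
  proof (rule Bochner_Integration.integrable_bound)
    show "integrable M (\<lambda>x. a * F x + (1 - a) * G x)" using F G by auto
    show "AE x in M. norm (F x powr a * G x powr (1 - a)) \<le> norm (a * F x + (1 - a) * G x)"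
      using F(2) G(2) by eventually_elim (use young in force)
  qed measurable
  define c d where "c = (\<integral>x. F x \<partial>M)" and "d = (\<integral>x. G x \<partial>M)"
  have nn: "0 \<le> c" "0 \<le> d" unfolding c_def d_def using F G by (auto intro: integral_nonneg_AE)
  show "(\<integral>x. F x powr a * G x powr (1 - a) \<partial>M) \<le> (\<integral>x. F x \<partial>M) powr a * (\<integral>x. G x \<partial>M) powr (1 - a)"
  proof (cases "c = 0 \<or> d = 0")
    case True
    then have "(AE x in M. F x = 0) \<or> (AE x in M. G x = 0)"
      unfolding c_def d_def using F G by (simp add: integral_nonneg_eq_0_iff_AE)
    then have "AE x in M. F x powr a * G x powr (1 - a) = 0"
      by (auto elim: eventually_mono)
    then have "(\<integral>x. F x powr a * G x powr (1 - a) \<partial>M) = 0"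
      by (rule integral_eq_zero_AE)
    then show ?thesis by simp
  next
    case False
    with nn have pos: "0 < c" "0 < d" by auto
    have "(\<integral>x. F x powr a * G x powr (1 - a) \<partial>M)
        \<le> (\<integral>x. c powr a * d powr (1 - a) * (a * (F x / c) + (1 - a) * (G x / d)) \<partial>M)"
    proof (rule integral_mono_AE[OF int])
      show "AE x in M. F x powr a * G x powr (1 - a)
        \<le> c powr a * d powr (1 - a) * (a * (F x / c) + (1 - a) * (G x / d))"
        using F(2) G(2)
      proof eventually_elim
        case (elim x)
        have "F x powr a * G x powr (1 - a)
            = c powr a * d powr (1 - a) * ((F x / c) powr a * (G x / d) powr (1 - a))"
          using elim pos by (simp add: powr_divide)
        also have "\<dots> \<le> c powr a * d powr (1 - a) * (a * (F x / c) + (1 - a) * (G x / d))"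
          by (intro mult_left_mono young) (use elim pos in auto)
        finally show ?case .
      qed
    qed (use F G in auto)
    also have "\<dots> = c powr a * d powr (1 - a) * (a * ((\<integral>x. F x \<partial>M) / c) + (1 - a) * ((\<integral>x. G x \<partial>M) / d))"
      using F G by (simp add: integral_add)
    also have "\<dots> = c powr a * d powr (1 - a)"
      using pos by (simp flip: c_def d_def)
    finally show ?thesis by (simp add: c_def d_def)
  qed
qed

section \<open>Rules for functions with continuous partial derivatives\<close>

lemma Ck_on_SucI:
  assumes "\<And>x. (g has_derivative D x) (at x)" "\<And>b. b \<in> Basis \<Longrightarrow> Ck_on k UNIV (\<lambda>x. D x b)"
  shows "Ck_on (Suc k) UNIV g"
proof -
  have "frechet_derivative g (at x) = D x" for x
    using frechet_derivative_at[OF assms(1)] by simp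
  with assms show ?thesis by (auto simp: differentiable_def)
qed

lemma Ck_on_has_derivative:
  "Ck_on (Suc k) UNIV g \<Longrightarrow> (g has_derivative frechet_derivative g (at x)) (at x)"
  by (simp add: frechet_derivative_works)

lemma Ck_on_Suc_imp: "Ck_on (Suc k) UNIV g \<Longrightarrow> Ck_on k UNIV g"
proof (induction k arbitrary: g)
  case 0
  then show ?case
    by (auto intro!: continuous_at_imp_continuous_on differentiable_imp_continuous_within)
qed simp

lemma Ck_on_const [simp]: "Ck_on k UNIV (\<lambda>x. c)"
proof (induction k arbitrary: c)
  case (Suc k)
  show ?case by (rule Ck_on_SucI[where D = "\<lambda>_ _. 0"]) (auto intro: Suc)
qed simp

lemma Ck_on_inner: "Ck_on k UNIV (\<lambda>x. x \<bullet> c)"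
proof (cases k)
  case (Suc k')
  show ?thesis unfolding Suc
    by (rule Ck_on_SucI[where D = "\<lambda>_ h. h \<bullet> c"]) (auto intro!: derivative_eq_intros)
qed (simp add: continuous_on_inner)

lemma Ck_on_add:
  assumes "Ck_on k UNIV f" "Ck_on k UNIV g"
  shows "Ck_on k UNIV (\<lambda>x. f x + g x)"
  using assms
proof (induction k arbitrary: f g)
  case (Suc k)
  show ?case
    by (rule Ck_on_SucI[OF has_derivative_add[OF Ck_on_has_derivative[OF Suc.prems(1)]
          Ck_on_has_derivative[OF Suc.prems(2)]]]) (use Suc in auto)
qed (simp add: continuous_on_add)

lemma Ck_on_mult:
  assumes "Ck_on k UNIV f" "Ck_on k UNIV g"
  shows "Ck_on k UNIV (\<lambda>x. f x * g x)"
  using assms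
proof (induction k arbitrary: f g)
  case (Suc k)
  show ?case
  proof (rule Ck_on_SucI[OF has_derivative_mult[OF Ck_on_has_derivative[OF Suc.prems(1)]
          Ck_on_has_derivative[OF Suc.prems(2)]]])
    fix b :: 'a assume "b \<in> Basis"
    with Suc.prems show "Ck_on k UNIV (\<lambda>x. f x * frechet_derivative g (at x) b + frechet_derivative f (at x) b * g x)"
      by (intro Ck_on_add Suc.IH Ck_on_Suc_imp[OF Suc.prems(1)] Ck_on_Suc_imp[OF Suc.prems(2)]) auto
  qed
qed (simp add: continuous_on_mult)

lemma Ck_on_prod: "(\<And>i. i \<in> I \<Longrightarrow> Ck_on k UNIV (f i)) \<Longrightarrow> Ck_on k UNIV (\<lambda>x. \<Prod>i\<in>I. f i x)"
  by (induction I rule: infinite_finite_induct) (auto intro: Ck_on_mult)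

text \<open>A smooth function of one real variable is handled as the sequence of all its
  derivatives, so that smoothness of a composition follows by induction on the order with the index
  \<open>n\<close> arbitrary.\<close>

definition deriv_seq :: "(nat \<Rightarrow> real \<Rightarrow> real) \<Rightarrow> bool" where
  "deriv_seq D \<longleftrightarrow> (\<forall>n t. (D n has_real_derivative D (Suc n) t) (at t))"

lemma Ck_on_compose:
  assumes D: "deriv_seq D" and "Ck_on k UNIV \<phi>"
  shows "Ck_on k UNIV (\<lambda>x. D n (\<phi> x))"
  using assms(2)
proof (induction k arbitrary: n)
  case 0
  have "continuous_on UNIV (D n)"
    using D by (auto simp: deriv_seq_def intro!: continuous_at_imp_continuous_on DERIV_isCont)
  with 0 show ?case
    using continuous_on_compose2[of UNIV "D n" UNIV \<phi>] by auto
next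
  case (Suc k)
  show ?case
  proof (rule Ck_on_SucI)
    show "((\<lambda>x. D n (\<phi> x)) has_derivative (\<lambda>h. D (Suc n) (\<phi> x) * frechet_derivative \<phi> (at x) h)) (at x)" for x
      using has_derivative_compose[OF Ck_on_has_derivative[OF Suc.prems, of x],
          of "D n" "\<lambda>h. D (Suc n) (\<phi> x) * h"] D
      by (simp add: deriv_seq_def has_field_derivative_def)
    show "Ck_on k UNIV (\<lambda>x. D (Suc n) (\<phi> x) * frechet_derivative \<phi> (at x) b)" if "b \<in> Basis" for b
      using Suc.prems that by (intro Ck_on_mult Suc.IH Ck_on_Suc_imp[OF Suc.prems]) auto
  qed
qed

text \<open>Since the derivative of tanh is 1 - tanh^2, the derivative of Q(tanh) is again a
  polynomial in tanh, with Q replaced by Q' (1 - X^2).\<close>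

lemma deriv_seq_poly_tanh:
  "deriv_seq (\<lambda>n t. poly (((\<lambda>Q. pderiv Q * [:1, 0, -1:]) ^^ n) P) (tanh t))"
  unfolding deriv_seq_def
proof (intro allI)
  fix n t
  define Q where "Q = ((\<lambda>Q. pderiv Q * [:1, 0, -1:]) ^^ n) P"
  have "((\<lambda>t. poly Q (tanh t)) has_real_derivative poly (pderiv Q) (tanh t) * (1 - tanh t ^ 2)) (at t)"
    by (rule DERIV_chain2[OF poly_DERIV]) (auto intro!: derivative_eq_intros)
  then show "((\<lambda>t. poly (((\<lambda>Q. pderiv Q * [:1, 0, -1:]) ^^ n) P) (tanh t)) has_real_derivative
      poly (((\<lambda>Q. pderiv Q * [:1, 0, -1:]) ^^ Suc n) P) (tanh t)) (at t)"
    unfolding Q_def[symmetric] funpow.simps comp_def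
    by (simp add: power2_eq_square algebra_simps)
qed

lemma poly_times_exp_tendsto_0:
  fixes c :: real assumes c: "c > 0"
  shows "((\<lambda>s. poly P s * exp (- (c * s))) \<longlongrightarrow> 0) at_top"
proof -
  have 1: "((\<lambda>s. s ^ k * exp (- (c * s))) \<longlongrightarrow> 0) at_top" for k
  proof -
    have "filterlim (\<lambda>s. c * s) at_top at_top"
      using c by (simp add: filterlim_tendsto_pos_mult_at_top[OF tendsto_const] filterlim_ident)
    from filterlim_compose[OF tendsto_power_div_exp_0[of k] this]
    have "((\<lambda>s. (1 / c ^ k) * ((c * s) ^ k / exp (c * s))) \<longlongrightarrow> (1 / c ^ k) * 0) at_top"
      by (intro tendsto_intros)
    then show ?thesis using c by (simp add: power_mult_distrib exp_minus field_simps)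
  qed
  have "((\<lambda>s. \<Sum>i\<le>degree P. coeff P i * (s ^ i * exp (- (c * s)))) \<longlongrightarrow> (\<Sum>i\<le>degree P. coeff P i * 0)) at_top"
    by (intro tendsto_sum tendsto_mult tendsto_const 1)
  then show ?thesis by (simp add: poly_altdef sum_distrib_right mult.assoc)
qed

text \<open>The n-th derivative of the flat function exp(-c/t), extended by 0 to t \<le> 0. It has
  the form P(1/t) exp(-c/t), and differentiation replaces P by (c P - P') X^2.\<close>

definition exp_cutoff :: "real \<Rightarrow> nat \<Rightarrow> real \<Rightarrow> real" where
  "exp_cutoff c n t = (if t > 0
     then poly (((\<lambda>Q. (smult c Q - pderiv Q) * [:0, 0, 1:]) ^^ n) 1) (1 / t) * exp (- (c * (1 / t))) else 0)"

lemma deriv_seq_exp_cutoff: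
  assumes c: "c > 0"
  shows "deriv_seq (exp_cutoff c)"
  unfolding deriv_seq_def
proof (intro allI)
  fix n :: nat and t :: real
  define P where "P = ((\<lambda>Q. (smult c Q - pderiv Q) * [:0, 0, 1:]) ^^ n) 1"
  have E: "exp_cutoff c n t = (if t > 0 then poly P (1 / t) * exp (- (c * (1 / t))) else 0)" for t
    by (simp add: exp_cutoff_def P_def)
  have E': "exp_cutoff c (Suc n) t
      = (if t > 0 then poly ((smult c P - pderiv P) * [:0, 0, 1:]) (1 / t) * exp (- (c * (1 / t))) else 0)" for t
    by (simp add: exp_cutoff_def P_def)
  consider "t > 0" | "t < 0" | "t = 0" by linarith
  then show "(exp_cutoff c n has_real_derivative exp_cutoff c (Suc n) t) (at t)"
  proof cases
    case 1
    have "((\<lambda>t. poly P (1 / t) * exp (- (c * (1 / t)))) has_real_derivative exp_cutoff c (Suc n) t) (at t)"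
      using 1 unfolding E'
      by (auto intro!: derivative_eq_intros DERIV_chain2[OF poly_DERIV] simp: power2_eq_square algebra_simps)
    then show ?thesis
      by (rule has_field_derivative_transform_within_open[where S = "{0<..}"]) (use 1 in \<open>auto simp: E\<close>)
  next
    case 2
    have "((\<lambda>t. 0) has_real_derivative exp_cutoff c (Suc n) t) (at t)"
      using 2 by (simp add: E')
    then show ?thesis
      by (rule has_field_derivative_transform_within_open[where S = "{..<0}"]) (use 2 in \<open>auto simp: E\<close>)
  next
    case 3
    \<comment> \<open>Dividing by \<open>h\<close> multiplies the polynomial in \<open>1 / h\<close>
      by X. So the difference quotient at 0 is of the same type and is beaten by the
      exponential.\<close>
    have "((\<lambda>h. poly ([:0, 1:] * P) (inverse h) * exp (- (c * inverse h))) \<longlongrightarrow> 0) (at_right 0)"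
      using filterlim_compose[OF poly_times_exp_tendsto_0[OF c] filterlim_inverse_at_top_right] .
    then have "((\<lambda>h. exp_cutoff c n h / h) \<longlongrightarrow> 0) (at_right 0)"
      by (rule Lim_transform_eventually) (auto simp: E eventually_at_filter divide_inverse mult_ac)
    moreover have "((\<lambda>h. exp_cutoff c n h / h) \<longlongrightarrow> 0) (at_left 0)"
      by (rule tendsto_eventually) (auto simp: E eventually_at_filter)
    ultimately have "((\<lambda>h. exp_cutoff c n h / h) \<longlongrightarrow> 0) (at 0)"
      by (simp add: filterlim_at_split)
    then show ?thesis
      using 3 by (simp add: DERIV_def E E')
  qed
qed

lemma exp_cutoff_0: "exp_cutoff c 0 t = (if t > 0 then exp (- (c / t)) else 0)"
  by (simp add: exp_cutoff_def)

section \<open>Test functions, their gradients and their bounds\<close>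

lemma compact_support_in_subset:
  assumes "compact_support_in \<Omega> \<phi>" "\<And>x. \<phi> x = 0 \<Longrightarrow> \<psi> x = 0"
  shows "compact_support_in \<Omega> \<psi>"
proof -
  have *: "closure {x. \<psi> x \<noteq> 0} \<subseteq> closure {x. \<phi> x \<noteq> 0}"
    using assms(2) by (intro closure_mono) auto
  then have "closure {x. \<psi> x \<noteq> 0} = closure {x. \<phi> x \<noteq> 0} \<inter> closure {x. \<psi> x \<noteq> 0}"
    by auto
  moreover have "compact (closure {x. \<phi> x \<noteq> 0} \<inter> closure {x. \<psi> x \<noteq> 0})"
    using assms(1) by (intro compact_Int_closed) (auto simp: compact_support_in_def)
  ultimately show ?thesis
    using assms(1) * by (auto simp: compact_support_in_def)
qed

lemma Cc_infty_compose:
  assumes "deriv_seq D" "D 0 0 = 0" "\<phi> \<in> Cc_infty \<Omega>"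
  shows "(\<lambda>x. D 0 (\<phi> x)) \<in> Cc_infty \<Omega>"
  using assms compact_support_in_subset[of \<Omega> \<phi> "\<lambda>x. D 0 (\<phi> x)"]
  by (simp add: Cc_infty_def smooth_on_def Ck_on_compose)

lemma Cc_infty_subset_Cc1: "Cc_infty \<Omega> \<subseteq> Cc1 \<Omega>"
  by (auto simp: Cc_infty_def Cc1_def smooth_on_def simp del: Ck_on.simps)

lemma grad_eqI:
  assumes "(f has_derivative (\<lambda>h. D \<bullet> h)) (at x)"
  shows "grad f x = D"
  unfolding grad_def frechet_derivative_at[OF assms, symmetric]
  by (simp add: euclidean_representation)

lemma has_derivative_grad:
  assumes "Ck_on (Suc 0) UNIV \<phi>"
  shows "(\<phi> has_derivative (\<lambda>h. grad \<phi> x \<bullet> h)) (at x)"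
proof -
  define L where "L = frechet_derivative \<phi> (at x)"
  have *: "(\<phi> has_derivative L) (at x)"
    using Ck_on_has_derivative[OF assms] by (simp add: L_def)
  interpret bounded_linear L using * by (rule has_derivative_bounded_linear)
  have "L h = grad \<phi> x \<bullet> h" for h
  proof -
    have "L h = L (\<Sum>b\<in>Basis. (h \<bullet> b) *\<^sub>R b)" by (simp add: euclidean_representation)
    also have "\<dots> = (\<Sum>b\<in>Basis. (h \<bullet> b) * L b)" by (simp add: sum scaleR)
    also have "\<dots> = grad \<phi> x \<bullet> h"
      by (simp add: grad_def L_def inner_sum_right inner_commute[of _ h] mult.commute)
    finally show ?thesis .
  qed
  with * show ?thesis by (metis ext)
qed

lemma continuous_on_grad:
  assumes "Ck_on (Suc 0) UNIV \<phi>"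
  shows "continuous_on UNIV (grad \<phi>)"
  using assms unfolding grad_def[abs_def]
  by (intro continuous_on_sum continuous_on_scaleR continuous_on_const) simp_all

lemma Ck_on_1I:
  assumes "\<And>x. (\<phi> has_derivative (\<lambda>h. D x \<bullet> h)) (at x)" "continuous_on UNIV D"
  shows "Ck_on (Suc 0) UNIV \<phi>"
  by (rule Ck_on_SucI[OF assms(1)]) (simp add: continuous_on_inner assms)

lemma Cc1_compose:
  assumes G: "\<And>t. (G has_real_derivative G' t) (at t)" "continuous_on UNIV G'" "G 0 = 0"
    and \<phi>: "\<phi> \<in> Cc1 \<Omega>"
  shows "(\<lambda>x. G (\<phi> x)) \<in> Cc1 \<Omega>" "grad (\<lambda>x. G (\<phi> x)) x = G' (\<phi> x) *\<^sub>R grad \<phi> x"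
proof -
  have C: "Ck_on (Suc 0) UNIV \<phi>" using \<phi> by (simp add: Cc1_def del: Ck_on.simps)
  have D: "((\<lambda>x. G (\<phi> x)) has_derivative (\<lambda>h. (G' (\<phi> x) *\<^sub>R grad \<phi> x) \<bullet> h)) (at x)" for x
    using has_derivative_compose[OF has_derivative_grad[OF C, of x], of G "\<lambda>h. G' (\<phi> x) * h"] G(1)
    by (simp add: has_field_derivative_def)
  have cont: "continuous_on UNIV (\<lambda>x. G' (\<phi> x) *\<^sub>R grad \<phi> x)"
    using Ck_on_Suc_imp[OF C]
    by (intro continuous_intros continuous_on_grad C continuous_on_compose2[OF G(2)]) auto
  show "(\<lambda>x. G (\<phi> x)) \<in> Cc1 \<Omega>"
    using Ck_on_1I[OF D cont] \<phi> G(3) compact_support_in_subset[of \<Omega> \<phi> "\<lambda>x. G (\<phi> x)"]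
    by (simp add: Cc1_def del: Ck_on.simps)
  show "grad (\<lambda>x. G (\<phi> x)) x = G' (\<phi> x) *\<^sub>R grad \<phi> x"
    by (rule grad_eqI[OF D])
qed

lemma Cc1_facts:
  assumes \<phi>: "\<phi> \<in> Cc1 \<Omega>"
  shows "continuous_on UNIV \<phi>" "continuous_on UNIV (grad \<phi>)"
    and "\<phi> \<in> borel_measurable borel" "grad \<phi> \<in> borel_measurable borel"
    and "\<And>x. (\<phi> has_derivative (\<lambda>h. grad \<phi> x \<bullet> h)) (at x)"
    and "\<And>x. x \<notin> \<Omega> \<Longrightarrow> \<phi> x = 0" "\<And>x. x \<notin> \<Omega> \<Longrightarrow> grad \<phi> x = 0"
proof -
  have C: "Ck_on (Suc 0) UNIV \<phi>" using \<phi> by (simp add: Cc1_def del: Ck_on.simps)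
  show 1: "continuous_on UNIV \<phi>" "continuous_on UNIV (grad \<phi>)"
    using Ck_on_Suc_imp[OF C] continuous_on_grad[OF C] by auto
  then show "\<phi> \<in> borel_measurable borel" "grad \<phi> \<in> borel_measurable borel"
    by (auto intro: borel_measurable_continuous_onI)
  show "\<And>x. (\<phi> has_derivative (\<lambda>h. grad \<phi> x \<bullet> h)) (at x)"
    by (rule has_derivative_grad[OF C])
  show "\<And>x. x \<notin> \<Omega> \<Longrightarrow> \<phi> x = 0"
    using \<phi> closure_subset[of "{x. \<phi> x \<noteq> 0}"] by (auto simp: Cc1_def compact_support_in_def)
  fix x assume "x \<notin> \<Omega>"
  define S where "S = closure {x. \<phi> x \<noteq> 0}"
  have "x \<in> - S" "open (- S)"
    using \<phi> \<open>x \<notin> \<Omega>\<close> by (auto simp: Cc1_def compact_support_in_def S_def)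
  moreover have "\<phi> y = 0" if "y \<in> - S" for y
    using that closure_subset[of "{x. \<phi> x \<noteq> 0}"] by (auto simp: S_def)
  moreover have "((\<lambda>_. 0) has_derivative (\<lambda>h. 0 \<bullet> h)) (at x)" by simp
  ultimately have "(\<phi> has_derivative (\<lambda>h. 0 \<bullet> h)) (at x)"
    by (metis has_derivative_transform_within_open)
  then show "grad \<phi> x = 0" by (rule grad_eqI)
qed

lemma Cc1_bounds:
  assumes \<phi>: "\<phi> \<in> Cc1 \<Omega>"
  obtains B R where "0 < B" "0 < R" "\<And>x. \<bar>\<phi> x\<bar> \<le> B" "\<And>x. norm (grad \<phi> x) \<le> B"
    "\<And>x. R \<le> norm x \<Longrightarrow> \<phi> x = 0" "\<And>x. R \<le> norm x \<Longrightarrow> grad \<phi> x = 0"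
proof -
  define S where "S = closure {x. \<phi> x \<noteq> 0}"
  have S: "compact S" using \<phi> by (auto simp: Cc1_def compact_support_in_def S_def)
  \<comment> \<open>A test function is also a test function on its own support, so
    \<open>Cc1_facts\<close> yields that it and its gradient vanish off the compact set
    \<open>S\<close>.\<close>
  have "\<phi> \<in> Cc1 S" using \<phi> by (auto simp: Cc1_def compact_support_in_def S_def)
  note f = Cc1_facts[OF this]
  obtain R where R: "0 < R" "\<And>x. x \<in> S \<Longrightarrow> norm x < R"
    using compact_imp_bounded[OF S] bounded_pos_less by blast
  have "bounded (\<phi> ` S)" "bounded (grad \<phi> ` S)"
    using S f by (auto intro!: compact_imp_bounded compact_continuous_image intro: continuous_on_subset)
  then obtain B1 B2 where B: "0 < B1" "\<And>x. x \<in> S \<Longrightarrow> norm (\<phi> x) \<le> B1"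
     "0 < B2" "\<And>x. x \<in> S \<Longrightarrow> norm (grad \<phi> x) \<le> B2"
    unfolding bounded_pos by auto
  show ?thesis
  proof
    show "0 < B1 + B2" using B by auto
    show "0 < R" by fact
    show "\<bar>\<phi> x\<bar> \<le> B1 + B2" "norm (grad \<phi> x) \<le> B1 + B2" for x
      using f(6,7)[of x] B(1,3) B(2,4)[of x] by (cases "x \<in> S"; force)+
    show "\<phi> x = 0" "grad \<phi> x = 0" if "R \<le> norm x" for x
      using f(6,7)[of x] R(2)[of x] that by force+
  qed
qed

subsection \<open>The Sobolev inequality\<close>

lemma integrable_bounded_support:
  fixes f :: "'a::euclidean_space \<Rightarrow> 'b::{banach, second_countable_topology}"
  assumes [measurable]: "f \<in> borel_measurable borel"
    and "\<And>x. norm (f x) \<le> B" "\<And>x. R \<le> norm x \<Longrightarrow> f x = 0"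
  shows "integrable lborel f"
proof (rule Bochner_Integration.integrable_bound)
  show "integrable lborel (\<lambda>x::'a. indicator (cball 0 R) x * B :: real)"
    using emeasure_bounded_finite[OF bounded_cball, of "0::'a" R]
    by (intro integrable_mult_left integrable_real_indicator) auto
  have "norm (f x) \<le> norm (indicator (cball 0 R) x * B :: real)" for x
    using assms(2)[of x] assms(3)[of x] by (cases "norm x \<le> R") (auto simp: indicator_def)
  then show "AE x in lborel. norm (f x) \<le> norm (indicator (cball 0 R) x * B :: real)" by simp
qed simp

text \<open>The fundamental theorem of calculus on the segment from a point outside the support to
  \<open>x\<close>.\<close>

lemma Cc1_le_line_int:
  fixes \<phi> :: "'a::euclidean_space \<Rightarrow> real"
  assumes \<phi>: "\<phi> \<in> Cc1 \<Omega>" and b: "b \<in> Basis"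
  shows "ennreal \<bar>\<phi> x\<bar> \<le> line_int b (\<lambda>y. ennreal (norm (grad \<phi> y))) x"
proof -
  note f = Cc1_facts[OF \<phi>]
  note [measurable] = f(3,4)
  obtain B R where B: "0 < B" "0 < R" "\<And>x. \<bar>\<phi> x\<bar> \<le> B" "\<And>x. norm (grad \<phi> x) \<le> B"
    "\<And>x. R \<le> norm x \<Longrightarrow> \<phi> x = 0" "\<And>x. R \<le> norm x \<Longrightarrow> grad \<phi> x = 0"
    using Cc1_bounds[OF \<phi>] by blast
  \<comment> \<open>Moving by at least \<open>R + norm x\<close> along a unit vector reaches norm
    \<open>R\<close> or more, where \<phi> vanishes.\<close>
  define t where "t = - (R + norm x)"
  have t: "t \<le> 0" using B(2) norm_ge_zero[of x] unfolding t_def by linarith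
  have "norm (t *\<^sub>R b) \<le> norm (x + t *\<^sub>R b) + norm x"
    using norm_triangle_ineq4[of "x + t *\<^sub>R b" x] by simp
  then have "R \<le> norm (x + t *\<^sub>R b)"
    using b B(2) norm_ge_zero[of x] by (simp add: t_def)
  then have 0: "\<phi> (x + t *\<^sub>R b) = 0" by (rule B)
  have D: "((\<lambda>s. \<phi> (x + s *\<^sub>R b)) has_real_derivative grad \<phi> (x + s *\<^sub>R b) \<bullet> b) (at s)" for s
  proof -
    have "((\<lambda>s. x + s *\<^sub>R b) has_derivative (\<lambda>s. s *\<^sub>R b)) (at s)"
      by (auto intro!: derivative_eq_intros)
    from has_derivative_compose[OF this f(5)] show ?thesis
      by (simp add: has_field_derivative_def inner_commute mult_commute_abs)
  qed
  have cont: "continuous_on UNIV (\<lambda>s. grad \<phi> (x + s *\<^sub>R b) \<bullet> b)"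
    by (intro continuous_intros continuous_on_compose2[OF f(2)]) auto
  have "has_bochner_integral lborel (\<lambda>s. (grad \<phi> (x + s *\<^sub>R b) \<bullet> b) * indicator {t..0} s)
     (\<phi> (x + 0 *\<^sub>R b) - \<phi> (x + t *\<^sub>R b))"
    using cont t
    by (intro has_bochner_integral_FTC_Icc_real D)
       (auto simp: continuous_on_eq_continuous_at)
  then have I: "integrable lborel (\<lambda>s. (grad \<phi> (x + s *\<^sub>R b) \<bullet> b) * indicator {t..0} s)"
      "(\<integral>s. (grad \<phi> (x + s *\<^sub>R b) \<bullet> b) * indicator {t..0} s \<partial>lborel) = \<phi> x"
    using 0 by (auto simp: has_bochner_integral_iff)
  have "ennreal \<bar>\<phi> x\<bar> \<le> (\<integral>\<^sup>+s. norm ((grad \<phi> (x + s *\<^sub>R b) \<bullet> b) * indicator {t..0} s) \<partial>lborel)"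
    using integral_norm_bound_ennreal[OF I(1)] I(2) by simp
  also have "\<dots> \<le> (\<integral>\<^sup>+s. ennreal (norm (grad \<phi> (x + s *\<^sub>R b))) \<partial>lborel)"
  proof (intro nn_integral_mono ennreal_leI)
    fix s
    have "\<bar>grad \<phi> (x + s *\<^sub>R b) \<bullet> b\<bar> \<le> norm (grad \<phi> (x + s *\<^sub>R b))"
      using Basis_le_norm[OF b] by simp
    then show "norm ((grad \<phi> (x + s *\<^sub>R b) \<bullet> b) * indicator {t..0} s) \<le> norm (grad \<phi> (x + s *\<^sub>R b))"
      by (simp add: indicator_def)
  qed
  finally show ?thesis by (simp add: line_int_def)
qed

lemma integrable_Cc1:
  assumes \<phi>: "\<phi> \<in> Cc1 \<Omega>" and a: "0 < a"
  shows "integrable lborel (\<lambda>x. \<bar>\<phi> x\<bar> powr a)" "integrable lborel (\<lambda>x. norm (grad \<phi> x) powr a)"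
    "integrable lborel \<phi>" "integrable lborel (grad \<phi>)"
proof -
  note [measurable] = Cc1_facts(3,4)[OF \<phi>]
  obtain B R where B: "0 < B" "0 < R" "\<And>x. \<bar>\<phi> x\<bar> \<le> B" "\<And>x. norm (grad \<phi> x) \<le> B"
    "\<And>x. R \<le> norm x \<Longrightarrow> \<phi> x = 0" "\<And>x. R \<le> norm x \<Longrightarrow> grad \<phi> x = 0"
    using Cc1_bounds[OF \<phi>] by blast
  show "integrable lborel (\<lambda>x. \<bar>\<phi> x\<bar> powr a)"
    by (rule integrable_bounded_support[where R = R and B = "B powr a"]) (use B a in \<open>auto intro!: powr_mono2\<close>)
  show "integrable lborel (\<lambda>x. norm (grad \<phi> x) powr a)"
    by (rule integrable_bounded_support[where R = R and B = "B powr a"]) (use B a in \<open>auto intro!: powr_mono2\<close>)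
  show "integrable lborel \<phi>" "integrable lborel (grad \<phi>)"
    by (rule integrable_bounded_support[where R = R and B = B]; use B in auto)+
qed

lemma Gagliardo_Nirenberg_Sobolev_1:
  fixes \<phi> :: "'a::euclidean_space \<Rightarrow> real"
  assumes \<phi>: "\<phi> \<in> Cc1 \<Omega>" and dim: "DIM('a) \<ge> 2"
  defines "q \<equiv> real DIM('a) / (real DIM('a) - 1)"
  shows "(\<integral>x. \<bar>\<phi> x\<bar> powr q \<partial>lborel) \<le> (\<integral>x. norm (grad \<phi> x) \<partial>lborel) powr q"
proof -
  note [measurable] = Cc1_facts(3,4)[OF \<phi>]
  have q: "0 < q" using dim by (simp add: q_def)
  have "ennreal (\<integral>x. \<bar>\<phi> x\<bar> powr q \<partial>lborel) = (\<integral>\<^sup>+x. ennreal (\<bar>\<phi> x\<bar> powr q) \<partial>lborel)"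
    using integrable_Cc1(1)[OF \<phi> q] by (simp add: nn_integral_eq_integral)
  also have "\<dots> = (\<integral>\<^sup>+x. epow (ennreal \<bar>\<phi> x\<bar>) q \<partial>lborel)"
    using q by (simp add: epow_ennreal)
  also have "\<dots> \<le> epow (\<integral>\<^sup>+x. ennreal (norm (grad \<phi> x)) \<partial>lborel) q"
    unfolding q_def by (rule Gagliardo_Nirenberg_lines) (use dim Cc1_le_line_int[OF \<phi>] in auto)
  also have "\<dots> = ennreal ((\<integral>x. norm (grad \<phi> x) \<partial>lborel) powr q)"
    using integrable_Cc1(4)[OF \<phi> q] q by (simp add: nn_integral_eq_integral epow_ennreal)
  finally show ?thesis by (subst (asm) ennreal_le_iff) auto
qed

text \<open>The a priori bounds close here: a quantity is dominated by a smaller power of itself,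
  and that power is divided out.\<close>

lemma le_powr_absorb:
  fixes S c a :: real
  assumes "0 \<le> S" "0 \<le> c" "a < 1" "S \<le> c * S powr a"
  shows "S \<le> c powr (1 / (1 - a))"
proof (cases "S = 0")
  case False
  then have S: "0 < S" using assms by simp
  have "S powr (1 - a) = S / S powr a" using S by (simp add: powr_diff)
  also have "\<dots> \<le> c" using S assms(4) by (simp add: field_simps)
  finally have "(S powr (1 - a)) powr (1 / (1 - a)) \<le> c powr (1 / (1 - a))"
    using assms by (intro powr_mono2) auto
  then show ?thesis using S assms by (simp add: powr_powr)
qed simp

lemma tendsto_abs_powr_0:
  assumes "0 < (g::real)"
  shows "((\<lambda>h::real. \<bar>h\<bar> powr g) \<longlongrightarrow> 0) (at 0)"
proof -
  have "((\<lambda>h::real. \<bar>h\<bar>) \<longlongrightarrow> \<bar>0\<bar>) (at 0)" by (intro tendsto_intros)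
  from tendsto_powr'[OF this tendsto_const, of g] assms show ?thesis by simp
qed

lemma abs_powr_has_derivative:
  assumes g: "1 < (g::real)"
  shows "((\<lambda>t. \<bar>t\<bar> powr g) has_real_derivative g * (\<bar>t\<bar> powr (g - 1) * sgn t)) (at t)"
proof -
  consider "t > 0" | "t < 0" | "t = 0" by linarith
  then show ?thesis
  proof cases
    case 1
    have "((\<lambda>t. t powr g) has_real_derivative g * (\<bar>t\<bar> powr (g - 1) * sgn t)) (at t)"
      using 1 by (auto intro!: derivative_eq_intros)
    then show ?thesis
      by (rule has_field_derivative_transform_within_open[where S = "{0<..}"]) (use 1 in auto)
  next
    case 2
    have "((\<lambda>t. (- t) powr g) has_real_derivative g * (\<bar>t\<bar> powr (g - 1) * sgn t)) (at t)"
      using 2 by (auto intro!: derivative_eq_intros)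
    then show ?thesis
      by (rule has_field_derivative_transform_within_open[where S = "{..<0}"]) (use 2 in auto)
  next
    case 3
    have "((\<lambda>h. \<bar>h\<bar> powr (g - 1)) \<longlongrightarrow> 0) (at 0)"
      using g by (intro tendsto_abs_powr_0) simp
    then have "((\<lambda>h. \<bar>h\<bar> powr g / h) \<longlongrightarrow> 0) (at 0)"
    proof (rule Lim_null_comparison[rotated])
      have "norm (\<bar>h\<bar> powr g / h) \<le> \<bar>h\<bar> powr (g - 1)" if "h \<noteq> 0" for h :: real
        using that by (simp add: powr_diff)
      then show "\<forall>\<^sub>F h in at 0. norm (\<bar>h\<bar> powr g / h) \<le> \<bar>h\<bar> powr (g - 1)"
        by (auto simp: eventually_at_filter)
    qed
    then show ?thesis using 3 g by (simp add: DERIV_def)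
  qed
qed

lemma continuous_abs_powr_sgn:
  assumes g: "0 < (g::real)"
  shows "continuous_on UNIV (\<lambda>t. \<bar>t\<bar> powr g * sgn t)"
proof -
  have "isCont (\<lambda>t. \<bar>t\<bar> powr g * sgn t) t" for t :: real
  proof (cases "t = 0")
    case True
    have "((\<lambda>h. \<bar>h\<bar> powr g * sgn h) \<longlongrightarrow> 0) (at 0)"
      by (rule Lim_null_comparison[OF _ tendsto_abs_powr_0[OF g]]) (auto simp: abs_mult sgn_if intro!: always_eventually)
    then show ?thesis using True by (simp add: isCont_def)
  qed (auto intro!: continuous_intros)
  then show ?thesis by (simp add: continuous_at_imp_continuous_on)
qed

lemma Sobolev_inequality:
  fixes \<Omega> :: "'a::euclidean_space set"
  assumes dim: "DIM('a) \<ge> 2" and r: "1 \<le> r" "r < real DIM('a)"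
  defines "q \<equiv> sobolev_conj (real DIM('a)) r"
  obtains C where "0 \<le> C" "\<And>\<phi>. \<phi> \<in> Cc1 \<Omega> \<Longrightarrow>
    (\<integral>x. \<bar>\<phi> x\<bar> powr q \<partial>lborel) \<le> C * (\<integral>x. norm (grad \<phi> x) powr r \<partial>lborel) powr (q / r)"
proof (cases "r = 1")
  \<comment> \<open>Here the auxiliary power used below would be 1, and the absolute value is not of
    class C^1; but the claim is then the inequality of exponent 1 itself.\<close>
  case True
  have "(\<integral>x. \<bar>\<phi> x\<bar> powr q \<partial>lborel) \<le> 1 * (\<integral>x. norm (grad \<phi> x) powr r \<partial>lborel) powr (q / r)"
    if "\<phi> \<in> Cc1 \<Omega>" for \<phi>
    using Gagliardo_Nirenberg_Sobolev_1[OF that dim] True by (simp add: q_def sobolev_conj_def)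
  then show ?thesis using that[of 1] by simp
next
  case False
  define N where "N = real DIM('a)"
  have N: "2 \<le> N" "1 < r" "r < N" using dim r False by (auto simp: N_def)
  define N' where "N' = N / (N - 1)"
  \<comment> \<open>Chosen so that \<open>g * N' = q\<close> and also
    \<open>g - 1 = q * (1 - 1 / r)\<close>: exponent 1 applied to |\<phi>|^g has the integral of
    |\<phi>|^q on the left, and Hoelder brings the same integral back on the right.\<close>
  define g where "g = r * (N - 1) / (N - r)"
  have q: "q = N * r / (N - r)" by (simp add: q_def sobolev_conj_def N_def)
  have "(N - r) * 1 < (N - r) + N * (r - 1)" using N by simp
  also have "\<dots> = r * (N - 1)" by algebra
  also have "\<dots> = (N - r) * g" using N by (simp add: g_def)
  finally have "(N - r) * 1 < (N - r) * g" .
  then have g: "1 < g" using N by (simp only: mult_less_cancel_left_pos)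
  have gN: "g * N' = q" using N by (simp add: g_def N'_def q)
  have g1: "(g - 1) = q * (1 - 1 / r)"
    using N by (simp add: g_def q field_simps)
  \<comment> \<open>The power of the integral of |\<phi>|^q that Hoelder leaves on the right; it is
    below 1 because r < N.\<close>
  define a where "a = (1 - 1 / r) * N'"
  have a1: "1 - a = (N / r - 1) / (N - 1)" using N by (simp add: a_def N'_def field_simps)
  then have a: "a < 1" using N by (smt (verit) divide_pos_pos less_divide_eq_1_pos)
  have e: "N' / (1 - a) = q"
  proof -
    have "N' / (1 - a) = N / (N / r - 1)" using N by (simp add: a1 N'_def)
    also have "N / r - 1 = (N - r) / r" using N by (simp add: field_simps)
    finally show ?thesis by (simp add: q)
  qed
  then have e': "N' / (r * (1 - a)) = q / r" by (metis divide_divide_eq_left mult.commute)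
  have N': "0 < N'" using N by (simp add: N'_def)
  show ?thesis
  proof (rule that[of "g powr q"])
    fix \<phi> assume \<phi>: "\<phi> \<in> Cc1 \<Omega>"
    have q0: "0 < q" using N by (simp add: q)
    define S K where "S = (\<integral>x. \<bar>\<phi> x\<bar> powr q \<partial>lborel)" and "K = (\<integral>x. norm (grad \<phi> x) powr r \<partial>lborel)"
    have SK: "0 \<le> S" "0 \<le> K" by (auto simp: S_def K_def)
    note G = Cc1_compose[OF abs_powr_has_derivative[OF g] continuous_on_mult[OF continuous_on_const
        continuous_abs_powr_sgn[of "g - 1"]] _ \<phi>]
    have 1: "(\<lambda>x. \<bar>\<phi> x\<bar> powr g) \<in> Cc1 \<Omega>"
      "\<And>x. norm (grad (\<lambda>x. \<bar>\<phi> x\<bar> powr g) x) = g * (\<bar>\<phi> x\<bar> powr (g - 1) * norm (grad \<phi> x))"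
      using G g by (auto simp: abs_mult abs_sgn_eq)
    have "S = (\<integral>x. \<bar>\<bar>\<phi> x\<bar> powr g\<bar> powr N' \<partial>lborel)"
      by (simp add: S_def powr_powr gN)
    also have "\<dots> \<le> (\<integral>x. norm (grad (\<lambda>x. \<bar>\<phi> x\<bar> powr g) x) \<partial>lborel) powr N'"
      unfolding N'_def N_def by (rule Gagliardo_Nirenberg_Sobolev_1[OF 1(1) dim])
    also have "(\<integral>x. norm (grad (\<lambda>x. \<bar>\<phi> x\<bar> powr g) x) \<partial>lborel)
        = g * (\<integral>x. (norm (grad \<phi> x) powr r) powr (1 / r) * (\<bar>\<phi> x\<bar> powr q) powr (1 - 1 / r) \<partial>lborel)"
      using N by (simp add: 1 powr_powr g1 mult_ac)
    also have "\<dots> powr N' \<le> (g * (K powr (1 / r) * S powr (1 - 1 / r))) powr N'"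
      unfolding S_def K_def using N N' g
      by (intro powr_mono2 mult_left_mono Hoelder_powr(2) integrable_Cc1[OF \<phi>] q0)
         (auto intro!: mult_nonneg_nonneg)
    also have "\<dots> = (g powr N' * K powr (N' / r)) * S powr a"
      using g by (simp add: powr_mult powr_powr a_def)
    finally have "S \<le> (g powr N' * K powr (N' / r)) powr (1 / (1 - a))"
      by (intro le_powr_absorb) (use SK a in auto)
    also have "\<dots> = g powr q * K powr (q / r)"
      using e e' by (simp add: powr_mult powr_powr)
    finally show "(\<integral>x. \<bar>\<phi> x\<bar> powr q \<partial>lborel) \<le> g powr q * (\<integral>x. norm (grad \<phi> x) powr r \<partial>lborel) powr (q / r)"
      by (simp add: S_def K_def)
  qed simp
qed

text \<open>The constant \<open>d\<close> is fixed before \<mu>, so one bound serves a whole family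
  of functions. A superlinear exponent \<beta> turns the recursion over levels with halving gaps
  into geometric decay.\<close>

lemma Stampacchia:
  fixes V M \<alpha> \<beta> k0 :: real
  assumes "0 < V" "0 \<le> M" "0 < \<alpha>" "1 < \<beta>"
  obtains d where "0 \<le> d"
    "\<And>\<mu>. \<lbrakk>\<And>k. k0 \<le> k \<Longrightarrow> 0 \<le> \<mu> k; \<And>h k. k0 \<le> k \<Longrightarrow> k \<le> h \<Longrightarrow> \<mu> h \<le> \<mu> k; \<mu> k0 \<le> V;
       \<And>k e. k0 \<le> k \<Longrightarrow> 0 < e \<Longrightarrow> \<mu> (k + e) \<le> M * e powr - \<alpha> * \<mu> k powr \<beta>\<rbrakk> \<Longrightarrow> \<mu> (k0 + d) = 0"
proof -
  \<comment> \<open>The decay ratio. Since \<open>r powr (\<beta> - 1) = 2 powr - \<alpha>\<close>,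
    the superlinear gain at step j cancels the factor 2^(\<alpha> j) caused by the shrinking
    gaps.\<close>
  define r where "r = 2 powr (- \<alpha> / (\<beta> - 1))"
  have r: "0 < r" "r < 1" using assms powr_less_mono[of "- \<alpha> / (\<beta> - 1)" 0 2] by (auto simp: r_def)
  have r': "r powr (\<beta> - 1) = 2 powr - \<alpha>" using assms by (simp add: r_def powr_powr)
  define X where "X = M * V powr (\<beta> - 1) * 2 powr \<alpha> / r"
  have X: "0 \<le> X" using assms r by (simp add: X_def)
  \<comment> \<open>Makes M V^(\<beta> - 1) 2^\<alpha> d^(-\<alpha>) \<le> \<open>r\<close>, the
    requirement of the induction step; the summand 1 keeps \<open>d\<close> positive when
    \<open>M = 0\<close>.\<close>
  define d where "d = (X + 1) powr (1 / \<alpha>)"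
  have d: "0 < d" "d powr - \<alpha> = 1 / (X + 1)"
    using X assms by (auto simp: d_def powr_powr powr_minus divide_inverse)
  have d': "M * V powr (\<beta> - 1) * 2 powr \<alpha> * d powr - \<alpha> \<le> r"
  proof -
    have "M * V powr (\<beta> - 1) * 2 powr \<alpha> = X * r" using r by (simp add: X_def)
    then show ?thesis using X r by (simp add: d field_simps)
  qed
  show ?thesis
  proof (rule that[of d])
    fix \<mu> :: "real \<Rightarrow> real"
    assume nn: "\<And>k. k0 \<le> k \<Longrightarrow> 0 \<le> \<mu> k" and mono: "\<And>h k. k0 \<le> k \<Longrightarrow> k \<le> h \<Longrightarrow> \<mu> h \<le> \<mu> k"
      and V: "\<mu> k0 \<le> V"
      and step: "\<And>k e. k0 \<le> k \<Longrightarrow> 0 < e \<Longrightarrow> \<mu> (k + e) \<le> M * e powr - \<alpha> * \<mu> k powr \<beta>"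
    \<comment> \<open>Levels increasing to \<open>k0 + d\<close>, with gap d / 2^(j+1) between
      consecutive ones.\<close>
    define k where "k j = k0 + d * (1 - (1/2) ^ j)" for j :: nat
    have k: "k0 \<le> k j" "k j \<le> k0 + d" for j
      using d by (auto simp: k_def power_le_one)
    have le: "\<mu> (k j) \<le> V * r ^ j" for j
    proof (induction j)
      case 0
      then show ?case using V by (simp add: k_def)
    next
      case (Suc j)
      have kS: "k (Suc j) = k j + d * (1/2) ^ Suc j" by (simp add: k_def algebra_simps)
      have "\<mu> (k (Suc j)) \<le> M * (d * (1/2) ^ Suc j) powr - \<alpha> * \<mu> (k j) powr \<beta>"
        unfolding kS using k d by (intro step) auto
      also have "\<dots> \<le> M * (d * (1/2) ^ Suc j) powr - \<alpha> * (V * r ^ j) powr \<beta>"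
        using Suc assms nn k by (intro mult_left_mono powr_mono2) auto
      also have "(d * (1/2) ^ Suc j) powr - \<alpha> = d powr - \<alpha> * (2 powr \<alpha> * (2 powr - \<alpha>) powr - real j)"
      proof -
        have "(1/2::real) ^ Suc j = inverse (2 ^ Suc j)"
          by (simp only: power_one_over inverse_eq_divide)
        also have "\<dots> = 2 powr - real (Suc j)"
          by (subst powr_minus, subst powr_realpow) auto
        finally have "((1/2::real) ^ Suc j) powr - \<alpha> = (2 powr - real (Suc j)) powr - \<alpha>"
          by (simp only:)
        also have "\<dots> = 2 powr \<alpha> * (2 powr - \<alpha>) powr - real j"
          by (simp only: powr_powr powr_add[symmetric]) (simp add: algebra_simps)
        finally have "((1/2::real) ^ Suc j) powr - \<alpha> = 2 powr \<alpha> * (2 powr - \<alpha>) powr - real j" .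
        moreover have "(d * (1/2) ^ Suc j) powr - \<alpha> = d powr - \<alpha> * ((1/2) ^ Suc j) powr - \<alpha>"
          by (rule powr_mult)
        ultimately show ?thesis by (simp only:)
      qed
      also have "(V * r ^ j) powr \<beta> = V * r ^ j * (V powr (\<beta> - 1) * (2 powr - \<alpha>) powr real j)"
      proof -
        have "(V * r ^ j) powr \<beta> = (V * r ^ j) powr (1 + (\<beta> - 1))" by simp
        also have "\<dots> = (V * r ^ j) * (V * r ^ j) powr (\<beta> - 1)"
          using assms r by (subst powr_add) (simp add: mult_pos_pos)
        also have "(V * r ^ j) powr (\<beta> - 1) = V powr (\<beta> - 1) * (r powr real j) powr (\<beta> - 1)"
          using assms r by (simp add: powr_mult powr_realpow)
        also have "(r powr real j) powr (\<beta> - 1) = (r powr (\<beta> - 1)) powr real j"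
          by (simp add: powr_powr mult.commute)
        finally show ?thesis by (simp add: r')
      qed
      also have "M * (d powr - \<alpha> * (2 powr \<alpha> * (2 powr - \<alpha>) powr - real j))
          * (V * r ^ j * (V powr (\<beta> - 1) * (2 powr - \<alpha>) powr real j))
         = V * r ^ j * (M * V powr (\<beta> - 1) * 2 powr \<alpha> * d powr - \<alpha>)
           * ((2 powr - \<alpha>) powr - real j * (2 powr - \<alpha>) powr real j)"
        by (simp only: mult_ac)
      also have "(2 powr - \<alpha>) powr - real j * (2 powr - \<alpha>) powr real j = 1"
        by (simp flip: powr_add)
      also have "V * r ^ j * (M * V powr (\<beta> - 1) * 2 powr \<alpha> * d powr - \<alpha>) * 1 \<le> V * r ^ j * r"
        using d' assms r by (simp add: mult_left_mono)
      finally show ?case by (simp add: mult_ac)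
    qed
    have "\<mu> (k0 + d) \<le> V * r ^ j" for j
      using mono[OF k, of j] le[of j] by linarith
    moreover have "(\<lambda>j. V * r ^ j) \<longlonglongrightarrow> V * 0"
      using r by (intro tendsto_intros LIMSEQ_power_zero) auto
    ultimately have "\<mu> (k0 + d) \<le> 0"
      by (intro LIMSEQ_le_const) auto
    then show "\<mu> (k0 + d) = 0" using nn[of "k0 + d"] d by simp
  qed (use d in auto)
qed

text \<open>A \<open>C\<^sup>1\<close> substitute for the truncation \<open>max 0 (t - k)\<close>.\<close>

definition soft_excess :: "real \<Rightarrow> real \<Rightarrow> real \<Rightarrow> real" where
  "soft_excess e k t = sqrt (e\<^sup>2 + (max 0 (t - k))\<^sup>2) - e"

definition soft_excess_deriv :: "real \<Rightarrow> real \<Rightarrow> real \<Rightarrow> real" where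
  "soft_excess_deriv e k t = max 0 (t - k) / sqrt (e\<^sup>2 + (max 0 (t - k))\<^sup>2)"

lemma max_square_has_derivative:
  "((\<lambda>t::real. (max 0 t)\<^sup>2) has_real_derivative 2 * max 0 t) (at t)"
proof -
  consider "t > 0" | "t < 0" | "t = 0" by linarith
  then show ?thesis
  proof cases
    case 1
    have "((\<lambda>t::real. t\<^sup>2) has_real_derivative 2 * max 0 t) (at t)"
      using 1 by (auto intro!: derivative_eq_intros)
    then show ?thesis
      by (rule has_field_derivative_transform_within_open[where S = "{0<..}"]) (use 1 in auto)
  next
    case 2
    have "((\<lambda>t::real. 0) has_real_derivative 2 * max 0 t) (at t)"
      using 2 by auto
    then show ?thesis
      by (rule has_field_derivative_transform_within_open[where S = "{..<0}"]) (use 2 in auto)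
  next
    case 3
    have "((\<lambda>h. \<bar>h\<bar>) \<longlongrightarrow> \<bar>0::real\<bar>) (at 0)" by (intro tendsto_intros)
    then have "((\<lambda>h. \<bar>h\<bar>) \<longlongrightarrow> (0::real)) (at 0)" by simp
    then have "((\<lambda>h. (max 0 h)\<^sup>2 / h) \<longlongrightarrow> (0::real)) (at 0)"
      by (rule Lim_null_comparison[rotated])
         (auto intro!: always_eventually simp: max_def power2_eq_square)
    then show ?thesis using 3 by (simp add: DERIV_def)
  qed
qed

lemma soft_excess_has_derivative:
  assumes "0 < e"
  shows "(soft_excess e k has_real_derivative soft_excess_deriv e k t) (at t)"
proof -
  have pos: "0 < e\<^sup>2 + (max 0 (t - k))\<^sup>2" using assms by (simp add: add_pos_nonneg)
  have 1: "((\<lambda>t. (max 0 (t - k))\<^sup>2) has_real_derivative 2 * max 0 (t - k) * 1) (at t)"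
    by (rule DERIV_chain2[OF max_square_has_derivative]) (auto intro!: derivative_eq_intros)
  have "((\<lambda>t. sqrt (e\<^sup>2 + (max 0 (t - k))\<^sup>2) - e) has_real_derivative
      inverse (sqrt (e\<^sup>2 + (max 0 (t - k))\<^sup>2)) / 2 * (0 + 2 * max 0 (t - k) * 1) - 0) (at t)"
    by (intro DERIV_diff DERIV_const DERIV_add 1
        DERIV_chain2[where f = sqrt and g = "\<lambda>t. e\<^sup>2 + (max 0 (t - k))\<^sup>2", OF DERIV_real_sqrt[OF pos]])
  moreover have "inverse (sqrt (e\<^sup>2 + (max 0 (t - k))\<^sup>2)) / 2 * (0 + 2 * max 0 (t - k) * 1) - 0
      = soft_excess_deriv e k t"
    unfolding soft_excess_deriv_def divide_inverse[of "max 0 (t - k)"] by simp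
  ultimately show ?thesis
    unfolding soft_excess_def[abs_def] by (rule DERIV_cong)
qed

lemma continuous_soft_excess_deriv: "0 < e \<Longrightarrow> continuous_on UNIV (soft_excess_deriv e k)"
  unfolding soft_excess_deriv_def[abs_def]
  by (intro continuous_intros) (auto simp: add_nonneg_eq_0_iff)

text \<open>The smoothing parameter is also the gap to the next level. At height \<open>e\<close>
  above \<open>k\<close> the value is sqrt 2 * e - e, hence the linear lower bound with a constant
  independent of both.\<close>

lemma soft_excess_bounds:
  assumes "0 < e"
  shows "0 \<le> soft_excess e k t" "t \<le> k \<Longrightarrow> soft_excess e k t = 0"
    "0 \<le> soft_excess_deriv e k t" "soft_excess_deriv e k t \<le> 1"
    "t \<le> k \<Longrightarrow> soft_excess_deriv e k t = 0"
    "k + e \<le> t \<Longrightarrow> (sqrt 2 - 1) * e \<le> soft_excess e k t"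
proof -
  define m where "m = max 0 (t - k)"
  have m: "0 \<le> m" by (simp add: m_def)
  have s: "e \<le> sqrt (e\<^sup>2 + m\<^sup>2)" "m \<le> sqrt (e\<^sup>2 + m\<^sup>2)"
    using assms m by (auto intro!: real_le_rsqrt)
  show "0 \<le> soft_excess e k t" "t \<le> k \<Longrightarrow> soft_excess e k t = 0"
    "t \<le> k \<Longrightarrow> soft_excess_deriv e k t = 0"
    using s assms by (auto simp: soft_excess_def soft_excess_deriv_def m_def)
  show "0 \<le> soft_excess_deriv e k t"
    using m by (simp add: soft_excess_deriv_def m_def[symmetric])
  show "soft_excess_deriv e k t \<le> 1"
    unfolding soft_excess_deriv_def m_def[symmetric]
    by (rule divide_le_eq_1_pos[THEN iffD2]) (use s assms in linarith)+
  assume "k + e \<le> t"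
  then have "e\<^sup>2 \<le> m\<^sup>2" using assms by (intro power_mono) (auto simp: m_def)
  then have "sqrt (2 * e\<^sup>2) \<le> sqrt (e\<^sup>2 + m\<^sup>2)" by simp
  then show "(sqrt 2 - 1) * e \<le> soft_excess e k t"
    using assms by (simp add: soft_excess_def real_sqrt_mult algebra_simps flip: m_def)
qed

subsection \<open>The supremum bound above the critical exponent\<close>

lemma cball_fmeasurable_lborel: "cball (c::'a::euclidean_space) R \<in> fmeasurable lborel"
  using emeasure_bounded_finite[OF bounded_cball, of c R] by (simp add: fmeasurable_def)

text \<open>Stampacchia's iteration on the measures of the superlevel sets of \<phi>. The inequality
  of exponent 1 is applied to the soft excess of \<phi>, whose gradient lives on a superlevel set,
  so Hoelder yields a power of its measure. The bound is for a fixed gradient bound \<open>K\<close>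
  and need not be homogeneous in it.\<close>

lemma Sobolev_sup_one_sided:
  fixes \<Omega> :: "'a::euclidean_space set" and r K :: real
  assumes dim: "DIM('a) \<ge> 2" and bdd: "bounded \<Omega>" and r: "real DIM('a) < r" and K: "0 \<le> K"
  obtains C where "0 \<le> C"
    "\<And>\<phi> x. \<phi> \<in> Cc1 \<Omega> \<Longrightarrow> (\<integral>x. norm (grad \<phi> x) powr r \<partial>lborel) \<le> K \<Longrightarrow> \<phi> x \<le> C"
proof -
  define N where "N = real DIM('a)"
  have N: "2 \<le> N" "N < r" using dim r by (auto simp: N_def)
  define q where "q = N / (N - 1)"
  have q: "0 < q" using N by (simp add: q_def)
  obtain R where R: "\<Omega> \<subseteq> cball 0 R"
    using bdd by (meson bounded_iff mem_cball_0 subsetI)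
  define V where "V = measure lborel (cball (0::'a) R) + 1"
  have V: "0 < V" by (simp add: V_def add_nonneg_pos)
  define c where "c = sqrt 2 - 1"
  have c: "0 < c" by (simp add: c_def)
  define M where "M = K powr (q / r) * c powr - q"
  have M0: "0 \<le> M" by (simp add: M_def)
  \<comment> \<open>Hoelder on the superlevel set contributes 1 - 1/r and the exponent-1 inequality
    the power q = N/(N-1); the product exceeds 1 because r > N.\<close>
  define \<beta> where "\<beta> = (1 - 1 / r) * q"
  have \<beta>: "1 < \<beta>"
  proof -
    have "(1 - 1 / r) * q - 1 = (r - N) / (r * (N - 1))"
      using N by (simp add: q_def field_simps)
    moreover have "0 < (r - N) / (r * (N - 1))" using N by simp
    ultimately show ?thesis by (simp add: \<beta>_def)
  qed
  obtain d where d: "0 \<le> d"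
    "\<And>\<mu>. \<lbrakk>\<And>k. 0 \<le> k \<Longrightarrow> 0 \<le> \<mu> k; \<And>h k. 0 \<le> k \<Longrightarrow> k \<le> h \<Longrightarrow> \<mu> h \<le> \<mu> k; \<mu> 0 \<le> V;
       \<And>k e. 0 \<le> k \<Longrightarrow> 0 < e \<Longrightarrow> \<mu> (k + e) \<le> M * e powr - q * \<mu> k powr \<beta>\<rbrakk> \<Longrightarrow> \<mu> (0 + d) = 0"
    by (rule Stampacchia[OF V M0 q \<beta>, of 0]) blast
  show ?thesis
  proof (rule that[OF d(1)])
    fix \<phi> x assume \<phi>: "\<phi> \<in> Cc1 \<Omega>" and le: "(\<integral>x. norm (grad \<phi> x) powr r \<partial>lborel) \<le> K"
    note f = Cc1_facts[OF \<phi>]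
    note [measurable] = f(3,4)
    define \<mu> where "\<mu> k = measure lborel {x. k < \<phi> x}" for k
    have sub: "{x. k < \<phi> x} \<subseteq> cball 0 R" if "0 \<le> k" for k
      using R f(6) that by force
    have fin: "{x. k < \<phi> x} \<in> fmeasurable lborel" if "0 \<le> k" for k
      by (rule fmeasurableI2[OF cball_fmeasurable_lborel sub[OF that]]) simp
    have "\<mu> (0 + d) = 0"
    proof (rule d(2))
      show "0 \<le> \<mu> k" for k by (simp add: \<mu>_def)
      show "\<mu> h \<le> \<mu> k" if "0 \<le> k" "k \<le> h" for h k
        unfolding \<mu>_def using that fin[of k] by (intro measure_mono_fmeasurable) auto
      have "\<mu> 0 \<le> measure lborel (cball (0::'a) R)"
        unfolding \<mu>_def using sub[of 0] fin[of 0]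
        by (intro measure_mono_fmeasurable cball_fmeasurable_lborel) auto
      then show "\<mu> 0 \<le> V" by (simp add: V_def)
      fix k e :: real assume k: "0 \<le> k" and e: "0 < e"
      define \<psi> where "\<psi> = (\<lambda>x. soft_excess e k (\<phi> x))"
      note G = Cc1_compose[OF soft_excess_has_derivative[OF e] continuous_soft_excess_deriv[OF e]
          soft_excess_bounds(2)[OF e k] \<phi>]
      have \<psi>: "\<psi> \<in> Cc1 \<Omega>" using G(1) by (simp add: \<psi>_def)
      have int: "integrable lborel (\<lambda>x. norm (grad \<phi> x) powr r)" "integrable lborel (\<lambda>x. indicat_real {x. k < \<phi> x} x)"
        using integrable_Cc1(2)[OF \<phi>, of r] N fin[OF k] by (auto simp: fmeasurable_def)
      have r1: "0 < 1 / r" "1 / r < 1" using N by auto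
      have "(\<integral>x. norm (grad \<psi> x) \<partial>lborel) \<le>
          (\<integral>x. (norm (grad \<phi> x) powr r) powr (1 / r) * (indicat_real {x. k < \<phi> x} x) powr (1 - 1 / r) \<partial>lborel)"
      proof (rule integral_mono)
        show "integrable lborel (\<lambda>x. norm (grad \<psi> x))"
          using integrable_Cc1(4)[OF \<psi> q] by simp
        show "integrable lborel (\<lambda>x. (norm (grad \<phi> x) powr r) powr (1 / r) * (indicat_real {x. k < \<phi> x} x) powr (1 - 1 / r))"
          by (rule Hoelder_powr(1)[OF int(1) _ int(2) _ r1]) auto
        show "norm (grad \<psi> x) \<le> (norm (grad \<phi> x) powr r) powr (1 / r) * (indicat_real {x. k < \<phi> x} x) powr (1 - 1 / r)" for x
        proof (cases "k < \<phi> x")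
          case True
          then show ?thesis
            using soft_excess_bounds(3,4)[OF e, of k "\<phi> x"] N
            by (simp add: \<psi>_def G(2) powr_powr mult_left_le_one_le)
        next
          case False
          then show ?thesis
            using soft_excess_bounds(5)[OF e, of "\<phi> x" k] by (simp add: \<psi>_def G(2))
        qed
      qed
      also have "\<dots> \<le> (\<integral>x. norm (grad \<phi> x) powr r \<partial>lborel) powr (1 / r) * (\<integral>x. indicat_real {x. k < \<phi> x} x \<partial>lborel) powr (1 - 1 / r)"
        by (rule Hoelder_powr(2)[OF int(1) _ int(2) _ r1]) auto
      also have "\<dots> \<le> K powr (1 / r) * \<mu> k powr (1 - 1 / r)"
        using le r1 by (intro mult_mono powr_mono2) (auto simp: \<mu>_def)
      finally have I: "(\<integral>x. norm (grad \<psi> x) \<partial>lborel) \<le> K powr (1 / r) * \<mu> k powr (1 - 1 / r)" .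
      have "\<mu> (k + e) * (c * e) powr q = (\<integral>x. indicat_real {x. k + e < \<phi> x} x * (c * e) powr q \<partial>lborel)"
        using k e by (simp add: \<mu>_def)
      also have "\<dots> \<le> (\<integral>x. \<bar>\<psi> x\<bar> powr q \<partial>lborel)"
      proof (rule integral_mono)
        show "integrable lborel (\<lambda>x. indicat_real {x. k + e < \<phi> x} x * (c * e) powr q)"
          using fin[of "k + e"] k e by (auto simp: fmeasurable_def intro!: integrable_mult_left)
        show "integrable lborel (\<lambda>x. \<bar>\<psi> x\<bar> powr q)" by (rule integrable_Cc1[OF \<psi> q])
        show "indicat_real {x. k + e < \<phi> x} x * (c * e) powr q \<le> \<bar>\<psi> x\<bar> powr q" for x
          using soft_excess_bounds(6)[OF e, of k "\<phi> x"] soft_excess_bounds(1)[OF e, of k "\<phi> x"] c e q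
          by (auto simp: indicator_def \<psi>_def c_def intro!: powr_mono2)
      qed
      also have "\<dots> \<le> (\<integral>x. norm (grad \<psi> x) \<partial>lborel) powr q"
        unfolding q_def N_def by (rule Gagliardo_Nirenberg_Sobolev_1[OF \<psi> dim])
      also have "\<dots> \<le> (K powr (1 / r) * \<mu> k powr (1 - 1 / r)) powr q"
        using I q by (intro powr_mono2) auto
      also have "\<dots> = K powr (q / r) * \<mu> k powr \<beta>"
        by (simp add: powr_mult powr_powr \<beta>_def)
      finally have "\<mu> (k + e) \<le> K powr (q / r) * \<mu> k powr \<beta> / (c * e) powr q"
        using c e by (simp add: field_simps)
      also have "\<dots> = M * e powr - q * \<mu> k powr \<beta>"
        using c e by (simp add: M_def powr_mult powr_minus divide_inverse)
      finally show "\<mu> (k + e) \<le> M * e powr - q * \<mu> k powr \<beta>" .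
    qed
    \<comment> \<open>An open null set is empty, so continuity of \<phi> turns the almost-everywhere
      bound into a pointwise one.\<close>
    then have "emeasure lborel {x. d < \<phi> x} = 0"
      using fin[OF d(1)] by (simp add: \<mu>_def emeasure_eq_measure2)
    then have "{x. d < \<phi> x} \<in> null_sets lebesgue"
      by (intro null_sets_completionI) (auto simp: null_sets_def)
    then have "negligible {x. d < \<phi> x}" by (simp add: negligible_iff_null_sets)
    moreover have "open {x. d < \<phi> x}"
      using f(1) by (intro open_Collect_less continuous_on_const)
    ultimately have "{x. d < \<phi> x} = {}" using open_not_negligible by blast
    then show "\<phi> x \<le> d" by (auto simp: not_less)
  qed
qed

lemma Cc1_uminus:
  assumes "\<phi> \<in> Cc1 \<Omega>"
  shows "(\<lambda>x. - \<phi> x) \<in> Cc1 \<Omega>" "grad (\<lambda>x. - \<phi> x) x = - grad \<phi> x"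
proof -
  have "((\<lambda>t. - t) has_real_derivative - 1) (at t)" for t :: real
    by (auto intro!: derivative_eq_intros)
  from Cc1_compose[OF this _ _ assms] show "(\<lambda>x. - \<phi> x) \<in> Cc1 \<Omega>" "grad (\<lambda>x. - \<phi> x) x = - grad \<phi> x"
    by simp_all
qed

lemma Sobolev_sup:
  fixes \<Omega> :: "'a::euclidean_space set" and r K :: real
  assumes "DIM('a) \<ge> 2" "bounded \<Omega>" "real DIM('a) < r" "0 \<le> K"
  obtains C where "0 \<le> C"
    "\<And>\<phi> x. \<phi> \<in> Cc1 \<Omega> \<Longrightarrow> (\<integral>x. norm (grad \<phi> x) powr r \<partial>lborel) \<le> K \<Longrightarrow> \<bar>\<phi> x\<bar> \<le> C"
proof -
  obtain C where C: "0 \<le> C"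
    "\<And>\<phi> x. \<phi> \<in> Cc1 \<Omega> \<Longrightarrow> (\<integral>x. norm (grad \<phi> x) powr r \<partial>lborel) \<le> K \<Longrightarrow> \<phi> x \<le> C"
    using Sobolev_sup_one_sided[OF assms] by blast
  show ?thesis
  proof (rule that[OF C(1)])
    fix \<phi> x assume *: "\<phi> \<in> Cc1 \<Omega>" "(\<integral>x. norm (grad \<phi> x) powr r \<partial>lborel) \<le> K"
    then show "\<bar>\<phi> x\<bar> \<le> C"
      using C(2)[OF *, of x] C(2)[OF Cc1_uminus(1)[OF *(1)], of x] by (simp add: Cc1_uminus(2)[OF *(1)])
  qed
qed

section \<open>Integration by parts for test functions\<close>

lemma lborel_integral_translate:
  fixes f :: "'a::euclidean_space \<Rightarrow> 'b::{banach, second_countable_topology}"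
  assumes [measurable]: "f \<in> borel_measurable borel"
  shows "(\<integral>x. f (c + x) \<partial>lborel) = (\<integral>x. f x \<partial>lborel)"
proof -
  have "(\<integral>x. f x \<partial>lborel) = (\<integral>x. f x \<partial>distr lborel borel ((+) c))"
    by (simp add: lborel_distr_plus)
  also have "\<dots> = (\<integral>x. f (c + x) \<partial>lborel)"
    by (rule integral_distr) auto
  finally show ?thesis by simp
qed

text \<open>Difference quotients have integral 0 by translation invariance of Lebesgue measure, and
  they converge to the partial derivative under a common majorant.\<close>

lemma integral_grad_Cc1:
  fixes \<phi> :: "'a::euclidean_space \<Rightarrow> real"
  assumes \<phi>: "\<phi> \<in> Cc1 \<Omega>"
  shows "(\<integral>x. grad \<phi> x \<partial>lborel) = 0"
proof (rule euclidean_eqI)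
  fix b :: 'a assume b: "b \<in> Basis"
  note f = Cc1_facts[OF \<phi>]
  note [measurable] = f(3,4)
  obtain B R where B: "0 < B" "0 < R" "\<And>x. \<bar>\<phi> x\<bar> \<le> B" "\<And>x. norm (grad \<phi> x) \<le> B"
    "\<And>x. R \<le> norm x \<Longrightarrow> \<phi> x = 0" "\<And>x. R \<le> norm x \<Longrightarrow> grad \<phi> x = 0"
    using Cc1_bounds[OF \<phi>] by blast
  define h where "h n = 1 / real (Suc n)" for n
  have h: "0 < h n" "h n \<le> 1" for n by (auto simp: h_def)
  define Q where "Q n x = (\<phi> (h n *\<^sub>R b + x) - \<phi> x) / h n" for n x
  have D: "((\<lambda>s. \<phi> (x + s *\<^sub>R b)) has_real_derivative grad \<phi> (x + s *\<^sub>R b) \<bullet> b) (at s)" for s x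
  proof -
    have "((\<lambda>s. x + s *\<^sub>R b) has_derivative (\<lambda>s. s *\<^sub>R b)) (at s)"
      by (auto intro!: derivative_eq_intros)
    from has_derivative_compose[OF this f(5)] show ?thesis
      by (simp add: has_field_derivative_def inner_commute mult_commute_abs)
  qed
  have le: "\<bar>grad \<phi> y \<bullet> b\<bar> \<le> B" for y
    using Basis_le_norm[OF b, of "grad \<phi> y"] B(4)[of y] by linarith
  have "(\<integral>x. Q n x \<partial>lborel) = 0" for n
  proof -
    have "integrable lborel (\<lambda>x. \<phi> (h n *\<^sub>R b + x))"
    proof (rule integrable_bounded_support[where R = "R + 1" and B = B])
      show "\<phi> (h n *\<^sub>R b + x) = 0" if "R + 1 \<le> norm x" for x
        using that h[of n] b norm_diff_ineq[of x "h n *\<^sub>R b"] by (intro B(5)) (simp add: add.commute)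
    qed (use B in auto)
    then show ?thesis
      using integrable_Cc1(3)[OF \<phi>, of 1] unfolding Q_def
      by (simp add: lborel_integral_translate)
  qed
  moreover have "(\<lambda>n. \<integral>x. Q n x \<partial>lborel) \<longlonglongrightarrow> (\<integral>x. grad \<phi> x \<bullet> b \<partial>lborel)"
  proof (rule integral_dominated_convergence)
    show "integrable lborel (\<lambda>x::'a. indicator (cball 0 (R + 1)) x * B :: real)"
      using emeasure_bounded_finite[OF bounded_cball, of "0::'a" "R + 1"]
      by (intro integrable_mult_left integrable_real_indicator) auto
    have "(\<lambda>n. Q n x) \<longlonglongrightarrow> grad \<phi> x \<bullet> b" for x
    proof -
      have "filterlim h (at 0) sequentially"
        unfolding filterlim_at
        using LIMSEQ_inverse_real_of_nat h by (auto simp: h_def[abs_def] inverse_eq_divide)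
      moreover have "((\<lambda>s. (\<phi> (x + s *\<^sub>R b) - \<phi> x) / s) \<longlongrightarrow> grad \<phi> x \<bullet> b) (at 0)"
        using D[of x 0] by (simp add: DERIV_def)
      ultimately show ?thesis
        unfolding Q_def by (auto dest: filterlim_compose simp: add.commute)
    qed
    then show "AE x in lborel. (\<lambda>n. Q n x) \<longlonglongrightarrow> grad \<phi> x \<bullet> b" by simp
    \<comment> \<open>The mean value theorem bounds the quotient by the gradient bound; as the step
      \<open>h n\<close> is at most 1, all quotients vanish outside the ball of radius
      \<open>R + 1\<close>.\<close>
    have "norm (Q n x) \<le> indicator (cball 0 (R + 1)) x * B" for n x
    proof (cases "norm x \<le> R + 1")
      case True
      obtain z where "0 < z" "\<phi> (x + h n *\<^sub>R b) - \<phi> (x + 0 *\<^sub>R b) = (h n - 0) * (grad \<phi> (x + z *\<^sub>R b) \<bullet> b)"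
        using MVT2[of 0 "h n" "\<lambda>s. \<phi> (x + s *\<^sub>R b)" "\<lambda>s. grad \<phi> (x + s *\<^sub>R b) \<bullet> b"] D h by blast
      then have "Q n x = grad \<phi> (x + z *\<^sub>R b) \<bullet> b"
        using h[of n] by (simp add: Q_def add.commute)
      then show ?thesis using le True by simp
    next
      case False
      then have "\<phi> (h n *\<^sub>R b + x) = 0" "\<phi> x = 0"
        using h[of n] b norm_diff_ineq[of x "h n *\<^sub>R b"] by (auto intro!: B(5) simp: add.commute)
      then show ?thesis using B by (simp add: Q_def)
    qed
    then show "AE x in lborel. norm (Q n x) \<le> indicator (cball 0 (R + 1)) x * B" for n by simp
  qed (auto simp: Q_def)
  ultimately have "(\<integral>x. grad \<phi> x \<bullet> b \<partial>lborel) = 0"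
    by (simp add: LIMSEQ_const_iff)
  then show "(\<integral>x. grad \<phi> x \<partial>lborel) \<bullet> b = 0 \<bullet> b"
    using integrable_Cc1(4)[OF \<phi>, of 1] by simp
qed

lemma Cc1_mult:
  assumes \<phi>: "\<phi> \<in> Cc1 \<Omega>" and \<psi>: "\<psi> \<in> Cc1 \<Omega>"
  shows "(\<lambda>x. \<phi> x * \<psi> x) \<in> Cc1 \<Omega>"
    "grad (\<lambda>x. \<phi> x * \<psi> x) x = \<phi> x *\<^sub>R grad \<psi> x + \<psi> x *\<^sub>R grad \<phi> x"
proof -
  note f = Cc1_facts[OF \<phi>] and g = Cc1_facts[OF \<psi>]
  have D: "((\<lambda>x. \<phi> x * \<psi> x) has_derivative (\<lambda>h. (\<phi> x *\<^sub>R grad \<psi> x + \<psi> x *\<^sub>R grad \<phi> x) \<bullet> h)) (at x)" for x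
    using has_derivative_mult[OF f(5) g(5)] by (simp add: inner_add_left mult.commute)
  have cont: "continuous_on UNIV (\<lambda>x. \<phi> x *\<^sub>R grad \<psi> x + \<psi> x *\<^sub>R grad \<phi> x)"
    using f g by (intro continuous_on_add continuous_on_scaleR)
  show "(\<lambda>x. \<phi> x * \<psi> x) \<in> Cc1 \<Omega>"
    using Ck_on_1I[OF D cont] \<phi> compact_support_in_subset[of \<Omega> \<phi> "\<lambda>x. \<phi> x * \<psi> x"]
    by (simp add: Cc1_def del: Ck_on.simps)
  show "grad (\<lambda>x. \<phi> x * \<psi> x) x = \<phi> x *\<^sub>R grad \<psi> x + \<psi> x *\<^sub>R grad \<phi> x"
    by (rule grad_eqI[OF D])
qed

lemma integrable_lebesgue_on_lborel:
  fixes f :: "'a::euclidean_space \<Rightarrow> 'b::{banach, second_countable_topology}"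
  assumes f: "integrable lborel f" and S: "S \<in> sets lebesgue"
  shows "integrable (lebesgue_on S) f"
proof -
  have "integrable lebesgue f" using f by (simp add: integrable_completion)
  then show ?thesis using S by (simp add: integrable_restrict_space integrable_mult_indicator)
qed

lemma integral_lebesgue_on_lborel:
  fixes f :: "'a::euclidean_space \<Rightarrow> 'b::{banach, second_countable_topology}"
  assumes f: "f \<in> borel_measurable borel" and S: "S \<in> sets lebesgue" and 0: "\<And>x. x \<notin> S \<Longrightarrow> f x = 0"
  shows "integral\<^sup>L (lebesgue_on S) f = integral\<^sup>L lborel f"
proof -
  have "(\<lambda>x. indicator S x *\<^sub>R f x) = f" using 0 by (auto simp: indicator_def)
  then show ?thesis using S f by (simp add: integral_restrict_space integral_completion)
qed

text \<open>The product rule applied to \<phi> \<psi>, whose gradient has integral 0.\<close>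

lemma is_weak_grad_Cc1:
  assumes \<phi>: "\<phi> \<in> Cc1 \<Omega>" and \<Omega>: "open \<Omega>"
  shows "is_weak_grad \<Omega> \<phi> (grad \<phi>)"
  unfolding is_weak_grad_def locally_integrable_on_def
proof (intro conjI allI impI ballI)
  note f = Cc1_facts[OF \<phi>]
  note [measurable] = f(3,4)
  have int: "integrable lborel \<phi>" "integrable lborel (grad \<phi>)"
    using integrable_Cc1(3,4)[OF \<phi>, of 1] by auto
  show "integrable (lebesgue_on K) \<phi>" "integrable (lebesgue_on K) (grad \<phi>)" if "compact K \<and> K \<subseteq> \<Omega>" for K
    using that int by (auto intro!: integrable_lebesgue_on_lborel lmeasurable_compact fmeasurableD)
  fix \<psi> assume "\<psi> \<in> Cc_infty \<Omega>"
  then have \<psi>: "\<psi> \<in> Cc1 \<Omega>" using Cc_infty_subset_Cc1 by auto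
  note g = Cc1_facts[OF \<psi>]
  note [measurable] = g(3,4)
  have S: "\<Omega> \<in> sets lebesgue" using \<Omega> by (simp add: borel_open)
  obtain B R where B: "0 < B" "0 < R" "\<And>x. \<bar>\<psi> x\<bar> \<le> B" "\<And>x. norm (grad \<psi> x) \<le> B"
    "\<And>x. R \<le> norm x \<Longrightarrow> \<psi> x = 0" "\<And>x. R \<le> norm x \<Longrightarrow> grad \<psi> x = 0"
    using Cc1_bounds[OF \<psi>] by blast
  obtain B' R' where B': "0 < B'" "0 < R'" "\<And>x. \<bar>\<phi> x\<bar> \<le> B'" "\<And>x. norm (grad \<phi> x) \<le> B'"
    "\<And>x. R' \<le> norm x \<Longrightarrow> \<phi> x = 0" "\<And>x. R' \<le> norm x \<Longrightarrow> grad \<phi> x = 0"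
    using Cc1_bounds[OF \<phi>] by blast
  have int': "integrable lborel (\<lambda>x. \<phi> x *\<^sub>R grad \<psi> x)" "integrable lborel (\<lambda>x. \<psi> x *\<^sub>R grad \<phi> x)"
    by (rule integrable_bounded_support[where R = R and B = "B' * B"]; use B B' in \<open>auto intro!: mult_mono\<close>)
       (rule integrable_bounded_support[where R = R and B = "B * B'"]; use B B' in \<open>auto intro!: mult_mono\<close>)
  have "(\<integral>x. \<phi> x *\<^sub>R grad \<psi> x \<partial>lborel) + (\<integral>x. \<psi> x *\<^sub>R grad \<phi> x \<partial>lborel) = 0"
    using integral_grad_Cc1[OF Cc1_mult(1)[OF \<phi> \<psi>]] int' by (simp add: Cc1_mult(2)[OF \<phi> \<psi>])
  moreover have "integral\<^sup>L (lebesgue_on \<Omega>) (\<lambda>x. \<phi> x *\<^sub>R grad \<psi> x) = (\<integral>x. \<phi> x *\<^sub>R grad \<psi> x \<partial>lborel)"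
    "integral\<^sup>L (lebesgue_on \<Omega>) (\<lambda>x. \<psi> x *\<^sub>R grad \<phi> x) = (\<integral>x. \<psi> x *\<^sub>R grad \<phi> x \<partial>lborel)"
    by (intro integral_lebesgue_on_lborel S; simp add: f g)+
  ultimately show "integral\<^sup>L (lebesgue_on \<Omega>) (\<lambda>x. \<phi> x *\<^sub>R grad \<psi> x) = - integral\<^sup>L (lebesgue_on \<Omega>) (\<lambda>x. \<psi> x *\<^sub>R grad \<phi> x)"
    by (simp add: add_eq_0_iff)
qed

subsection \<open>The fundamental lemma and weak gradients\<close>

text \<open>With c = 1/(n+1) tending to 0, each factor exp(-c/t) tends to 1 for t > 0. So these
  smooth functions, bounded by 1, converge pointwise to the indicator of the open box.\<close>

definition box_bump :: "nat \<Rightarrow> 'a::euclidean_space \<Rightarrow> 'a \<Rightarrow> 'a \<Rightarrow> real" where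
  "box_bump n a b x = (\<Prod>i\<in>Basis. exp_cutoff (1 / real (Suc n)) 0 (x \<bullet> i - a \<bullet> i) *
     exp_cutoff (1 / real (Suc n)) 0 (b \<bullet> i - x \<bullet> i))"

lemma exp_cutoff_0_bounds: "0 < c \<Longrightarrow> 0 \<le> exp_cutoff c 0 t" "0 < c \<Longrightarrow> exp_cutoff c 0 t \<le> 1"
  by (auto simp: exp_cutoff_0)

lemma box_bump_bounds: "0 \<le> box_bump n a b x" "box_bump n a b x \<le> 1"
  unfolding box_bump_def
  by (auto intro!: prod_nonneg prod_le_1 mult_nonneg_nonneg mult_le_one exp_cutoff_0_bounds)

lemma box_bump_outside:
  assumes "x \<notin> box a b"
  shows "box_bump n a b x = 0"
proof -
  obtain i where "i \<in> Basis" "\<not> (a \<bullet> i < x \<bullet> i \<and> x \<bullet> i < b \<bullet> i)"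
    using assms by (auto simp: mem_box)
  then show ?thesis
    unfolding box_bump_def by (intro prod_zero bexI[of _ i]) (auto simp: exp_cutoff_0)
qed

lemma box_bump_tendsto: "(\<lambda>n. box_bump n a b x) \<longlonglongrightarrow> indicator (box a b) x"
proof (cases "x \<in> box a b")
  case True
  have *: "(\<lambda>n. exp_cutoff (1 / real (Suc n)) 0 t) \<longlonglongrightarrow> 1" if "0 < t" for t
  proof -
    have "(\<lambda>n. exp (- (inverse (real (Suc n)) / t))) \<longlonglongrightarrow> exp (- (0 / t))"
      by (intro tendsto_intros LIMSEQ_inverse_real_of_nat) (use that in auto)
    then show ?thesis using that by (simp add: exp_cutoff_0 inverse_eq_divide)
  qed
  have "(\<lambda>n. box_bump n a b x) \<longlonglongrightarrow> (\<Prod>i\<in>(Basis::'a set). 1 * 1)"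
    unfolding box_bump_def using True by (intro tendsto_prod tendsto_mult *) (auto simp: mem_box)
  then show ?thesis using True by simp
next
  case False
  then show ?thesis by (simp add: box_bump_outside)
qed

lemma box_bump_Cc_infty:
  assumes "cbox a b \<subseteq> \<Omega>"
  shows "box_bump n a b \<in> Cc_infty \<Omega>"
proof -
  have D: "deriv_seq (exp_cutoff (1 / real (Suc n)))" by (rule deriv_seq_exp_cutoff) simp
  have 1: "Ck_on k UNIV (\<lambda>x. x \<bullet> i - a \<bullet> i)" "Ck_on k UNIV (\<lambda>x. b \<bullet> i - x \<bullet> i)" for k and i :: 'a
    using Ck_on_add[OF Ck_on_inner[of k i] Ck_on_const[of k "- (a \<bullet> i)"]]
      Ck_on_add[OF Ck_on_inner[of k "- i"] Ck_on_const[of k "b \<bullet> i"]]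
    by simp_all
  have "Ck_on k UNIV (box_bump n a b)" for k
    unfolding box_bump_def[abs_def] by (intro Ck_on_prod Ck_on_mult Ck_on_compose[OF D] 1)
  moreover have "{x. box_bump n a b x \<noteq> 0} \<subseteq> cbox a b"
    using box_bump_outside box_subset_cbox[of a b] by blast
  then have *: "closure {x. box_bump n a b x \<noteq> 0} \<subseteq> cbox a b"
    by (intro closure_minimal) auto
  have "compact (cbox a b \<inter> closure {x. box_bump n a b x \<noteq> 0})"
    by (intro compact_Int_closed) auto
  then have "compact_support_in \<Omega> (box_bump n a b)"
    using * assms by (auto simp: compact_support_in_def Int_absorb1)
  ultimately show ?thesis by (auto simp: Cc_infty_def smooth_on_def)
qed

text \<open>Boxes form an intersection-stable generator of the Borel sets, so the integral vanishes
  over every Borel set. The whole space is not a box, and complements require the integral over it: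
  hence the separate assumption. A Borel representative of \<open>h\<close> replaces
  \<open>h\<close> throughout.\<close>

lemma AE_zero_if_zero_on_boxes:
  fixes h :: "'a::euclidean_space \<Rightarrow> real"
  assumes int: "integrable lebesgue h" and 0: "(\<integral>x. h x \<partial>lebesgue) = 0"
    and box: "\<And>c d. (\<integral>x. indicator (box c d) x * h x \<partial>lebesgue) = 0"
  shows "AE x in lebesgue. h x = 0"
proof -
  obtain h' where h'[measurable]: "h' \<in> borel_measurable lborel" and eq: "AE x in lborel. h x = h' x"
    using completion_ex_borel_measurable_real[OF borel_measurable_integrable[OF int]] by auto
  have [measurable]: "h \<in> borel_measurable lebesgue" using int by auto
  have eq': "AE x in lebesgue. h x = h' x" using eq by (simp add: AE_completion)
  have h'c: "h' \<in> borel_measurable lebesgue" by (rule measurable_completion[OF h'])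
  have int': "integrable lborel h'"
  proof -
    have "integrable lebesgue h'"
      using integrable_cong_AE[of h lebesgue h'] int h'c eq' by auto
    then show ?thesis using h' by (simp add: integrable_completion)
  qed
  have trans: "(\<integral>x. indicator A x * h' x \<partial>lborel) = (\<integral>x. indicator A x * h x \<partial>lebesgue)" if A: "A \<in> sets borel" for A
  proof -
    have [measurable]: "A \<in> sets lborel" using A by simp
    have Al: "A \<in> sets lebesgue" using A by auto
    have "(\<integral>x. indicator A x * h' x \<partial>lborel) = (\<integral>x. indicator A x * h' x \<partial>lebesgue)"
      by (rule integral_completion[symmetric]) measurable
    also have "\<dots> = (\<integral>x. indicator A x * h x \<partial>lebesgue)"
      using eq' Al h'c by (intro integral_cong_AE) (auto intro!: borel_measurable_times)
    finally show ?thesis .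
  qed
  have "(\<integral>x. indicator A x * h' x \<partial>lborel) = 0" if "A \<in> sets borel" for A
  proof -
    let ?G = "range (\<lambda>(a, b). box a b :: 'a set)"
    have sets: "sets borel = sigma_sets UNIV ?G"
      by (subst borel_eq_box) simp
    have A: "A \<in> sigma_sets UNIV ?G"
      using that sets by simp
    have "Int_stable ?G"
    proof (rule Int_stableI)
      fix A B assume "A \<in> ?G" "B \<in> ?G"
      then obtain a b c d where "A = box a b" "B = box c d" by auto
      then show "A \<inter> B \<in> ?G" by (auto simp: box_Int_box)
    qed
    moreover have "?G \<subseteq> Pow UNIV" by simp
    ultimately show ?thesis
      using A
    proof (induction rule: sigma_sets_induct_disjoint)
      case (basic A)
      then obtain c d where "A = box c d" by auto
      then show ?case using trans[of "box c d"] box by auto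
    next
      case (compl A)
      then have A: "A \<in> sets borel" using sets by simp
      have "(\<integral>x. indicator (UNIV - A) x * h' x \<partial>lborel) = (\<integral>x. h' x - indicator A x * h' x \<partial>lborel)"
        by (intro Bochner_Integration.integral_cong) (auto simp: indicator_def)
      also have "\<dots> = (\<integral>x. h' x \<partial>lborel) - (\<integral>x. indicator A x * h' x \<partial>lborel)"
        using A int' integrable_mult_indicator[of A lborel h'] by (intro Bochner_Integration.integral_diff) auto
      also have "(\<integral>x. h' x \<partial>lborel) = 0"
        using trans[of UNIV] 0 by simp
      finally show ?case using compl by simp
    next
      case (union A)
      then have A: "\<And>i. A i \<in> sets lborel" using sets by auto
      have "(LINT x:(\<Union>i. A i)|lborel. h' x) = (\<Sum>i. (LINT x:(A i)|lborel. h' x))"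
        using union A int' integrable_mult_indicator[of "\<Union>i. A i" lborel h']
        by (intro lebesgue_integral_countable_add) (auto simp: disjoint_family_on_def set_integrable_def)
      then show ?case using union by (simp add: set_lebesgue_integral_def)
    qed auto
  qed
  then have "AE x in lborel. h' x = 0"
    using int' by (intro sigma_finite_measure.density_zero[OF lborel.sigma_finite_measure_axioms]) (auto simp: set_lebesgue_integral_def)
  then have "AE x in lebesgue. h' x = 0" by (simp add: AE_completion)
  with eq' show ?thesis by eventually_elim simp
qed

lemma integrable_compact_times_locally_integrable:
  fixes g :: "'a::euclidean_space \<Rightarrow> 'b::euclidean_space"
  assumes \<phi>: "\<phi> \<in> borel_measurable borel" "\<And>x. \<bar>\<phi> x\<bar> \<le> B" "\<And>x. x \<notin> K \<Longrightarrow> \<phi> x = 0"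
    and K: "compact K" "K \<subseteq> \<Omega>" and g: "locally_integrable_on g \<Omega>" and \<Omega>: "open \<Omega>"
  shows "integrable (lebesgue_on \<Omega>) (\<lambda>x. \<phi> x *\<^sub>R g x)"
proof -
  have Kl: "K \<in> sets lebesgue" "\<Omega> \<in> sets lebesgue"
    using K \<Omega> by (auto simp: lmeasurable_compact fmeasurableD)
  have B: "0 \<le> B" using \<phi>(2)[of undefined] by linarith
  have "integrable (lebesgue_on K) g" using g K by (auto simp: locally_integrable_on_def)
  then have gK: "integrable lebesgue (\<lambda>x. indicator K x *\<^sub>R g x)"
    using Kl by (simp add: integrable_restrict_space)
  have "integrable lebesgue (\<lambda>x. \<phi> x *\<^sub>R (indicator K x *\<^sub>R g x))"
  proof (rule Bochner_Integration.integrable_bound)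
    show "integrable lebesgue (\<lambda>x. B *\<^sub>R (indicator K x *\<^sub>R g x))"
      using gK by (rule integrable_scaleR_right)
    show "AE x in lebesgue. norm (\<phi> x *\<^sub>R (indicator K x *\<^sub>R g x)) \<le> norm (B *\<^sub>R (indicator K x *\<^sub>R g x))"
      using \<phi>(2) B by (auto simp: indicator_def intro!: mult_right_mono)
    show "(\<lambda>x. \<phi> x *\<^sub>R (indicator K x *\<^sub>R g x)) \<in> borel_measurable lebesgue"
      using \<phi>(1) by (intro borel_measurable_scaleR[OF _ borel_measurable_integrable[OF gK]] measurable_completion) simp
  qed
  moreover have "(\<lambda>x. \<phi> x *\<^sub>R (indicator K x *\<^sub>R g x)) = (\<lambda>x. indicator \<Omega> x *\<^sub>R (\<phi> x *\<^sub>R g x))"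
  proof
    fix x
    show "\<phi> x *\<^sub>R (indicator K x *\<^sub>R g x) = indicator \<Omega> x *\<^sub>R (\<phi> x *\<^sub>R g x)"
      using K \<phi>(3) by (cases "x \<in> K") (auto simp: indicator_def)
  qed
  ultimately show ?thesis using Kl by (simp add: integrable_restrict_space)
qed

lemma integrable_test_times_locally_integrable:
  assumes \<phi>: "\<phi> \<in> Cc1 \<Omega>" and \<Omega>: "open \<Omega>"
  shows "locally_integrable_on (g :: 'a::euclidean_space \<Rightarrow> 'b::euclidean_space) \<Omega> \<Longrightarrow>
      integrable (lebesgue_on \<Omega>) (\<lambda>x. \<phi> x *\<^sub>R g x)"
    and "locally_integrable_on u \<Omega> \<Longrightarrow> integrable (lebesgue_on \<Omega>) (\<lambda>x. u x *\<^sub>R grad \<phi> x)"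
proof -
  define K where "K = closure {x. \<phi> x \<noteq> 0}"
  have K: "compact K" "K \<subseteq> \<Omega>" "\<phi> \<in> Cc1 K"
    using \<phi> by (auto simp: Cc1_def compact_support_in_def K_def)
  note f = Cc1_facts[OF K(3)]
  obtain B R where B: "0 < B" "0 < R" "\<And>x. \<bar>\<phi> x\<bar> \<le> B" "\<And>x. norm (grad \<phi> x) \<le> B"
    "\<And>x. R \<le> norm x \<Longrightarrow> \<phi> x = 0" "\<And>x. R \<le> norm x \<Longrightarrow> grad \<phi> x = 0"
    using Cc1_bounds[OF \<phi>] by blast
  show "integrable (lebesgue_on \<Omega>) (\<lambda>x. \<phi> x *\<^sub>R g x)" if "locally_integrable_on g \<Omega>"
    for g :: "'a \<Rightarrow> 'b"
    by (rule integrable_compact_times_locally_integrable[OF f(3) B(3) f(6) K(1,2) that \<Omega>])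
  assume u: "locally_integrable_on u \<Omega>"
  \<comment> \<open>The preceding lemma allows only a scalar test factor, so the gradient is split
    into its coordinates.\<close>
  have "integrable (lebesgue_on \<Omega>) (\<lambda>x. \<Sum>b\<in>Basis. ((grad \<phi> x \<bullet> b) *\<^sub>R u x) *\<^sub>R b)"
  proof (intro Bochner_Integration.integrable_sum integrable_scaleR_left)
    fix b :: 'a assume b: "b \<in> Basis"
    note [measurable] = f(4)
    have "\<bar>grad \<phi> x \<bullet> b\<bar> \<le> B" for x
      using Basis_le_norm[OF b, of "grad \<phi> x"] B(4)[of x] by linarith
    then show "integrable (lebesgue_on \<Omega>) (\<lambda>x. (grad \<phi> x \<bullet> b) *\<^sub>R u x)"
      by (intro integrable_compact_times_locally_integrable[OF _ _ _ K(1,2) u \<Omega>]) (auto simp: f(7))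
  qed
  moreover have "(\<Sum>b\<in>Basis. ((grad \<phi> x \<bullet> b) *\<^sub>R u x) *\<^sub>R b) = u x *\<^sub>R grad \<phi> x" for x
  proof -
    have "u x *\<^sub>R grad \<phi> x = u x *\<^sub>R (\<Sum>b\<in>Basis. (grad \<phi> x \<bullet> b) *\<^sub>R b)"
      by (simp only: euclidean_representation)
    also have "\<dots> = (\<Sum>b\<in>Basis. ((grad \<phi> x \<bullet> b) *\<^sub>R u x) *\<^sub>R b)"
      by (simp only: scaleR_sum_right scaleR_scaleR real_scaleR_def mult.commute)
    finally show ?thesis by simp
  qed
  ultimately show "integrable (lebesgue_on \<Omega>) (\<lambda>x. u x *\<^sub>R grad \<phi> x)" by simp
qed

text \<open>Bumps converging to the indicator of a box show that \<open>g\<close> has integral 0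
  over every open box whose closure lies in \<Omega>. Hence \<open>g\<close> vanishes almost
  everywhere on each such box, and countably many closed boxes exhaust \<Omega>.\<close>

lemma fundamental_lemma_real:
  fixes g :: "'a::euclidean_space \<Rightarrow> real"
  assumes \<Omega>: "open \<Omega>" and g: "locally_integrable_on g \<Omega>"
    and 0: "\<And>\<phi>. \<phi> \<in> Cc_infty \<Omega> \<Longrightarrow> integral\<^sup>L (lebesgue_on \<Omega>) (\<lambda>x. \<phi> x * g x) = 0"
  shows "AE x in lebesgue_on \<Omega>. g x = 0"
proof -
  have S: "\<Omega> \<in> sets lebesgue" using \<Omega> by auto
  have box0: "(\<integral>x. indicator (box a b) x * g x \<partial>lebesgue) = 0"
    and boxi: "integrable lebesgue (\<lambda>x. indicator (box a b) x * g x)"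
    if ab: "cbox a b \<subseteq> \<Omega>" for a b :: 'a
  proof -
    have gi: "integrable lebesgue (\<lambda>x. indicator (cbox a b) x * g x)"
      using g ab by (auto simp: locally_integrable_on_def integrable_restrict_space dest!: spec[of _ "cbox a b"])
    have eq: "indicator \<Omega> x *\<^sub>R (box_bump n a b x * g x) = box_bump n a b x * (indicator (cbox a b) x * g x)" for n x
      using box_bump_outside[of x a b n] box_subset_cbox[of a b] ab
      by (cases "x \<in> box a b") (auto simp: indicator_def)
    have 1: "(\<integral>x. box_bump n a b x * (indicator (cbox a b) x * g x) \<partial>lebesgue) = 0" for n
    proof -
      have "integral\<^sup>L (lebesgue_on \<Omega>) (\<lambda>x. box_bump n a b x * g x)
          = (\<integral>x. indicator \<Omega> x *\<^sub>R (box_bump n a b x * g x) \<partial>lebesgue)"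
        using S by (intro integral_restrict_space) simp
      then show ?thesis using 0[OF box_bump_Cc_infty[OF ab, of n]] by (simp only: eq)
    qed
    have bm: "box_bump n a b \<in> borel_measurable lebesgue" for n
      using Cc1_facts(3)[OF subsetD[OF Cc_infty_subset_Cc1 box_bump_Cc_infty[OF ab]]]
      by (intro measurable_completion) simp
    have gm: "(\<lambda>x. indicator (cbox a b) x * g x) \<in> borel_measurable lebesgue" using gi by auto
    have "(\<lambda>n. \<integral>x. box_bump n a b x * (indicator (cbox a b) x * g x) \<partial>lebesgue)
        \<longlonglongrightarrow> (\<integral>x. indicator (box a b) x * (indicator (cbox a b) x * g x) \<partial>lebesgue)"
    proof (rule integral_dominated_convergence)
      show "integrable lebesgue (\<lambda>x. norm (indicator (cbox a b) x * g x))" using gi by simp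
      show "AE x in lebesgue. (\<lambda>n. box_bump n a b x * (indicator (cbox a b) x * g x))
          \<longlonglongrightarrow> indicator (box a b) x * (indicator (cbox a b) x * g x)"
        by (intro AE_I2 tendsto_intros box_bump_tendsto)
      show "AE x in lebesgue. norm (box_bump n a b x * (indicator (cbox a b) x * g x))
          \<le> norm (indicator (cbox a b) x * g x)" for n
        using box_bump_bounds[of n a b] by (auto simp: abs_mult intro!: mult_left_le_one_le)
      show "(\<lambda>x. box_bump n a b x * (indicator (cbox a b) x * g x)) \<in> borel_measurable lebesgue" for n
        by (rule borel_measurable_times[OF bm gm])
      show "(\<lambda>x. indicator (box a b) x * (indicator (cbox a b) x * g x)) \<in> borel_measurable lebesgue"
        by (rule borel_measurable_times[OF borel_measurable_indicator gm]) auto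
    qed
    moreover have eq2: "indicator (box a b) x * (indicator (cbox a b) x * g x) = indicator (box a b) x * g x" for x
      using box_subset_cbox[of a b] by (auto simp: indicator_def)
    ultimately show "(\<integral>x. indicator (box a b) x * g x \<partial>lebesgue) = 0"
      by (simp add: 1 LIMSEQ_const_iff)
    show "integrable lebesgue (\<lambda>x. indicator (box a b) x * g x)"
      using integrable_mult_indicator[OF _ gi, of "box a b"] by (simp add: eq2)
  qed
  have cb: "AE x in lebesgue. x \<in> cbox a b \<longrightarrow> g x = 0" if ab: "cbox a b \<subseteq> \<Omega>" for a b
  proof -
    have "AE x in lebesgue. indicator (box a b) x * g x = 0"
    proof (rule AE_zero_if_zero_on_boxes[OF boxi[OF ab] box0[OF ab]])
      fix c d :: 'a
      \<comment> \<open>The corners of the intersection of the two boxes, which is again a box whose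
        closed version lies in \<Omega>.\<close>
      define a' b' where "a' = (\<Sum>i\<in>Basis. max (a\<bullet>i) (c\<bullet>i) *\<^sub>R i)" and "b' = (\<Sum>i\<in>Basis. min (b\<bullet>i) (d\<bullet>i) *\<^sub>R i)"
      have "indicator (box c d) x * (indicator (box a b) x * g x) = indicator (box a' b') x * g x" for x
        unfolding a'_def b'_def box_Int_box[symmetric] by (simp add: indicator_inter_arith)
      moreover have "cbox a' b' \<subseteq> \<Omega>"
        using ab unfolding a'_def b'_def Int_interval[symmetric] by auto
      ultimately show "(\<integral>x. indicator (box c d) x * (indicator (box a b) x * g x) \<partial>lebesgue) = 0"
        using box0[of a' b'] by (simp only:)
    qed
    \<comment> \<open>The bumps only see the open box, whereas the countable cover consists of
      closed ones; the faces in between are null sets.\<close>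
    moreover have "AE x in lebesgue. x \<notin> cbox a b - box a b"
      using negligible_frontier_interval[of a b] by (intro AE_not_in) (simp add: negligible_iff_null_sets)
    ultimately show ?thesis by eventually_elim auto
  qed
  obtain \<D> where \<D>: "countable \<D>" "\<D> \<subseteq> Pow \<Omega>" "\<And>X. X \<in> \<D> \<Longrightarrow> \<exists>a b. X = cbox a b" "\<Union>\<D> = \<Omega>"
    using open_countable_Union_open_cbox[OF \<Omega>] by metis
  have "AE x in lebesgue. \<forall>X\<in>\<D>. x \<in> X \<longrightarrow> g x = 0"
  proof (subst AE_ball_countable[OF \<D>(1)], intro ballI)
    fix X assume X: "X \<in> \<D>"
    then obtain a b where "X = cbox a b" using \<D>(3) by metis
    moreover have "X \<subseteq> \<Omega>" using X \<D>(2) by auto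
    ultimately show "AE x in lebesgue. x \<in> X \<longrightarrow> g x = 0" using cb by simp
  qed
  then have "AE x in lebesgue. x \<in> \<Omega> \<longrightarrow> g x = 0"
    by eventually_elim (use \<D>(4) in auto)
  then show ?thesis using S by (simp add: AE_restrict_space_iff)
qed

lemma fundamental_lemma:
  fixes g :: "'a::euclidean_space \<Rightarrow> 'b::euclidean_space"
  assumes \<Omega>: "open \<Omega>" and g: "locally_integrable_on g \<Omega>"
    and 0: "\<And>\<phi>. \<phi> \<in> Cc_infty \<Omega> \<Longrightarrow> integral\<^sup>L (lebesgue_on \<Omega>) (\<lambda>x. \<phi> x *\<^sub>R g x) = 0"
  shows "AE x in lebesgue_on \<Omega>. g x = 0"
proof -
  have "AE x in lebesgue_on \<Omega>. g x \<bullet> b = 0" for b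
  proof (rule fundamental_lemma_real[OF \<Omega>])
    show "locally_integrable_on (\<lambda>x. g x \<bullet> b) \<Omega>"
      using g by (auto simp: locally_integrable_on_def)
    fix \<phi> assume \<phi>: "\<phi> \<in> Cc_infty \<Omega>"
    then have "integrable (lebesgue_on \<Omega>) (\<lambda>x. \<phi> x *\<^sub>R g x)"
      using Cc_infty_subset_Cc1 by (intro integrable_test_times_locally_integrable(1)[OF _ \<Omega> g]) auto
    then show "integral\<^sup>L (lebesgue_on \<Omega>) (\<lambda>x. \<phi> x * (g x \<bullet> b)) = 0"
      using 0[OF \<phi>] integral_inner_left[where M = "lebesgue_on \<Omega>" and f = "\<lambda>x. \<phi> x *\<^sub>R g x" and c = b]
      by simp
  qed
  then have "AE x in lebesgue_on \<Omega>. \<forall>b\<in>Basis. g x \<bullet> b = 0"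
    by (subst AE_ball_countable) (auto intro: countable_finite)
  then show ?thesis
    by eventually_elim (simp add: euclidean_all_zero_iff)
qed

section \<open>Uniqueness of weak gradients\<close>

lemma locally_integrable_on_diff:
  "locally_integrable_on f \<Omega> \<Longrightarrow> locally_integrable_on g \<Omega> \<Longrightarrow> locally_integrable_on (\<lambda>x. f x - g x) \<Omega>"
  by (auto simp: locally_integrable_on_def)

lemma is_weak_grad_unique:
  assumes \<Omega>: "open \<Omega>" and g: "is_weak_grad \<Omega> u g" "is_weak_grad \<Omega> u h"
  shows "AE x in lebesgue_on \<Omega>. g x = h x"
proof -
  have li: "locally_integrable_on g \<Omega>" "locally_integrable_on h \<Omega>" using g by (auto simp: is_weak_grad_def)
  have "AE x in lebesgue_on \<Omega>. g x - h x = 0"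
  proof (rule fundamental_lemma[OF \<Omega> locally_integrable_on_diff[OF li]])
    fix \<phi> assume \<phi>: "\<phi> \<in> Cc_infty \<Omega>"
    then have "\<phi> \<in> Cc1 \<Omega>" using Cc_infty_subset_Cc1 by auto
    note i = integrable_test_times_locally_integrable(1)[OF this \<Omega> li(1)]
      integrable_test_times_locally_integrable(1)[OF this \<Omega> li(2)]
    have "- integral\<^sup>L (lebesgue_on \<Omega>) (\<lambda>x. \<phi> x *\<^sub>R g x) = - integral\<^sup>L (lebesgue_on \<Omega>) (\<lambda>x. \<phi> x *\<^sub>R h x)"
      using g \<phi> unfolding is_weak_grad_def by metis
    then show "integral\<^sup>L (lebesgue_on \<Omega>) (\<lambda>x. \<phi> x *\<^sub>R (g x - h x)) = 0"
      using i by (simp add: scaleR_diff_right)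
  qed
  then show ?thesis by simp
qed

lemma wgrad_is_weak_grad: "is_weak_grad \<Omega> u g \<Longrightarrow> is_weak_grad \<Omega> u (wgrad \<Omega> u)"
  unfolding wgrad_def by (rule someI[of "is_weak_grad \<Omega> u"])

lemma wgrad_AE_eq:
  assumes "open \<Omega>" "is_weak_grad \<Omega> u g"
  shows "AE x in lebesgue_on \<Omega>. wgrad \<Omega> u x = g x"
  using is_weak_grad_unique[OF assms(1) wgrad_is_weak_grad[OF assms(2)] assms(2)] .

lemma is_weak_grad_diff:
  assumes \<Omega>: "open \<Omega>" and u: "is_weak_grad \<Omega> u g" "is_weak_grad \<Omega> v h"
  shows "is_weak_grad \<Omega> (\<lambda>x. u x - v x) (\<lambda>x. g x - h x)"
  unfolding is_weak_grad_def
proof (intro conjI ballI)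
  show "locally_integrable_on (\<lambda>x. u x - v x) \<Omega>" "locally_integrable_on (\<lambda>x. g x - h x) \<Omega>"
    using u by (auto simp: is_weak_grad_def intro: locally_integrable_on_diff)
  fix \<phi> assume \<phi>: "\<phi> \<in> Cc_infty \<Omega>"
  then have \<phi>1: "\<phi> \<in> Cc1 \<Omega>" using Cc_infty_subset_Cc1 by auto
  have i: "integrable (lebesgue_on \<Omega>) (\<lambda>x. \<phi> x *\<^sub>R g x)" "integrable (lebesgue_on \<Omega>) (\<lambda>x. \<phi> x *\<^sub>R h x)"
    using u by (auto simp: is_weak_grad_def intro!: integrable_test_times_locally_integrable(1)[OF \<phi>1 \<Omega>])
  have j: "integrable (lebesgue_on \<Omega>) (\<lambda>x. u x *\<^sub>R grad \<phi> x)" "integrable (lebesgue_on \<Omega>) (\<lambda>x. v x *\<^sub>R grad \<phi> x)"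
    using u by (auto simp: is_weak_grad_def intro!: integrable_test_times_locally_integrable(2)[OF \<phi>1 \<Omega>])
  show "integral\<^sup>L (lebesgue_on \<Omega>) (\<lambda>x. (u x - v x) *\<^sub>R grad \<phi> x)
      = - integral\<^sup>L (lebesgue_on \<Omega>) (\<lambda>x. \<phi> x *\<^sub>R (g x - h x))"
    using u \<phi> i j by (simp add: is_weak_grad_def scaleR_diff_left scaleR_diff_right)
qed

subsection \<open>Weighted spaces on a bounded open set\<close>

lemma complete_measure_lebesgue_on:
  assumes S: "S \<in> sets lebesgue"
  shows "complete_measure (lebesgue_on S)"
proof
  fix B A assume *: "A \<subseteq> B" "B \<in> null_sets (lebesgue_on S)"
  then have "B \<subseteq> S" "B \<in> null_sets lebesgue"
    using S by (auto simp: null_sets_restrict_space)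
  then have "A \<in> null_sets lebesgue"
    using *(1) by (rule_tac complete_measure.complete2[OF completion.complete_measure_axioms]) auto
  then show "A \<in> sets (lebesgue_on S)"
    using \<open>B \<subseteq> S\<close> *(1) S by (auto simp: sets_restrict_space_iff)
qed

text \<open>Completeness of the measure makes preimages that differ by a null set measurable. This
  serves functions known only up to null sets, such as \<open>wgrad\<close> and almost-everywhere
  limits.\<close>

lemma measurable_lebesgue_on_cong_AE:
  assumes S: "S \<in> sets lebesgue" and f: "f \<in> borel_measurable (lebesgue_on S)"
    and eq: "AE x in lebesgue_on S. f x = g x"
  shows "g \<in> borel_measurable (lebesgue_on S)"
proof (rule measurableI)
  fix A :: "'b set" assume A: "A \<in> sets borel"
  have "AE x in lebesgue_on S. x \<in> f -` A \<inter> space (lebesgue_on S) \<longleftrightarrow> x \<in> g -` A \<inter> space (lebesgue_on S)"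
    using eq by eventually_elim auto
  then show "g -` A \<inter> space (lebesgue_on S) \<in> sets (lebesgue_on S)"
    using measurable_sets[OF f A]
    by (rule complete_measure.in_sets_AE[OF complete_measure_lebesgue_on[OF S]]) auto
qed simp

lemma measurable_lebesgue_on_AE_LIMSEQ:
  fixes f :: "nat \<Rightarrow> 'a::euclidean_space \<Rightarrow> 'b::{second_countable_topology, real_normed_vector}"
  assumes S: "S \<in> sets lebesgue" and f: "\<And>n. f n \<in> borel_measurable (lebesgue_on S)"
    and lim: "AE x in lebesgue_on S. (\<lambda>n. f n x) \<longlonglongrightarrow> g x"
  shows "g \<in> borel_measurable (lebesgue_on S)"
proof -
  obtain N where N: "N \<in> null_sets (lebesgue_on S)" "{x \<in> space (lebesgue_on S). \<not> (\<lambda>n. f n x) \<longlonglongrightarrow> g x} \<subseteq> N"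
    using lim by (auto simp: eventually_ae_filter)
  define h where "h x = indicator (S - N) x *\<^sub>R g x" for x
  have "h \<in> borel_measurable (lebesgue_on S)"
  proof (rule borel_measurable_LIMSEQ_metric)
    show "(\<lambda>x. indicator (S - N) x *\<^sub>R f n x) \<in> borel_measurable (lebesgue_on S)" for n
      using N(1) f by (intro borel_measurable_scaleR borel_measurable_indicator) auto
    show "(\<lambda>n. indicator (S - N) x *\<^sub>R f n x) \<longlonglongrightarrow> h x" if "x \<in> space (lebesgue_on S)" for x
      using N(2) that by (cases "x \<in> N") (auto simp: h_def)
  qed
  moreover have "AE x in lebesgue_on S. h x = g x"
    using AE_not_in[OF N(1)] AE_space by eventually_elim (simp add: h_def)
  ultimately show ?thesis by (rule measurable_lebesgue_on_cong_AE[OF S])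
qed

lemma integrable_lebesgue_on_subset:
  fixes f :: "'a::euclidean_space \<Rightarrow> 'b::{banach, second_countable_topology}"
  assumes f: "integrable (lebesgue_on T) f" and S: "S \<subseteq> T" "S \<in> sets lebesgue" "T \<in> sets lebesgue"
  shows "integrable (lebesgue_on S) f"
proof -
  have "integrable lebesgue (\<lambda>x. indicator T x *\<^sub>R f x)"
    using f S by (simp add: integrable_restrict_space)
  then have "integrable lebesgue (\<lambda>x. indicator S x *\<^sub>R (indicator T x *\<^sub>R f x))"
    using S(2) by (rule integrable_mult_indicator[rotated])
  moreover have "(\<lambda>x. indicator S x *\<^sub>R (indicator T x *\<^sub>R f x)) = (\<lambda>x. indicator S x *\<^sub>R f x)"
    by (rule ext) (use S in \<open>auto simp: indicator_def\<close>)
  ultimately show ?thesis using S by (simp add: integrable_restrict_space)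
qed

text \<open>An open set is a countable union of closed boxes, on each of which \<open>f\<close> is
  integrable.\<close>

lemma locally_integrable_on_measurable:
  fixes f :: "'a::euclidean_space \<Rightarrow> 'b::{banach, second_countable_topology}"
  assumes f: "locally_integrable_on f \<Omega>" and \<Omega>: "open \<Omega>"
  shows "f \<in> borel_measurable (lebesgue_on \<Omega>)"
proof -
  obtain \<D> where \<D>: "countable \<D>" "\<D> \<subseteq> Pow \<Omega>" "\<And>X. X \<in> \<D> \<Longrightarrow> \<exists>a b. X = cbox a b" "\<Union>\<D> = \<Omega>"
    using open_countable_Union_open_cbox[OF \<Omega>] by metis
  have S: "\<Omega> \<in> sets lebesgue" using \<Omega> by auto
  show ?thesis
  proof (rule measurableI)
    fix A :: "'b set" assume A: "A \<in> sets borel"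
    have "f -` A \<inter> X \<in> sets lebesgue" if X: "X \<in> \<D>" for X
    proof -
      obtain a b where ab: "X = cbox a b" using \<D>(3)[OF X] by auto
      then have "integrable (lebesgue_on X) f"
        using f X \<D>(2) by (auto simp: locally_integrable_on_def)
      from measurable_sets[OF borel_measurable_integrable[OF this] A] show ?thesis
        using ab by (auto simp: sets_restrict_space_iff)
    qed
    then have "(\<Union>X\<in>\<D>. f -` A \<inter> X) \<in> sets lebesgue"
      using \<D>(1) by (intro sets.countable_UN') auto
    moreover have "(\<Union>X\<in>\<D>. f -` A \<inter> X) = f -` A \<inter> \<Omega>" using \<D>(4) by auto
    ultimately show "f -` A \<inter> space (lebesgue_on \<Omega>) \<in> sets (lebesgue_on \<Omega>)"
      using S by (simp add: sets_restrict_space_iff)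
  qed simp
qed

lemma norm_add_powr_le:
  fixes a b :: "'b::real_normed_vector"
  assumes "0 \<le> p"
  shows "norm (a + b) powr p \<le> 2 powr p * (norm a powr p + norm b powr p)"
proof -
  have "norm (a + b) \<le> 2 * max (norm a) (norm b)"
    using norm_triangle_ineq[of a b] by linarith
  then have "norm (a + b) powr p \<le> (2 * max (norm a) (norm b)) powr p"
    using assms by (intro powr_mono2) auto
  also have "\<dots> = 2 powr p * (max (norm a) (norm b)) powr p"
    by (simp add: powr_mult)
  also have "\<dots> \<le> 2 powr p * (norm a powr p + norm b powr p)"
    by (intro mult_left_mono) (auto simp: max_def)
  finally show ?thesis .
qed

text \<open>The consequences of the weight condition on the bounded set itself.
  \<open>w_dual\<close> makes functions of finite weighted energy integrable, so that the pairings
  with test functions in the definition of a weak gradient are meaningful.\<close>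

locale weighted_domain =
  fixes \<Omega> :: "'a::euclidean_space set" and p :: real and w :: "'a \<Rightarrow> real"
  assumes open_\<Omega>: "open \<Omega>" and bounded_\<Omega>: "bounded \<Omega>" and p: "1 < p"
    and w_integrable: "integrable (lebesgue_on \<Omega>) w"
    and w_pos: "AE x in lebesgue_on \<Omega>. 0 < w x"
    and w_dual: "integrable (lebesgue_on \<Omega>) (\<lambda>x. w x powr (- 1 / (p - 1)))"
begin

abbreviation M :: "'a measure" where "M \<equiv> lebesgue_on \<Omega>"

lemma sets_\<Omega> [simp]: "\<Omega> \<in> sets lebesgue"
  using open_\<Omega> by auto

lemma measurable_w [measurable]: "w \<in> borel_measurable M"
  using w_integrable by auto

lemma finite_measure_M: "finite_measure M"
  using bounded_\<Omega> by (intro finite_measure_lebesgue_on bounded_set_imp_lmeasurable) auto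

lemma Cc1_measurable:
  assumes "\<phi> \<in> Cc1 \<Omega>"
  shows "\<phi> \<in> borel_measurable M" "grad \<phi> \<in> borel_measurable M"
  using Cc1_facts(3,4)[OF assms]
  by (intro measurable_restrict_space1 measurable_completion; simp)+

text \<open>Taken in \<open>ennreal\<close>, so that an infinite value is not confused with the
  default value 0 of a Bochner integral. It is the p-th power of a norm, hence subadditive only up
  to the factor 2^p.\<close>

definition energy :: "('a \<Rightarrow> 'b::real_normed_vector) \<Rightarrow> ennreal" where
  "energy u = (\<integral>\<^sup>+x. ennreal (norm (u x) powr p * w x) \<partial>M)"

lemma energy_mono:
  assumes "AE x in M. norm (u x) \<le> norm (v x)"
  shows "energy u \<le> energy v"
  unfolding energy_def
proof (rule nn_integral_mono_AE)
  show "AE x in M. ennreal (norm (u x) powr p * w x) \<le> ennreal (norm (v x) powr p * w x)"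
    using assms w_pos by eventually_elim (use p in \<open>auto intro!: ennreal_leI mult_right_mono powr_mono2\<close>)
qed

lemma energy_cong: "AE x in M. norm (u x) = norm (v x) \<Longrightarrow> energy u = energy v"
  by (intro antisym energy_mono) (auto elim: eventually_mono)

lemma energy_add:
  fixes u v :: "'a \<Rightarrow> 'b::euclidean_space"
  assumes [measurable]: "u \<in> borel_measurable M" "v \<in> borel_measurable M"
  shows "energy (\<lambda>x. u x + v x) \<le> ennreal (2 powr p) * (energy u + energy v)"
proof -
  have "energy (\<lambda>x. u x + v x) \<le> (\<integral>\<^sup>+x. ennreal (2 powr p) *
      (ennreal (norm (u x) powr p * w x) + ennreal (norm (v x) powr p * w x)) \<partial>M)"
    unfolding energy_def
  proof (rule nn_integral_mono_AE)
    show "AE x in M. ennreal (norm (u x + v x) powr p * w x) \<le> ennreal (2 powr p) *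
      (ennreal (norm (u x) powr p * w x) + ennreal (norm (v x) powr p * w x))"
      using w_pos
    proof eventually_elim
      case (elim x)
      have "norm (u x + v x) powr p * w x \<le> (2 powr p * (norm (u x) powr p + norm (v x) powr p)) * w x"
        using elim p by (intro mult_right_mono norm_add_powr_le) auto
      then show ?case
        using elim by (simp add: ennreal_mult[symmetric] ennreal_plus[symmetric] algebra_simps del: ennreal_plus)
    qed
  qed
  also have "\<dots> = ennreal (2 powr p) * (energy u + energy v)"
    unfolding energy_def by (subst nn_integral_cmult) (auto simp: nn_integral_add)
  finally show ?thesis .
qed

lemma energy_scale_le:
  fixes u :: "'a \<Rightarrow> 'b::euclidean_space" and v :: "'a \<Rightarrow> 'c::euclidean_space"
  assumes [measurable]: "v \<in> borel_measurable M" and L: "0 \<le> L"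
    and le: "AE x in M. norm (u x) \<le> L * norm (v x)"
  shows "energy u \<le> ennreal (L powr p) * energy v"
proof -
  have "energy u \<le> (\<integral>\<^sup>+x. ennreal (L powr p) * ennreal (norm (v x) powr p * w x) \<partial>M)"
    unfolding energy_def
  proof (rule nn_integral_mono_AE)
    show "AE x in M. ennreal (norm (u x) powr p * w x) \<le> ennreal (L powr p) * ennreal (norm (v x) powr p * w x)"
      using le w_pos
    proof eventually_elim
      case (elim x)
      have "norm (u x) powr p * w x \<le> (L * norm (v x)) powr p * w x"
        using elim p by (intro mult_right_mono powr_mono2) auto
      then show ?case
        using elim L by (simp add: ennreal_mult[symmetric] powr_mult mult.assoc)
    qed
  qed
  also have "\<dots> = ennreal (L powr p) * energy v"
    unfolding energy_def by (rule nn_integral_cmult) measurable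
  finally show ?thesis .
qed

lemma energy_finite_iff:
  fixes u :: "'a \<Rightarrow> 'b::euclidean_space"
  assumes [measurable]: "u \<in> borel_measurable M"
  shows "energy u < top \<longleftrightarrow> integrable M (\<lambda>x. norm (u x) powr p * w x)"
proof -
  have "(\<integral>\<^sup>+x. ennreal (norm (norm (u x) powr p * w x)) \<partial>M) = energy u"
    unfolding energy_def
    by (rule nn_integral_cong_AE) (use w_pos in eventually_elim, simp add: abs_mult)
  then show ?thesis by (simp add: integrable_iff_bounded)
qed

lemma energy_eq_integral:
  fixes u :: "'a \<Rightarrow> 'b::euclidean_space"
  assumes "integrable M (\<lambda>x. norm (u x) powr p * w x)"
  shows "energy u = ennreal (\<integral>x. norm (u x) powr p * w x \<partial>M)"
  unfolding energy_def using assms w_pos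
  by (intro nn_integral_eq_integral) (auto elim!: eventually_mono)

lemma weighted_integral_nonneg: "0 \<le> (\<integral>x. norm (u x) powr p * w x \<partial>M)"
  using w_pos by (intro integral_nonneg_AE) (auto elim!: eventually_mono)

lemma energy_bounded_finite:
  assumes [measurable]: "u \<in> borel_measurable M" and "AE x in M. norm (u x) \<le> B"
  shows "energy (u :: 'a \<Rightarrow> 'b::euclidean_space) < top"
proof -
  have "integrable M (\<lambda>x. norm (u x) powr p * w x)"
  proof (rule Bochner_Integration.integrable_bound)
    show "integrable M (\<lambda>x. B powr p * w x)" using w_integrable by auto
    show "AE x in M. norm (norm (u x) powr p * w x) \<le> norm (B powr p * w x)"
      using assms(2) w_pos by eventually_elim (use p in \<open>auto simp: abs_mult intro!: mult_right_mono powr_mono2\<close>)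
  qed measurable
  then show ?thesis by (simp add: energy_finite_iff)
qed

lemma energy_Cc1_finite:
  assumes \<phi>: "\<phi> \<in> Cc1 \<Omega>"
  shows "energy \<phi> < top" "energy (grad \<phi>) < top"
proof -
  obtain B R where B: "0 < B" "0 < R" "\<And>x. \<bar>\<phi> x\<bar> \<le> B" "\<And>x. norm (grad \<phi> x) \<le> B"
    "\<And>x. R \<le> norm x \<Longrightarrow> \<phi> x = 0" "\<And>x. R \<le> norm x \<Longrightarrow> grad \<phi> x = 0"
    using Cc1_bounds[OF \<phi>] by blast
  then show "energy \<phi> < top" "energy (grad \<phi>) < top"
    using Cc1_measurable[OF \<phi>] by (auto intro!: energy_bounded_finite[where B = B])
qed

text \<open>Hoelder with weight 1/p for the factorisation of |u| into (|u|^p w)^(1/p) and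
  (w^(-1/(p-1)))^(1 - 1/p), in which the powers of \<open>w\<close> cancel.\<close>

lemma energy_finite_imp_integrable:
  fixes u :: "'a \<Rightarrow> 'b::euclidean_space"
  assumes [measurable]: "u \<in> borel_measurable M" and fin: "energy u < top"
  shows "integrable M u"
    "(\<integral>x. norm (u x) \<partial>M) \<le> (\<integral>x. norm (u x) powr p * w x \<partial>M) powr (1 / p)
       * (\<integral>x. w x powr (- 1 / (p - 1)) \<partial>M) powr (1 - 1 / p)"
proof -
  have int: "integrable M (\<lambda>x. norm (u x) powr p * w x)" using fin by (simp add: energy_finite_iff)
  have a: "0 < 1 / p" "1 / p < 1" using p by auto
  have eq: "AE x in M. (norm (u x) powr p * w x) powr (1 / p) * (w x powr (- 1 / (p - 1))) powr (1 - 1 / p) = norm (u x)"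
    using w_pos
  proof eventually_elim
    case (elim x)
    have "- 1 / (p - 1) * (1 - 1 / p) = - 1 / p" using p by (simp add: field_simps)
    then have "(w x powr (- 1 / (p - 1))) powr (1 - 1 / p) = w x powr (- 1 / p)"
      by (simp only: powr_powr)
    moreover have "w x powr (1 / p) * w x powr (- 1 / p) = 1"
      using elim by (simp flip: powr_add)
    ultimately show ?case using p by (simp add: powr_mult powr_powr mult.assoc)
  qed
  note H = Hoelder_powr[OF int _ w_dual _ a]
  have nn: "AE x in M. 0 \<le> norm (u x) powr p * w x" "AE x in M. 0 \<le> w x powr (- 1 / (p - 1))"
    using w_pos by (auto elim!: eventually_mono)
  have "integrable M (\<lambda>x. norm (u x))"
    using H(1)[OF nn] integrable_cong_AE[OF _ _ eq] by simp
  then show "integrable M u" by (simp add: integrable_norm_iff)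
  have "(\<integral>x. norm (u x) \<partial>M) = (\<integral>x. (norm (u x) powr p * w x) powr (1 / p) * (w x powr (- 1 / (p - 1))) powr (1 - 1 / p) \<partial>M)"
    using eq by (intro integral_cong_AE) (auto elim!: eventually_mono)
  also have "\<dots> \<le> (\<integral>x. norm (u x) powr p * w x \<partial>M) powr (1 / p)
       * (\<integral>x. w x powr (- 1 / (p - 1)) \<partial>M) powr (1 - 1 / p)"
    by (rule H(2)[OF nn])
  finally show "(\<integral>x. norm (u x) \<partial>M) \<le> (\<integral>x. norm (u x) powr p * w x \<partial>M) powr (1 / p)
       * (\<integral>x. w x powr (- 1 / (p - 1)) \<partial>M) powr (1 - 1 / p)" .
qed

lemma energy_tendsto_0_imp_L1:
  fixes u :: "nat \<Rightarrow> 'a \<Rightarrow> 'b::euclidean_space"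
  assumes m[measurable]: "\<And>j. u j \<in> borel_measurable M" and fin: "\<And>j. energy (u j) < top"
    and lim: "(\<lambda>j. energy (u j)) \<longlonglongrightarrow> 0"
  shows "(\<lambda>j. \<integral>x. norm (u j x) \<partial>M) \<longlonglongrightarrow> 0"
proof (rule Lim_null_comparison)
  have "(\<lambda>j. enn2real (energy (u j))) \<longlonglongrightarrow> 0"
    using lim by (intro tendsto_enn2real) simp_all
  moreover have "enn2real (energy (u j)) = (\<integral>x. norm (u j x) powr p * w x \<partial>M)" for j
    using fin[of j] energy_eq_integral[of "u j"] weighted_integral_nonneg[of "u j"] by (simp add: energy_finite_iff)
  ultimately have "(\<lambda>j. \<integral>x. norm (u j x) powr p * w x \<partial>M) \<longlonglongrightarrow> 0" by simp
  then have "(\<lambda>j. (\<integral>x. norm (u j x) powr p * w x \<partial>M) powr (1 / p)) \<longlonglongrightarrow> 0 powr (1 / p)"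
    using p weighted_integral_nonneg by (intro tendsto_powr' tendsto_const) (auto intro!: always_eventually)
  then have "(\<lambda>j. (\<integral>x. norm (u j x) powr p * w x \<partial>M) powr (1 / p)
       * (\<integral>x. w x powr (- 1 / (p - 1)) \<partial>M) powr (1 - 1 / p)) \<longlonglongrightarrow> 0 * (\<integral>x. w x powr (- 1 / (p - 1)) \<partial>M) powr (1 - 1 / p)"
    using p by (intro tendsto_mult tendsto_const) auto
  then show "(\<lambda>j. (\<integral>x. norm (u j x) powr p * w x \<partial>M) powr (1 / p)
       * (\<integral>x. w x powr (- 1 / (p - 1)) \<partial>M) powr (1 - 1 / p)) \<longlonglongrightarrow> 0" by simp
qed (use energy_finite_imp_integrable(2)[OF m fin] in auto)

text \<open>Membership of \<open>u\<close> in \<open>W1p_0\<close> with weak gradient \<open>g\<close>, without the choice operator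
  hidden in \<open>wgrad\<close>.\<close>

definition X0 :: "('a \<Rightarrow> real) \<Rightarrow> ('a \<Rightarrow> 'a) \<Rightarrow> bool" where
  "X0 u g \<longleftrightarrow> u \<in> borel_measurable M \<and> g \<in> borel_measurable M \<and>
     (\<forall>e>0. \<exists>\<phi>\<in>Cc_infty \<Omega>. energy (\<lambda>x. u x - \<phi> x) < ennreal e \<and> energy (\<lambda>x. g x - grad \<phi> x) < ennreal e)"

lemma X0_measurable: "X0 u g \<Longrightarrow> u \<in> borel_measurable M" "X0 u g \<Longrightarrow> g \<in> borel_measurable M"
  by (auto simp: X0_def)

lemma energy_diff_finite:
  fixes u v :: "'a \<Rightarrow> 'b::euclidean_space"
  assumes "u \<in> borel_measurable M" "v \<in> borel_measurable M" "energy u < top" "energy v < top"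
  shows "energy (\<lambda>x. u x - v x) < top"
proof -
  have "energy (\<lambda>x. u x + - v x) \<le> ennreal (2 powr p) * (energy u + energy (\<lambda>x. - v x))"
    using assms by (intro energy_add) auto
  also have "energy (\<lambda>x. - v x) = energy v" by (intro energy_cong) auto
  also have "ennreal (2 powr p) * (energy u + energy v) < top"
    using assms by (simp add: ennreal_mult_less_top)
  finally show ?thesis by simp
qed

lemma energy_triangle:
  fixes u v z :: "'a \<Rightarrow> 'b::euclidean_space"
  assumes "u \<in> borel_measurable M" "v \<in> borel_measurable M" "z \<in> borel_measurable M"
  shows "energy (\<lambda>x. u x - z x) \<le> ennreal (2 powr p) * (energy (\<lambda>x. u x - v x) + energy (\<lambda>x. v x - z x))"
  using energy_add[of "\<lambda>x. u x - v x" "\<lambda>x. v x - z x"] assms by simp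

lemma X0_energy_finite:
  assumes X: "X0 u g"
  shows "energy u < top" "energy g < top"
proof -
  note [measurable] = X0_measurable[OF X]
  obtain \<phi> where \<phi>: "\<phi> \<in> Cc_infty \<Omega>" "energy (\<lambda>x. u x - \<phi> x) < ennreal 1" "energy (\<lambda>x. g x - grad \<phi> x) < ennreal 1"
    using X by (auto simp: X0_def dest!: spec[of _ 1])
  then have \<phi>1: "\<phi> \<in> Cc1 \<Omega>" using Cc_infty_subset_Cc1 by auto
  note [measurable] = Cc1_measurable[OF \<phi>1]
  have "energy (\<lambda>x. (u x - \<phi> x) + \<phi> x) \<le> ennreal (2 powr p) * (energy (\<lambda>x. u x - \<phi> x) + energy \<phi>)"
    by (rule energy_add) measurable
  also have "\<dots> < top"
    using \<phi>(2) energy_Cc1_finite[OF \<phi>1] by (auto simp: ennreal_mult_less_top intro: less_trans)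
  finally show "energy u < top" by simp
  have "energy (\<lambda>x. (g x - grad \<phi> x) + grad \<phi> x) \<le> ennreal (2 powr p) * (energy (\<lambda>x. g x - grad \<phi> x) + energy (grad \<phi>))"
    by (rule energy_add) measurable
  also have "\<dots> < top"
    using \<phi>(3) energy_Cc1_finite[OF \<phi>1] by (auto simp: ennreal_mult_less_top intro: less_trans)
  finally show "energy g < top" by simp
qed

lemma X0_sequence:
  assumes X: "X0 u g"
  obtains \<phi> where "\<And>j::nat. \<phi> j \<in> Cc_infty \<Omega>"
    "(\<lambda>j. energy (\<lambda>x. u x - \<phi> j x)) \<longlonglongrightarrow> 0" "(\<lambda>j. energy (\<lambda>x. g x - grad (\<phi> j) x)) \<longlonglongrightarrow> 0"
    "AE x in M. (\<lambda>j. \<phi> j x) \<longlonglongrightarrow> u x"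
proof -
  note [measurable] = X0_measurable[OF X]
  have "\<exists>\<phi>\<in>Cc_infty \<Omega>. energy (\<lambda>x. u x - \<phi> x) < ennreal (1 / real (Suc j)) \<and> energy (\<lambda>x. g x - grad \<phi> x) < ennreal (1 / real (Suc j))" for j
    using X by (auto simp: X0_def)
  then obtain \<phi> where \<phi>: "\<And>j. \<phi> j \<in> Cc_infty \<Omega>" "\<And>j. energy (\<lambda>x. u x - \<phi> j x) < ennreal (1 / real (Suc j))"
    "\<And>j. energy (\<lambda>x. g x - grad (\<phi> j) x) < ennreal (1 / real (Suc j))"
    by metis
  have \<phi>1: "\<phi> j \<in> Cc1 \<Omega>" for j using \<phi>(1) Cc_infty_subset_Cc1 by auto
  note [measurable] = Cc1_measurable[OF \<phi>1]
  have lim0: "(\<lambda>j. ennreal (1 / real (Suc j))) \<longlonglongrightarrow> 0"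
    using tendsto_ennrealI[OF LIMSEQ_inverse_real_of_nat] by (simp add: inverse_eq_divide)
  have lim: "(\<lambda>j. energy (\<lambda>x. u x - \<phi> j x)) \<longlonglongrightarrow> 0" "(\<lambda>j. energy (\<lambda>x. g x - grad (\<phi> j) x)) \<longlonglongrightarrow> 0"
    by (rule tendsto_sandwich[OF _ _ tendsto_const lim0]; use \<phi>(2,3) in \<open>auto intro!: always_eventually less_imp_le simp del: of_nat_Suc\<close>)+
  have fin: "energy (\<lambda>x. u x - \<phi> j x) < top" for j
    using \<phi>(2)[of j] by (auto intro: less_trans)
  have "(\<lambda>j. \<integral>x. norm (u x - \<phi> j x) \<partial>M) \<longlonglongrightarrow> 0"
    by (rule energy_tendsto_0_imp_L1[OF _ fin lim(1)]) measurable
  moreover have "integrable M (\<lambda>x. u x - \<phi> j x)" for j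
    by (rule energy_finite_imp_integrable(1)[OF _ fin]) measurable
  \<comment> \<open>Convergence in the mean gives almost-everywhere convergence only along a
    subsequence, to which everything is then restricted.\<close>
  ultimately obtain r where r: "strict_mono (r::nat\<Rightarrow>nat)" "AE x in M. (\<lambda>j. u x - \<phi> (r j) x) \<longlonglongrightarrow> 0"
    using tendsto_L1_AE_subseq[of M "\<lambda>j x. u x - \<phi> j x"] by auto
  show ?thesis
  proof (rule that[of "\<lambda>j. \<phi> (r j)"])
    show "AE x in M. (\<lambda>j. \<phi> (r j) x) \<longlonglongrightarrow> u x"
      using r(2)
    proof eventually_elim
      case (elim x)
      from tendsto_diff[OF tendsto_const[of "u x"] elim] show ?case by simp
    qed
  qed (use \<phi>(1) LIMSEQ_subseq_LIMSEQ[OF lim(1) r(1)] LIMSEQ_subseq_LIMSEQ[OF lim(2) r(1)] in \<open>auto simp: comp_def\<close>)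
qed

end

text \<open>Convergence in the mean survives multiplication by a bounded function. Stated for
  bilinear maps because the bounded factor is the vector in one term of the integration by parts and
  the scalar in the other.\<close>

lemma integral_bounded_bilinear_tendsto:
  fixes B :: "'b::{banach,second_countable_topology} \<Rightarrow> 'c::{banach,second_countable_topology} \<Rightarrow> 'd::{banach,second_countable_topology}"
  assumes B: "bounded_bilinear B"
    and f: "integrable M f" and a: "\<And>j::nat. integrable M (a j)"
    and lim: "(\<lambda>j. \<integral>x. norm (f x - a j x) \<partial>M) \<longlonglongrightarrow> 0"
    and h[measurable]: "h \<in> borel_measurable M" and K: "\<And>x. norm (h x) \<le> K"
  shows "(\<lambda>j. \<integral>x. B (a j x) (h x) \<partial>M) \<longlonglongrightarrow> (\<integral>x. B (f x) (h x) \<partial>M)"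
proof -
  interpret bounded_bilinear B by fact
  obtain C where C: "0 < C" "\<And>x y. norm (B x y) \<le> norm x * norm y * C"
    using pos_bounded by blast
  have int: "integrable M (\<lambda>x. B (u x) (h x))" and le: "norm (\<integral>x. B (u x) (h x) \<partial>M) \<le> K * C * (\<integral>x. norm (u x) \<partial>M)"
    if u: "integrable M u" for u
  proof -
    note [measurable] = borel_measurable_integrable[OF u]
    have bd: "norm (B (u x) (h x)) \<le> norm (u x) * (K * C)" for x
    proof -
      have "norm (B (u x) (h x)) \<le> norm (u x) * norm (h x) * C" by (rule C(2))
      also have "\<dots> \<le> norm (u x) * K * C"
        using K[of x] C(1) by (intro mult_right_mono mult_left_mono) auto
      finally show ?thesis by (simp add: mult.assoc)
    qed
    have KC: "0 \<le> K * C" using K[of undefined] C(1) norm_ge_zero[of "h undefined"] by (intro mult_nonneg_nonneg) linarith+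
    have m: "(\<lambda>x. B (u x) (h x)) \<in> borel_measurable M"
      by (rule borel_measurable_continuous_Pair[OF borel_measurable_integrable[OF u] h])
         (intro continuous_on continuous_on_fst continuous_on_snd continuous_on_id)
    show 1: "integrable M (\<lambda>x. B (u x) (h x))"
      by (rule Bochner_Integration.integrable_bound[of M "\<lambda>x. norm (u x) * (K * C)"])
         (use u bd m KC in \<open>auto intro!: AE_I2 order_trans[OF bd]\<close>)
    have "norm (\<integral>x. B (u x) (h x) \<partial>M) \<le> (\<integral>x. norm (B (u x) (h x)) \<partial>M)"
      by (rule integral_norm_bound)
    also have "\<dots> \<le> (\<integral>x. norm (u x) * (K * C) \<partial>M)"
      using 1 u bd by (intro integral_mono) auto
    finally show "norm (\<integral>x. B (u x) (h x) \<partial>M) \<le> K * C * (\<integral>x. norm (u x) \<partial>M)"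
      by (simp add: mult.commute)
  qed
  show ?thesis
  proof (rule Lim_transform[OF tendsto_const], rule Lim_null_comparison)
    have "(\<lambda>j. K * C * (\<integral>x. norm (f x - a j x) \<partial>M)) \<longlonglongrightarrow> K * C * 0"
      by (intro tendsto_intros lim)
    then show "(\<lambda>j. K * C * (\<integral>x. norm (f x - a j x) \<partial>M)) \<longlonglongrightarrow> 0" by simp
    have "norm ((\<integral>x. B (a j x) (h x) \<partial>M) - (\<integral>x. B (f x) (h x) \<partial>M))
      \<le> K * C * (\<integral>x. norm (f x - a j x) \<partial>M)" for j
    proof -
      have "(\<integral>x. B (f x) (h x) \<partial>M) - (\<integral>x. B (a j x) (h x) \<partial>M) = (\<integral>x. B (f x - a j x) (h x) \<partial>M)"
        using int[OF f] int[OF a[of j]] by (simp add: diff_left)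
      then show ?thesis using le[of "\<lambda>x. f x - a j x"] f a by (simp add: norm_minus_commute)
    qed
    then show "\<forall>\<^sub>F j in sequentially. norm ((\<integral>x. B (a j x) (h x) \<partial>M) - (\<integral>x. B (f x) (h x) \<partial>M))
      \<le> K * C * (\<integral>x. norm (f x - a j x) \<partial>M)" by simp
  qed
qed

context weighted_domain
begin

text \<open>Integration by parts holds for the approximating test functions, and both of its sides
  pass to the limit, since energy convergence implies convergence in the mean.\<close>

lemma X0_is_weak_grad:
  assumes X: "X0 u g"
  shows "is_weak_grad \<Omega> u g"
proof -
  note [measurable] = X0_measurable[OF X]
  have int: "integrable M u" "integrable M g"
    using X0_energy_finite[OF X] by (auto intro: energy_finite_imp_integrable(1))
  obtain \<phi> where \<phi>: "\<And>j::nat. \<phi> j \<in> Cc_infty \<Omega>"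
    "(\<lambda>j. energy (\<lambda>x. u x - \<phi> j x)) \<longlonglongrightarrow> 0" "(\<lambda>j. energy (\<lambda>x. g x - grad (\<phi> j) x)) \<longlonglongrightarrow> 0"
    by (rule X0_sequence[OF X]) (rule that; assumption)
  have \<phi>1: "\<phi> j \<in> Cc1 \<Omega>" for j using \<phi>(1) Cc_infty_subset_Cc1 by auto
  note [measurable] = Cc1_measurable[OF \<phi>1]
  have intj: "integrable M (\<phi> j)" "integrable M (grad (\<phi> j))" for j
    using energy_Cc1_finite[OF \<phi>1] by (auto intro: energy_finite_imp_integrable(1))
  have L1: "(\<lambda>j. \<integral>x. norm (u x - \<phi> j x) \<partial>M) \<longlonglongrightarrow> 0" "(\<lambda>j. \<integral>x. norm (g x - grad (\<phi> j) x) \<partial>M) \<longlonglongrightarrow> 0"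
    by (rule energy_tendsto_0_imp_L1[OF _ _ \<phi>(2)] energy_tendsto_0_imp_L1[OF _ _ \<phi>(3)];
        use X0_energy_finite[OF X] energy_Cc1_finite[OF \<phi>1] in \<open>auto intro!: energy_diff_finite\<close>)+
  have loc: "locally_integrable_on f \<Omega>" if "integrable M f" for f :: "'a \<Rightarrow> 'c::euclidean_space"
    using that by (auto simp: locally_integrable_on_def lmeasurable_compact fmeasurableD
      intro: integrable_lebesgue_on_subset)
  show ?thesis
    unfolding is_weak_grad_def
  proof (intro conjI ballI loc int)
    fix \<psi> assume "\<psi> \<in> Cc_infty \<Omega>"
    then have \<psi>: "\<psi> \<in> Cc1 \<Omega>" and \<psi>': "\<psi> \<in> Cc_infty \<Omega>" using Cc_infty_subset_Cc1 by auto
    note [measurable] = Cc1_measurable[OF \<psi>]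
    obtain B R where B: "0 < B" "0 < R" "\<And>x. \<bar>\<psi> x\<bar> \<le> B" "\<And>x. norm (grad \<psi> x) \<le> B"
      "\<And>x. R \<le> norm x \<Longrightarrow> \<psi> x = 0" "\<And>x. R \<le> norm x \<Longrightarrow> grad \<psi> x = 0"
      using Cc1_bounds[OF \<psi>] by blast
    have 1: "(\<lambda>j. \<integral>x. \<phi> j x *\<^sub>R grad \<psi> x \<partial>M) \<longlonglongrightarrow> (\<integral>x. u x *\<^sub>R grad \<psi> x \<partial>M)"
      by (rule integral_bounded_bilinear_tendsto[OF bounded_bilinear_scaleR int(1) intj(1) L1(1) _ B(4)]) measurable
    have 2: "(\<lambda>j. \<integral>x. \<psi> x *\<^sub>R grad (\<phi> j) x \<partial>M) \<longlonglongrightarrow> (\<integral>x. \<psi> x *\<^sub>R g x \<partial>M)"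
      by (rule integral_bounded_bilinear_tendsto[OF bounded_bilinear.flip[OF bounded_bilinear_scaleR] int(2) intj(2) L1(2), where K = B])
         (use B(3) in auto)
    have "(\<integral>x. \<phi> j x *\<^sub>R grad \<psi> x \<partial>M) = - (\<integral>x. \<psi> x *\<^sub>R grad (\<phi> j) x \<partial>M)" for j
      using is_weak_grad_Cc1[OF \<phi>1 open_\<Omega>, of j] \<psi>' by (simp add: is_weak_grad_def)
    then show "(\<integral>x. u x *\<^sub>R grad \<psi> x \<partial>M) = - (\<integral>x. \<psi> x *\<^sub>R g x \<partial>M)"
      using LIMSEQ_unique[OF 1] tendsto_minus[OF 2] by simp
  qed
qed

lemma X0_cong_AE:
  assumes X: "X0 u g" and eq: "AE x in M. g x = h x"
  shows "X0 u h"
proof -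
  have "energy (\<lambda>x. h x - grad \<phi> x) = energy (\<lambda>x. g x - grad \<phi> x)" for \<phi>
    by (rule energy_cong) (use eq in eventually_elim, simp)
  moreover have "h \<in> borel_measurable M"
    by (rule measurable_lebesgue_on_cong_AE[OF sets_\<Omega> _ eq]) (rule X0_measurable[OF X])
  ultimately show ?thesis using X by (simp add: X0_def)
qed

lemma X0_wgrad_eq:
  assumes X: "X0 u g"
  shows "AE x in M. wgrad \<Omega> u x = g x"
  by (rule wgrad_AE_eq[OF open_\<Omega> X0_is_weak_grad[OF X]])

lemma X0_wgrad: "X0 u g \<Longrightarrow> X0 u (wgrad \<Omega> u)"
  using X0_wgrad_eq[of u g] by (rule_tac X0_cong_AE) (auto elim: eventually_mono)

section \<open>Agreement of \<open>X0\<close> with the closure \<open>W1p_0\<close>\<close>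

lemma energy_less_imp_powr_less:
  fixes u :: "'a \<Rightarrow> 'b::euclidean_space"
  assumes [measurable]: "u \<in> borel_measurable M" and le: "energy u < ennreal (e powr p)" and e: "0 < e"
  shows "(\<integral>x. norm (u x) powr p * w x \<partial>M) powr (1 / p) < e"
proof -
  have "integrable M (\<lambda>x. norm (u x) powr p * w x)"
    using le energy_finite_iff[of u] by (auto intro: less_trans)
  then have "(\<integral>x. norm (u x) powr p * w x \<partial>M) < e powr p"
    using le e by (simp add: energy_eq_integral ennreal_less_iff weighted_integral_nonneg)
  then have "(\<integral>x. norm (u x) powr p * w x \<partial>M) powr (1 / p) < (e powr p) powr (1 / p)"
    using p weighted_integral_nonneg by (intro powr_less_mono2) auto
  then show ?thesis using p e by (simp add: powr_powr)
qed

lemma powr_less_imp_energy_less: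
  fixes u :: "'a \<Rightarrow> 'b::euclidean_space"
  assumes int: "integrable M (\<lambda>x. norm (u x) powr p * w x)"
    and le: "(\<integral>x. norm (u x) powr p * w x \<partial>M) powr (1 / p) < e powr (1 / p)" and e: "0 < e"
  shows "energy u < ennreal e"
proof -
  have "(\<integral>x. norm (u x) powr p * w x \<partial>M) < e"
  proof (rule ccontr)
    assume "\<not> ?thesis"
    then have "e powr (1 / p) \<le> (\<integral>x. norm (u x) powr p * w x \<partial>M) powr (1 / p)"
      using p e by (intro powr_mono2) auto
    with le show False by simp
  qed
  then show ?thesis using int e by (simp add: energy_eq_integral ennreal_less_iff weighted_integral_nonneg)
qed

text \<open>The norm involves the chosen gradient of \<open>u - \<phi>\<close>; by uniqueness of
  weak gradients it coincides almost everywhere with \<open>g - grad \<phi>\<close>, so its energy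
  is the one controlled by \<open>X0\<close>.\<close>

lemma X0_imp_W1p_0:
  assumes X: "X0 u g"
  shows "u \<in> W1p_0 p \<Omega> w"
proof -
  note [measurable] = X0_measurable[OF X]
  note X' = X0_wgrad[OF X]
  have wg: "is_weak_grad \<Omega> u (wgrad \<Omega> u)" by (rule X0_is_weak_grad[OF X'])
  have "u \<in> W1p p \<Omega> w"
    unfolding W1p_def
    using wg energy_finite_iff[of u] energy_finite_iff[of "wgrad \<Omega> u"] X0_energy_finite[OF X'] X0_measurable[OF X']
    by auto
  moreover have "\<exists>\<phi>\<in>Cc_infty \<Omega>. W1p_norm p \<Omega> w (\<lambda>x. u x - \<phi> x) < e" if e: "0 < e" for e
  proof -
    obtain \<phi> where \<phi>: "\<phi> \<in> Cc_infty \<Omega>" "energy (\<lambda>x. u x - \<phi> x) < ennreal ((e / 2) powr p)"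
      "energy (\<lambda>x. g x - grad \<phi> x) < ennreal ((e / 2) powr p)"
      using X e by (auto simp: X0_def dest!: spec[of _ "(e / 2) powr p"])
    then have \<phi>1: "\<phi> \<in> Cc1 \<Omega>" using Cc_infty_subset_Cc1 by auto
    note [measurable] = Cc1_measurable[OF \<phi>1]
    have eq: "AE x in M. wgrad \<Omega> (\<lambda>x. u x - \<phi> x) x = g x - grad \<phi> x"
      by (rule wgrad_AE_eq[OF open_\<Omega> is_weak_grad_diff[OF open_\<Omega> X0_is_weak_grad[OF X] is_weak_grad_Cc1[OF \<phi>1 open_\<Omega>]]])
    have m: "wgrad \<Omega> (\<lambda>x. u x - \<phi> x) \<in> borel_measurable M"
      by (rule measurable_lebesgue_on_cong_AE[where f = "\<lambda>x. g x - grad \<phi> x"]) (use eq in \<open>auto elim: eventually_mono\<close>)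
    have "energy (wgrad \<Omega> (\<lambda>x. u x - \<phi> x)) = energy (\<lambda>x. g x - grad \<phi> x)"
      by (rule energy_cong) (use eq in eventually_elim, simp)
    then have "(\<integral>x. norm (wgrad \<Omega> (\<lambda>x. u x - \<phi> x) x) powr p * w x \<partial>M) powr (1 / p) < e / 2"
      using \<phi>(3) e m by (intro energy_less_imp_powr_less) auto
    moreover have "(\<integral>x. norm (u x - \<phi> x) powr p * w x \<partial>M) powr (1 / p) < e / 2"
      using \<phi>(2) e by (intro energy_less_imp_powr_less) auto
    ultimately have "W1p_norm p \<Omega> w (\<lambda>x. u x - \<phi> x) < e"
      by (simp add: W1p_norm_def)
    then show ?thesis using \<phi>(1) by blast
  qed
  ultimately show ?thesis by (auto simp: W1p_0_def)
qed

lemma W1p_0_imp_X0: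
  assumes u: "u \<in> W1p_0 p \<Omega> w"
  shows "X0 u (wgrad \<Omega> u)"
proof -
  define g where "g = wgrad \<Omega> u"
  have wg: "is_weak_grad \<Omega> u g"
    using u wgrad_is_weak_grad by (auto simp: W1p_0_def W1p_def g_def)
  have int: "integrable M (\<lambda>x. norm (u x) powr p * w x)" "integrable M (\<lambda>x. norm (g x) powr p * w x)"
    using u by (auto simp: W1p_0_def W1p_def g_def)
  have m[measurable]: "u \<in> borel_measurable M" "g \<in> borel_measurable M"
    using wg by (auto simp: is_weak_grad_def intro: locally_integrable_on_measurable[OF _ open_\<Omega>])
  have fin: "energy u < top" "energy g < top" using int m by (simp_all add: energy_finite_iff)
  show ?thesis
    unfolding X0_def g_def[symmetric]
  proof (intro conjI m allI impI)
    fix e :: real assume e: "0 < e"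
    obtain \<phi> where \<phi>: "\<phi> \<in> Cc_infty \<Omega>" "W1p_norm p \<Omega> w (\<lambda>x. u x - \<phi> x) < e powr (1 / p)"
      using u e by (auto simp: W1p_0_def dest!: spec[of _ "e powr (1 / p)"])
    then have \<phi>1: "\<phi> \<in> Cc1 \<Omega>" using Cc_infty_subset_Cc1 by auto
    note [measurable] = Cc1_measurable[OF \<phi>1]
    have eq: "AE x in M. wgrad \<Omega> (\<lambda>x. u x - \<phi> x) x = g x - grad \<phi> x"
      by (rule wgrad_AE_eq[OF open_\<Omega> is_weak_grad_diff[OF open_\<Omega> wg is_weak_grad_Cc1[OF \<phi>1 open_\<Omega>]]])
    have m2[measurable]: "wgrad \<Omega> (\<lambda>x. u x - \<phi> x) \<in> borel_measurable M"
      by (rule measurable_lebesgue_on_cong_AE[where f = "\<lambda>x. g x - grad \<phi> x"]) (use eq in \<open>auto elim: eventually_mono\<close>)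
    have "energy (\<lambda>x. u x - \<phi> x) < top" "energy (\<lambda>x. g x - grad \<phi> x) < top"
      using fin energy_Cc1_finite[OF \<phi>1] by (auto intro!: energy_diff_finite)
    moreover have E: "energy (wgrad \<Omega> (\<lambda>x. u x - \<phi> x)) = energy (\<lambda>x. g x - grad \<phi> x)"
      by (rule energy_cong) (use eq in eventually_elim, simp)
    ultimately have fin': "energy (\<lambda>x. u x - \<phi> x) < top" "energy (wgrad \<Omega> (\<lambda>x. u x - \<phi> x)) < top"
      by simp_all
    \<comment> \<open>A smallness statement about \<open>W1p_norm\<close> says something about the
      energies only if the integrals in it are not 0 by default, so integrability is established
      here.\<close>
    have i: "integrable M (\<lambda>x. norm (u x - \<phi> x) powr p * w x)"
      "integrable M (\<lambda>x. norm (wgrad \<Omega> (\<lambda>x. u x - \<phi> x) x) powr p * w x)"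
      by (rule energy_finite_iff[THEN iffD1, OF _ fin'(1)] energy_finite_iff[THEN iffD1, OF _ fin'(2)]; measurable)+
    have "(\<integral>x. norm (u x - \<phi> x) powr p * w x \<partial>M) powr (1 / p) < e powr (1 / p)"
      "(\<integral>x. norm (wgrad \<Omega> (\<lambda>x. u x - \<phi> x) x) powr p * w x \<partial>M) powr (1 / p) < e powr (1 / p)"
      using \<phi>(2) by (auto simp: W1p_norm_def intro: le_less_trans[rotated])
    then have "energy (\<lambda>x. u x - \<phi> x) < ennreal e" "energy (wgrad \<Omega> (\<lambda>x. u x - \<phi> x)) < ennreal e"
      by (auto intro!: powr_less_imp_energy_less i e)
    with \<phi>(1) E show "\<exists>\<phi>\<in>Cc_infty \<Omega>. energy (\<lambda>x. u x - \<phi> x) < ennreal e \<and> energy (\<lambda>x. g x - grad \<phi> x) < ennreal e"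
      by auto
  qed
qed

lemma X0_closed:
  assumes [measurable]: "u \<in> borel_measurable M" "g \<in> borel_measurable M"
    and X: "\<And>e::real. 0 < e \<Longrightarrow> \<exists>u' g'. X0 u' g' \<and> energy (\<lambda>x. u x - u' x) < ennreal e \<and> energy (\<lambda>x. g x - g' x) < ennreal e"
  shows "X0 u g"
  unfolding X0_def
proof (intro conjI assms allI impI)
  fix e :: real assume e: "0 < e"
  \<comment> \<open>Two errors below \<open>d\<close> add up to less than \<open>e\<close> after the
    factor 2^p of the quasi-triangle inequality.\<close>
  define d where "d = e / (2 powr p * 2)"
  have d: "0 < d" "2 powr p * (d + d) = e" using e by (auto simp: d_def)
  obtain u' g' where X': "X0 u' g'" and 1: "energy (\<lambda>x. u x - u' x) < ennreal d" "energy (\<lambda>x. g x - g' x) < ennreal d"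
    using X[OF d(1)] by blast
  note [measurable] = X0_measurable[OF X']
  obtain \<phi> where \<phi>: "\<phi> \<in> Cc_infty \<Omega>" "energy (\<lambda>x. u' x - \<phi> x) < ennreal d" "energy (\<lambda>x. g' x - grad \<phi> x) < ennreal d"
    using X' d(1) by (auto simp: X0_def)
  then have \<phi>1: "\<phi> \<in> Cc1 \<Omega>" using Cc_infty_subset_Cc1 by auto
  note [measurable] = Cc1_measurable[OF \<phi>1]
  have *: "ennreal (2 powr p) * (a + b) < ennreal e" if "a < ennreal d" "b < ennreal d" for a b
  proof -
    have "a + b < ennreal d + ennreal d" using that by (intro add_strict_mono)
    then have "ennreal (2 powr p) * (a + b) < ennreal (2 powr p) * (ennreal d + ennreal d)"
      by (intro ennreal_mult_strict_left_mono) auto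
    also have "\<dots> = ennreal e"
      using d by (simp add: ennreal_mult[symmetric] ennreal_plus[symmetric] del: ennreal_plus)
    finally show ?thesis .
  qed
  have "energy (\<lambda>x. u x - \<phi> x) < ennreal e"
    using energy_triangle[of u u' \<phi>] *[OF 1(1) \<phi>(2)] by (auto intro: le_less_trans)
  moreover have "energy (\<lambda>x. g x - grad \<phi> x) < ennreal e"
    using energy_triangle[of g g' "grad \<phi>"] *[OF 1(2) \<phi>(3)] by (auto intro: le_less_trans)
  ultimately show "\<exists>\<phi>\<in>Cc_infty \<Omega>. energy (\<lambda>x. u x - \<phi> x) < ennreal e \<and> energy (\<lambda>x. g x - grad \<phi> x) < ennreal e"
    using \<phi>(1) by blast
qed

text \<open>The functions D(\<phi>_j) are test functions again. The values are controlled by the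
  Lipschitz constant \<open>L\<close>. The error in the gradients is split as (D'(u) - D'(\<phi>_j))
  g + D'(\<phi>_j) (g - grad \<phi>_j): the former tends to 0 by dominated convergence, using
  \<phi>_j \<rightarrow> u almost everywhere and the majorant (2 L |g|)^p w, the latter by energy
  convergence.\<close>

lemma X0_compose_smooth:
  assumes X: "X0 u g" and D: "deriv_seq D" "D 0 0 = 0" and L: "\<And>t. \<bar>D 1 t\<bar> \<le> L"
  shows "X0 (\<lambda>x. D 0 (u x)) (\<lambda>x. D 1 (u x) *\<^sub>R g x)"
proof -
  note [measurable] = X0_measurable[OF X]
  have DD: "(D n has_real_derivative D (Suc n) t) (at t)" for n t using D(1) by (simp add: deriv_seq_def)
  have contD: "continuous_on UNIV (D n)" for n
    using DD by (auto intro!: continuous_at_imp_continuous_on DERIV_isCont)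
  have [measurable]: "D n \<in> borel_measurable borel" for n
    using contD by (rule borel_measurable_continuous_onI)
  have L0: "0 \<le> L" using L[of 0] by linarith
  have lip: "\<bar>D 0 s - D 0 t\<bar> \<le> L * \<bar>s - t\<bar>" for s t
    using field_differentiable_bound[of UNIV "D 0" "D 1" L s t] DD[of 0] L by (auto simp: has_field_derivative_at_within)
  obtain \<phi> where \<phi>: "\<And>j::nat. \<phi> j \<in> Cc_infty \<Omega>"
    "(\<lambda>j. energy (\<lambda>x. u x - \<phi> j x)) \<longlonglongrightarrow> 0" "(\<lambda>j. energy (\<lambda>x. g x - grad (\<phi> j) x)) \<longlonglongrightarrow> 0"
    "AE x in M. (\<lambda>j. \<phi> j x) \<longlonglongrightarrow> u x"
    by (rule X0_sequence[OF X]) (rule that; assumption)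
  have \<phi>1: "\<phi> j \<in> Cc1 \<Omega>" for j using \<phi>(1) Cc_infty_subset_Cc1 by auto
  note [measurable] = Cc1_measurable[OF \<phi>1]
  have gr: "grad (\<lambda>x. D 0 (\<phi> j x)) x = D 1 (\<phi> j x) *\<^sub>R grad (\<phi> j) x" for j x
    using Cc1_compose(2)[OF DD[of 0] contD[of "Suc 0"] D(2) \<phi>1] by simp
  have 1: "(\<lambda>j. energy (\<lambda>x. D 0 (u x) - D 0 (\<phi> j x))) \<longlonglongrightarrow> 0"
  proof (rule tendsto_sandwich[OF _ _ tendsto_const])
    have "(\<lambda>j. ennreal (L powr p) * energy (\<lambda>x. u x - \<phi> j x)) \<longlonglongrightarrow> ennreal (L powr p) * 0"
      by (intro ennreal_tendsto_cmult \<phi>(2)) simp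
    then show "(\<lambda>j. ennreal (L powr p) * energy (\<lambda>x. u x - \<phi> j x)) \<longlonglongrightarrow> 0" by simp
    show "\<forall>\<^sub>F j in sequentially. energy (\<lambda>x. D 0 (u x) - D 0 (\<phi> j x)) \<le> ennreal (L powr p) * energy (\<lambda>x. u x - \<phi> j x)"
      by (intro always_eventually allI energy_scale_le L0) (use lip in auto)
  qed simp
  have 2: "(\<lambda>j. energy (\<lambda>x. (D 1 (u x) - D 1 (\<phi> j x)) *\<^sub>R g x)) \<longlonglongrightarrow> 0"
  proof -
    have "(\<lambda>j. \<integral>\<^sup>+x. ennreal (norm ((D 1 (u x) - D 1 (\<phi> j x)) *\<^sub>R g x) powr p * w x) \<partial>M) \<longlonglongrightarrow> (\<integral>\<^sup>+x. 0 \<partial>M)"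
    proof (rule nn_integral_dominated_convergence)
      show "(\<lambda>x. ennreal ((2 * L) powr p) * ennreal (norm (g x) powr p * w x)) \<in> borel_measurable M" by measurable
      show "(\<integral>\<^sup>+x. ennreal ((2 * L) powr p) * ennreal (norm (g x) powr p * w x) \<partial>M) < \<infinity>"
        using X0_energy_finite(2)[OF X]
        by (subst nn_integral_cmult) (auto simp: energy_def ennreal_mult_less_top)
      show "AE x in M. ennreal (norm ((D 1 (u x) - D 1 (\<phi> j x)) *\<^sub>R g x) powr p * w x)
          \<le> ennreal ((2 * L) powr p) * ennreal (norm (g x) powr p * w x)" for j
        using w_pos
      proof eventually_elim
        case (elim x)
        have "\<bar>D 1 (u x) - D 1 (\<phi> j x)\<bar> \<le> 2 * L" using L[of "u x"] L[of "\<phi> j x"] by linarith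
        then have "norm ((D 1 (u x) - D 1 (\<phi> j x)) *\<^sub>R g x) powr p \<le> (2 * L * norm (g x)) powr p"
          using p by (intro powr_mono2) (auto intro!: mult_right_mono)
        then have "norm ((D 1 (u x) - D 1 (\<phi> j x)) *\<^sub>R g x) powr p * w x \<le> (2 * L) powr p * (norm (g x) powr p * w x)"
          using elim by (simp add: powr_mult mult.assoc[symmetric] mult_right_mono)
        then show ?case using elim by (simp add: ennreal_mult[symmetric] ennreal_leI)
      qed
      show "AE x in M. (\<lambda>j. ennreal (norm ((D 1 (u x) - D 1 (\<phi> j x)) *\<^sub>R g x) powr p * w x)) \<longlonglongrightarrow> 0"
        using \<phi>(4)
      proof eventually_elim
        case (elim x)
        have "(\<lambda>j. D 1 (\<phi> j x)) \<longlonglongrightarrow> D 1 (u x)"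
          by (rule isCont_tendsto_compose[OF _ elim]) (use DD[of 1] in \<open>blast intro: DERIV_isCont\<close>)
        then have "(\<lambda>j. norm ((D 1 (u x) - D 1 (\<phi> j x)) *\<^sub>R g x)) \<longlonglongrightarrow> norm ((D 1 (u x) - D 1 (u x)) *\<^sub>R g x)"
          by (intro tendsto_intros)
        then have "(\<lambda>j. norm ((D 1 (u x) - D 1 (\<phi> j x)) *\<^sub>R g x) powr p * w x)
            \<longlonglongrightarrow> norm ((D 1 (u x) - D 1 (u x)) *\<^sub>R g x) powr p * w x"
          using p by (intro tendsto_mult tendsto_const tendsto_powr') (auto intro!: always_eventually)
        from tendsto_ennrealI[OF this] show ?case by simp
      qed
    qed measurable
    then show ?thesis by (simp add: energy_def)
  qed
  have 3: "(\<lambda>j. energy (\<lambda>x. D 1 (u x) *\<^sub>R g x - grad (\<lambda>x. D 0 (\<phi> j x)) x)) \<longlonglongrightarrow> 0"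
  proof (rule tendsto_sandwich[OF _ _ tendsto_const])
    let ?b = "\<lambda>j. ennreal (2 powr p) * (energy (\<lambda>x. (D 1 (u x) - D 1 (\<phi> j x)) *\<^sub>R g x)
        + ennreal (L powr p) * energy (\<lambda>x. g x - grad (\<phi> j) x))"
    have "?b \<longlonglongrightarrow> ennreal (2 powr p) * (0 + ennreal (L powr p) * 0)"
      by (intro ennreal_tendsto_cmult tendsto_add 2 \<phi>(3)) simp_all
    then show "?b \<longlonglongrightarrow> 0" by simp
    have "energy (\<lambda>x. D 1 (u x) *\<^sub>R g x - grad (\<lambda>x. D 0 (\<phi> j x)) x) \<le> ?b j" for j
    proof -
      have "energy (\<lambda>x. D 1 (u x) *\<^sub>R g x - grad (\<lambda>x. D 0 (\<phi> j x)) x)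
          = energy (\<lambda>x. (D 1 (u x) - D 1 (\<phi> j x)) *\<^sub>R g x + D 1 (\<phi> j x) *\<^sub>R (g x - grad (\<phi> j) x))"
        by (simp add: gr algebra_simps)
      also have "\<dots> \<le> ennreal (2 powr p) * (energy (\<lambda>x. (D 1 (u x) - D 1 (\<phi> j x)) *\<^sub>R g x)
          + energy (\<lambda>x. D 1 (\<phi> j x) *\<^sub>R (g x - grad (\<phi> j) x)))"
        by (rule energy_add) measurable
      also have "\<dots> \<le> ?b j"
        by (intro mult_left_mono add_left_mono energy_scale_le[OF _ L0])
           (use L in \<open>auto intro!: mult_right_mono\<close>)
      finally show ?thesis .
    qed
    then show "\<forall>\<^sub>F j in sequentially. energy (\<lambda>x. D 1 (u x) *\<^sub>R g x - grad (\<lambda>x. D 0 (\<phi> j x)) x) \<le> ?b j"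
      by simp
  qed simp
  show ?thesis
    unfolding X0_def
  proof (intro conjI allI impI)
    fix e :: real assume "0 < e"
    then have e: "0 < ennreal e" by simp
    from order_tendstoD(2)[OF 1 e] order_tendstoD(2)[OF 3 e]
    have "\<forall>\<^sub>F j in sequentially. energy (\<lambda>x. D 0 (u x) - D 0 (\<phi> j x)) < ennreal e \<and>
       energy (\<lambda>x. D 1 (u x) *\<^sub>R g x - grad (\<lambda>x. D 0 (\<phi> j x)) x) < ennreal e"
      by (rule eventually_conj)
    then obtain j where "energy (\<lambda>x. D 0 (u x) - D 0 (\<phi> j x)) < ennreal e"
       "energy (\<lambda>x. D 1 (u x) *\<^sub>R g x - grad (\<lambda>x. D 0 (\<phi> j x)) x) < ennreal e"
      by (auto simp: eventually_sequentially)
    then show "\<exists>\<psi>\<in>Cc_infty \<Omega>. energy (\<lambda>x. D 0 (u x) - \<psi> x) < ennreal e \<and>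
        energy (\<lambda>x. D 1 (u x) *\<^sub>R g x - grad \<psi> x) < ennreal e"
      by (intro bexI[OF _ Cc_infty_compose[OF D \<phi>(1)[of j]]] conjI)
  qed measurable
qed

end

subsection \<open>Chain rule and embeddings\<close>

lemma poly_antiderivative:
  fixes a :: "nat \<Rightarrow> real"
  shows "\<exists>P. poly P 0 = 0 \<and> (\<forall>x. poly (pderiv P) x = (\<Sum>i\<le>n. a i * x ^ i))"
proof (induction n)
  case 0
  show ?case
    by (rule exI[of _ "[:0, a 0:]"]) (simp add: pderiv_pCons)
next
  case (Suc n)
  then obtain P where P: "poly P 0 = 0" "\<And>x. poly (pderiv P) x = (\<Sum>i\<le>n. a i * x ^ i)" by auto
  show ?case
    by (rule exI[of _ "P + monom (a (Suc n) / real (Suc (Suc n))) (Suc (Suc n))"])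
       (simp add: P pderiv_add pderiv_monom poly_monom del: of_nat_Suc)
qed

text \<open>Unlike polynomials, polynomials in \<open>tanh\<close> have bounded derivatives on the whole line. This matters
  because the test functions approximating a bounded function need not be uniformly bounded.\<close>

lemma poly_tanh_approx:
  fixes G' :: "real \<Rightarrow> real"
  assumes G': "continuous_on UNIV G'" and e: "0 < e"
  obtains P where "poly P 0 = 0"
    "\<And>t. \<bar>t\<bar> \<le> M \<Longrightarrow> \<bar>poly (pderiv P) (tanh t) * (1 - (tanh t)\<^sup>2) - G' t\<bar> \<le> e"
proof -
  define S where "S = {- tanh M..tanh M}"
  have S: "-1 < x \<and> x < 1" if "x \<in> S" for x
    using that tanh_real_bounds[of M] by (auto simp: S_def)
  have S2: "1 - x\<^sup>2 \<noteq> 0" if "x \<in> S" for x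
    using S[OF that] by (simp add: power2_eq_1_iff)
  \<comment> \<open>The substitution s = tanh t turns the claim P'(s) (1 - s^2) close to G'(artanh
    s) into polynomial approximation of this quotient on a compact interval inside (-1, 1);
    multiplying back by 1 - s^2 \<le> 1 does not enlarge the error.\<close>
  have "continuous_on S (\<lambda>s. G' (artanh s) / (1 - s\<^sup>2))"
    using S S2 by (intro continuous_intros continuous_on_compose2[OF G']) auto
  then obtain g where g: "real_polynomial_function g" "\<And>x. x \<in> S \<Longrightarrow> \<bar>G' (artanh x) / (1 - x\<^sup>2) - g x\<bar> < e"
    using Stone_Weierstrass_real_polynomial_function[of S "\<lambda>s. G' (artanh s) / (1 - s\<^sup>2)" e] e
    by (auto simp: S_def)
  obtain a n where an: "g = (\<lambda>x. \<Sum>i\<le>n. a i * x ^ i)"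
    using g(1) by (auto simp: real_polynomial_function_iff_sum)
  obtain P where P: "poly P 0 = 0" "\<And>x. poly (pderiv P) x = g x"
    using poly_antiderivative[of a n] an by auto
  show ?thesis
  proof (rule that[OF P(1)])
    fix t :: real assume t: "\<bar>t\<bar> \<le> M"
    define x where "x = tanh t"
    have "- tanh M \<le> x" "x \<le> tanh M"
      using t tanh_real_le_iff[of "- M" t] tanh_real_le_iff[of t M] by (auto simp: x_def)
    then have x: "x \<in> S" by (auto simp: S_def)
    have x1: "0 \<le> 1 - x\<^sup>2" "1 - x\<^sup>2 \<le> 1" using S[OF x] by (auto simp: abs_square_le_1)
    have "poly (pderiv P) x * (1 - x\<^sup>2) - G' t = - ((G' (artanh x) / (1 - x\<^sup>2) - g x) * (1 - x\<^sup>2))"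
      using S2[OF x] by (simp add: P x_def artanh_tanh_real left_diff_distrib)
    then have "\<bar>poly (pderiv P) x * (1 - x\<^sup>2) - G' t\<bar> = \<bar>G' (artanh x) / (1 - x\<^sup>2) - g x\<bar> * (1 - x\<^sup>2)"
      using x1 by (simp add: abs_mult)
    also have "\<dots> \<le> e * 1"
      using g(2)[OF x] x1 e by (intro mult_mono) auto
    finally show "\<bar>poly (pderiv P) (tanh t) * (1 - (tanh t)\<^sup>2) - G' t\<bar> \<le> e" by (simp add: x_def)
  qed
qed

context weighted_domain
begin

text \<open>Only the values of \<open>G'\<close> on the bounded range of \<open>v\<close> matter, so
  \<open>G'\<close> is approximated uniformly there by the derivative of a polynomial in tanh. The
  latter composition is covered by \<open>X0_compose_smooth\<close>, and \<open>X0\<close> is closed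
  under limits in energy.\<close>

lemma X0_compose_C1:
  assumes X: "X0 v g" and bd: "AE x in M. \<bar>v x\<bar> \<le> B"
    and G: "\<And>t. (G has_real_derivative G' t) (at t)" "continuous_on UNIV G'" "G 0 = 0"
  shows "X0 (\<lambda>x. G (v x)) (\<lambda>x. G' (v x) *\<^sub>R g x)"
proof (rule X0_closed)
  note [measurable] = X0_measurable[OF X]
  have contG: "continuous_on UNIV G"
    using G(1) by (auto intro!: continuous_at_imp_continuous_on DERIV_isCont)
  have [measurable]: "G \<in> borel_measurable borel" "G' \<in> borel_measurable borel"
    using contG G(2) by (auto intro: borel_measurable_continuous_onI)
  show "(\<lambda>x. G (v x)) \<in> borel_measurable M" "(\<lambda>x. G' (v x) *\<^sub>R g x) \<in> borel_measurable M"
    by measurable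
  fix e :: real assume e: "0 < e"
  define K where "K = enn2real (energy (\<lambda>_. 1 :: real)) + enn2real (energy g)"
  have fin1: "energy (\<lambda>_. 1 :: real) < top" by (rule energy_bounded_finite[where B = 1]) auto
  have K: "energy (\<lambda>_. 1 :: real) \<le> ennreal K" "energy g \<le> ennreal K" "0 \<le> K"
    using fin1 X0_energy_finite(2)[OF X]
    by (auto simp: K_def intro!: ennreal_enn2real[symmetric, THEN eq_refl, THEN order_trans] ennreal_leI)
  define B' where "B' = max 0 B + 1"
  have B': "1 \<le> B'" by (simp add: B'_def)
  \<comment> \<open>An error \<open>d\<close> in the derivative becomes at most
    \<open>d * B'\<close> in the values, since both functions vanish at 0. With
    \<open>B' \<ge> 1\<close> both p-th powers are at most \<open>e / (K + 1)\<close>, and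
    \<open>K\<close> bounds the two energies they multiply.\<close>
  define d where "d = (e / (K + 1)) powr (1 / p) / B'"
  have d: "0 < d" using e K B' by (simp add: d_def)
  have dB: "(d * B') powr p = e / (K + 1)"
    using B' e K p by (simp add: d_def powr_powr)
  have dp: "d powr p \<le> e / (K + 1)"
    unfolding dB[symmetric] using d B' p by (intro powr_mono2) (auto simp: mult_le_cancel_left1)
  have less: "ennreal (e / (K + 1)) * x < ennreal e" if "x \<le> ennreal K" for x
  proof -
    have "ennreal (e / (K + 1)) * x \<le> ennreal (e / (K + 1)) * ennreal K"
      using that by (rule mult_left_mono) simp
    also have "\<dots> = ennreal (e / (K + 1) * K)" using K e by (intro ennreal_mult[symmetric]) auto
    also have "\<dots> < ennreal e" using K e by (intro ennreal_lessI) (auto simp: field_simps)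
    finally show ?thesis .
  qed
  obtain P where P: "poly P 0 = 0"
    "\<And>t. \<bar>t\<bar> \<le> B' \<Longrightarrow> \<bar>poly (pderiv P) (tanh t) * (1 - (tanh t)\<^sup>2) - G' t\<bar> \<le> d"
    using poly_tanh_approx[OF G(2) d, where M = B'] by blast
  define D where "D = (\<lambda>n t. poly (((\<lambda>Q. pderiv Q * [:1, 0, -1:]) ^^ n) P) (tanh t))"
  have D: "deriv_seq D" unfolding D_def by (rule deriv_seq_poly_tanh)
  have D0: "D 0 0 = 0" using P(1) by (simp add: D_def)
  have D1: "D 1 t = poly (pderiv P) (tanh t) * (1 - (tanh t)\<^sup>2)" for t
    by (simp add: D_def power2_eq_square algebra_simps)
  obtain L where L: "\<And>t. \<bar>D 1 t\<bar> \<le> L"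
  proof -
    have "bounded ((\<lambda>s. poly (pderiv P * [:1, 0, -1:]) s) ` {-1..1})"
      by (intro compact_imp_bounded compact_continuous_image continuous_intros) auto
    then obtain L where L: "\<forall>y\<in>(\<lambda>s. poly (pderiv P * [:1, 0, -1:]) s) ` {-1..1}. norm y \<le> L"
      unfolding bounded_iff by blast
    have "\<bar>D 1 t\<bar> \<le> L" for t
    proof -
      have "tanh t \<in> {-1..1}" using tanh_real_bounds[of t] by auto
      then have "norm (poly (pderiv P * [:1, 0, -1:]) (tanh t)) \<le> L" using L by blast
      then show ?thesis by (simp add: D_def)
    qed
    then show ?thesis by (rule that)
  qed
  have derD: "(D 0 has_real_derivative D 1 t) (at t)" for t using D by (simp add: deriv_seq_def)
  note X' = X0_compose_smooth[OF X D D0 L]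
  have bd': "AE x in M. \<bar>v x\<bar> \<le> B'" using bd by eventually_elim (simp add: B'_def)
  have close: "\<bar>G t - D 0 t\<bar> \<le> d * B'" if t: "\<bar>t\<bar> \<le> B'" for t
  proof -
    have "norm ((G t - D 0 t) - (G 0 - D 0 0)) \<le> d * norm (t - 0)"
    proof (rule field_differentiable_bound[where S = "{- B'..B'}" and f' = "\<lambda>t. G' t - D 1 t"])
      show "((\<lambda>t. G t - D 0 t) has_real_derivative G' z - D 1 z) (at z within {- B'..B'})" for z
        by (rule has_field_derivative_at_within, rule DERIV_diff[OF G(1) derD])
      show "norm (G' z - D 1 z) \<le> d" if "z \<in> {- B'..B'}" for z
        using P(2)[of z] that unfolding D1 by (simp add: abs_minus_commute abs_le_iff)
    qed (use t B' in auto)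
    also have "\<dots> \<le> d * B'" using t d by simp
    finally show ?thesis by (simp add: G(3) D0)
  qed
  have "energy (\<lambda>x. G (v x) - D 0 (v x)) \<le> ennreal ((d * B') powr p) * energy (\<lambda>_. 1 :: real)"
    by (rule energy_scale_le) (use d B' bd' close in \<open>auto elim!: eventually_mono\<close>)
  also have "\<dots> < ennreal e" unfolding dB by (rule less[OF K(1)])
  finally have 1: "energy (\<lambda>x. G (v x) - D 0 (v x)) < ennreal e" .
  have "energy (\<lambda>x. G' (v x) *\<^sub>R g x - D 1 (v x) *\<^sub>R g x) \<le> ennreal (d powr p) * energy g"
  proof (rule energy_scale_le)
    show "AE x in M. norm (G' (v x) *\<^sub>R g x - D 1 (v x) *\<^sub>R g x) \<le> d * norm (g x)"
      using bd'
    proof eventually_elim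
      case (elim x)
      have "norm (G' (v x) *\<^sub>R g x - D 1 (v x) *\<^sub>R g x) = \<bar>D 1 (v x) - G' (v x)\<bar> * norm (g x)"
        by (simp add: abs_minus_commute flip: scaleR_diff_left)
      also have "\<dots> \<le> d * norm (g x)"
        unfolding D1 by (intro mult_right_mono P(2) elim) simp
      finally show ?case .
    qed
  qed (use d in auto)
  also have "\<dots> \<le> ennreal (e / (K + 1)) * energy g" by (intro mult_right_mono ennreal_leI dp) simp
  also have "\<dots> < ennreal e" by (rule less[OF K(2)])
  finally have 2: "energy (\<lambda>x. G' (v x) *\<^sub>R g x - D 1 (v x) *\<^sub>R g x) < ennreal e" .
  show "\<exists>u' g'. X0 u' g' \<and> energy (\<lambda>x. G (v x) - u' x) < ennreal e \<and>
      energy (\<lambda>x. G' (v x) *\<^sub>R g x - g' x) < ennreal e"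
    using X' 1 2 by blast
qed

text \<open>The embedding of X into the Lebesgue space of exponent q, raised to the power q and
  required on test functions alone; \<open>X0_embedding\<close> carries it to their closure.\<close>

definition embeds :: "real \<Rightarrow> real \<Rightarrow> bool" where
  "embeds q C \<longleftrightarrow> (\<forall>\<phi>\<in>Cc_infty \<Omega>. (\<integral>x. \<bar>\<phi> x\<bar> powr q \<partial>lborel)
     \<le> C * (\<integral>x. norm (grad \<phi> x) powr p * w x \<partial>M) powr (q / p))"

lemma integrable_grad_energy:
  assumes "\<phi> \<in> Cc1 \<Omega>"
  shows "integrable M (\<lambda>x. norm (grad \<phi> x) powr p * w x)"
  using energy_Cc1_finite(2)[OF assms] Cc1_measurable(2)[OF assms] by (simp add: energy_finite_iff)

lemma X0_grad_sequence:
  assumes X: "X0 u g"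
  obtains \<phi> a where "\<And>j::nat. \<phi> j \<in> Cc_infty \<Omega>" "AE x in M. (\<lambda>j. \<phi> j x) \<longlonglongrightarrow> u x"
    "\<And>j. (\<integral>x. norm (grad (\<phi> j) x) powr p * w x \<partial>M) \<le> 2 powr p * ((\<integral>x. norm (g x) powr p * w x \<partial>M) + a j)"
    "a \<longlonglongrightarrow> 0" "\<And>j. 0 \<le> a j"
proof -
  note [measurable] = X0_measurable[OF X]
  obtain \<phi> where \<phi>: "\<And>j::nat. \<phi> j \<in> Cc_infty \<Omega>"
    "(\<lambda>j. energy (\<lambda>x. u x - \<phi> j x)) \<longlonglongrightarrow> 0" "(\<lambda>j. energy (\<lambda>x. g x - grad (\<phi> j) x)) \<longlonglongrightarrow> 0"
    "AE x in M. (\<lambda>j. \<phi> j x) \<longlonglongrightarrow> u x"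
    by (rule X0_sequence[OF X]) (rule that; assumption)
  have \<phi>1: "\<phi> j \<in> Cc1 \<Omega>" for j using \<phi>(1) Cc_infty_subset_Cc1 by auto
  note [measurable] = Cc1_measurable[OF \<phi>1]
  define a where "a j = enn2real (energy (\<lambda>x. g x - grad (\<phi> j) x))" for j
  have fin: "energy (\<lambda>x. g x - grad (\<phi> j) x) < top" for j
    using X0_energy_finite[OF X] energy_Cc1_finite[OF \<phi>1] by (auto intro!: energy_diff_finite)
  have E: "energy (\<lambda>x. g x - grad (\<phi> j) x) = ennreal (a j)" for j
    using fin[of j] by (simp add: a_def)
  have gi: "integrable M (\<lambda>x. norm (g x) powr p * w x)"
    using X0_energy_finite(2)[OF X] by (simp add: energy_finite_iff)
  show ?thesis
  proof (rule that[of \<phi> a])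
    show "a \<longlonglongrightarrow> 0" using \<phi>(3) unfolding a_def by (intro tendsto_enn2real) simp_all
    show "0 \<le> a j" for j by (simp add: a_def)
    show "(\<integral>x. norm (grad (\<phi> j) x) powr p * w x \<partial>M) \<le> 2 powr p * ((\<integral>x. norm (g x) powr p * w x \<partial>M) + a j)" for j
    proof -
      have "energy (\<lambda>x. g x + (grad (\<phi> j) x - g x)) \<le> ennreal (2 powr p) * (energy g + energy (\<lambda>x. grad (\<phi> j) x - g x))"
        by (rule energy_add) measurable
      also have "energy (\<lambda>x. grad (\<phi> j) x - g x) = ennreal (a j)"
        unfolding E[symmetric] by (rule energy_cong) (simp add: norm_minus_commute)
      finally have "ennreal (\<integral>x. norm (grad (\<phi> j) x) powr p * w x \<partial>M)
          \<le> ennreal (2 powr p * ((\<integral>x. norm (g x) powr p * w x \<partial>M) + a j))"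
        using integrable_grad_energy[OF \<phi>1, of j] gi weighted_integral_nonneg[of g]
        by (simp add: energy_eq_integral ennreal_mult ennreal_plus[symmetric] a_def del: ennreal_plus)
      then show ?thesis
        using weighted_integral_nonneg[of g] by (subst (asm) ennreal_le_iff) (auto simp: a_def)
    qed
  qed (use \<phi> in auto)
qed

text \<open>Fatou's lemma along an almost everywhere convergent sequence of test functions. The
  factor 2^p comes from comparing their energies with that of \<open>g\<close>.\<close>

lemma X0_embedding:
  assumes emb: "embeds q C" and q: "0 < q" and C: "0 \<le> C" and X: "X0 u g"
  shows "integrable M (\<lambda>x. \<bar>u x\<bar> powr q)"
    "(\<integral>x. \<bar>u x\<bar> powr q \<partial>M) \<le> C * (2 powr p * (\<integral>x. norm (g x) powr p * w x \<partial>M)) powr (q / p)"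
proof -
  note [measurable] = X0_measurable[OF X]
  define Y where "Y = (\<integral>x. norm (g x) powr p * w x \<partial>M)"
  have Y: "0 \<le> Y" unfolding Y_def by (rule weighted_integral_nonneg)
  obtain \<phi> a where \<phi>: "\<And>j::nat. \<phi> j \<in> Cc_infty \<Omega>" "AE x in M. (\<lambda>j. \<phi> j x) \<longlonglongrightarrow> u x"
    "\<And>j. (\<integral>x. norm (grad (\<phi> j) x) powr p * w x \<partial>M) \<le> 2 powr p * ((\<integral>x. norm (g x) powr p * w x \<partial>M) + a j)"
    "a \<longlonglongrightarrow> 0" "\<And>j. 0 \<le> a j"
    by (rule X0_grad_sequence[OF X]) (rule that; assumption)
  note \<phi> = \<phi>[folded Y_def]
  have \<phi>1: "\<phi> j \<in> Cc1 \<Omega>" for j using \<phi>(1) Cc_infty_subset_Cc1 by auto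
  note [measurable] = Cc1_measurable[OF \<phi>1]
  define b where "b j = C * (2 powr p * (Y + a j)) powr (q / p)" for j
  have bl: "b \<longlonglongrightarrow> C * (2 powr p * (Y + 0)) powr (q / p)"
    unfolding b_def using p q Y \<phi>(5) by (intro tendsto_intros \<phi>(4) tendsto_powr') (auto intro!: always_eventually)
  have le: "(\<integral>\<^sup>+x. ennreal (\<bar>\<phi> j x\<bar> powr q) \<partial>M) \<le> ennreal (b j)" for j
  proof -
    have i: "integrable lborel (\<lambda>x. \<bar>\<phi> j x\<bar> powr q)" by (rule integrable_Cc1(1)[OF \<phi>1 q])
    have "(\<integral>\<^sup>+x. ennreal (\<bar>\<phi> j x\<bar> powr q) \<partial>M) = ennreal (\<integral>x. \<bar>\<phi> j x\<bar> powr q \<partial>M)"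
      using integrable_lebesgue_on_lborel[OF i] by (intro nn_integral_eq_integral) auto
    also have "(\<integral>x. \<bar>\<phi> j x\<bar> powr q \<partial>M) = (\<integral>x. \<bar>\<phi> j x\<bar> powr q \<partial>lborel)"
      using i Cc1_facts(6)[OF \<phi>1, of _ j] by (intro integral_lebesgue_on_lborel) auto
    also have "\<dots> \<le> C * (\<integral>x. norm (grad (\<phi> j) x) powr p * w x \<partial>M) powr (q / p)"
      using emb \<phi>(1) by (auto simp: embeds_def)
    also have "\<dots> \<le> b j"
      unfolding b_def using C p q \<phi>(3) weighted_integral_nonneg
      by (intro mult_left_mono powr_mono2) auto
    finally show ?thesis by (simp add: ennreal_leI)
  qed
  have "(\<integral>\<^sup>+x. ennreal (\<bar>u x\<bar> powr q) \<partial>M) = (\<integral>\<^sup>+x. liminf (\<lambda>j. ennreal (\<bar>\<phi> j x\<bar> powr q)) \<partial>M)"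
  proof (rule nn_integral_cong_AE)
    show "AE x in M. ennreal (\<bar>u x\<bar> powr q) = liminf (\<lambda>j. ennreal (\<bar>\<phi> j x\<bar> powr q))"
      using \<phi>(2)
    proof eventually_elim
      case (elim x)
      have "(\<lambda>j. ennreal (\<bar>\<phi> j x\<bar> powr q)) \<longlonglongrightarrow> ennreal (\<bar>u x\<bar> powr q)"
        using elim q by (intro tendsto_ennrealI tendsto_powr' tendsto_rabs tendsto_const) (auto intro!: always_eventually)
      then show ?case by (rule lim_imp_Liminf[OF sequentially_bot, symmetric])
    qed
  qed
  also have "\<dots> \<le> liminf (\<lambda>j. \<integral>\<^sup>+x. ennreal (\<bar>\<phi> j x\<bar> powr q) \<partial>M)"
    by (rule nn_integral_liminf) measurable
  also have "\<dots> \<le> liminf (\<lambda>j. ennreal (b j))"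
    by (intro Liminf_mono always_eventually allI le)
  also have "\<dots> = ennreal (C * (2 powr p * Y) powr (q / p))"
    using lim_imp_Liminf[OF sequentially_bot tendsto_ennrealI[OF bl]] by simp
  finally have F: "(\<integral>\<^sup>+x. ennreal (\<bar>u x\<bar> powr q) \<partial>M) \<le> ennreal (C * (2 powr p * Y) powr (q / p))" .
  show i: "integrable M (\<lambda>x. \<bar>u x\<bar> powr q)"
    unfolding integrable_iff_bounded using F by (auto intro: le_less_trans)
  show "(\<integral>x. \<bar>u x\<bar> powr q \<partial>M) \<le> C * (2 powr p * (\<integral>x. norm (g x) powr p * w x \<partial>M)) powr (q / p)"
    using F i C unfolding Y_def[symmetric] by (subst (asm) nn_integral_eq_integral) (auto simp: ennreal_le_iff)
qed

text \<open>Exponents below \<open>p_sub p s\<close> are included, by one more Hoelder inequality on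
  the finite measure space \<Omega>; the critical case \<open>p_sub p s = N\<close> relies on
  them.\<close>

lemma grad_Lr_le:
  assumes s: "0 < s" and ws: "integrable M (\<lambda>x. w x powr - s)" and r: "0 < r" "r \<le> p_sub p s"
  obtains K where "0 \<le> K" "\<And>\<phi>. \<phi> \<in> Cc1 \<Omega> \<Longrightarrow>
    (\<integral>x. norm (grad \<phi> x) powr r \<partial>lborel) \<le> K * (\<integral>x. norm (grad \<phi> x) powr p * w x \<partial>M) powr (r / p)"
proof -
  define r0 where "r0 = p_sub p s"
  have r0: "0 < r0" "r0 / p = s / (s + 1)" "1 - s / (s + 1) = 1 / (s + 1)"
  proof -
    show "0 < r0" "r0 / p = s / (s + 1)" using p s by (simp_all add: r0_def p_sub_def)
    show "1 - s / (s + 1) = 1 / (s + 1)" using s by (simp add: field_simps)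
  qed
  have a: "0 < s / (s + 1)" "s / (s + 1) < 1" using s by auto
  define W where "W = (\<integral>x. w x powr - s \<partial>M)"
  have W: "0 \<le> W" by (simp add: W_def)
  have nn: "AE x in M. 0 \<le> norm (g x) powr p * w x" for g :: "'a \<Rightarrow> 'a"
    using w_pos by (auto elim!: eventually_mono)
  have eqM: "(\<integral>x. norm (grad \<phi> x) powr t \<partial>lborel) = (\<integral>x. norm (grad \<phi> x) powr t \<partial>M)" if "\<phi> \<in> Cc1 \<Omega>" "0 < t" for \<phi> t
    using Cc1_facts(4,7)[OF that(1)] by (intro integral_lebesgue_on_lborel[symmetric]) auto
  have top: "(\<integral>x. norm (grad \<phi> x) powr r0 \<partial>M) \<le> W powr (1 / (s + 1)) * (\<integral>x. norm (grad \<phi> x) powr p * w x \<partial>M) powr (r0 / p)"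
    if \<phi>: "\<phi> \<in> Cc1 \<Omega>" for \<phi>
  proof -
    note [measurable] = Cc1_measurable[OF \<phi>]
    have "(\<integral>x. norm (grad \<phi> x) powr r0 \<partial>M)
        = (\<integral>x. (norm (grad \<phi> x) powr p * w x) powr (s / (s + 1)) * (w x powr - s) powr (1 - s / (s + 1)) \<partial>M)"
    proof (rule integral_cong_AE)
      show "AE x in M. norm (grad \<phi> x) powr r0 = (norm (grad \<phi> x) powr p * w x) powr (s / (s + 1)) * (w x powr - s) powr (1 - s / (s + 1))"
        using w_pos
      proof eventually_elim
        case (elim x)
        \<comment> \<open>The factors \<open>w\<close> and w^(-s), raised to their Hoelder weights
          s/(s+1) and 1/(s+1), cancel; this fixes the weights and thereby the exponent
          \<open>p_sub p s\<close>.\<close>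
        have "w x powr (s / (s + 1)) * w x powr (- s * (1 / (s + 1))) = 1"
          using elim by (simp flip: powr_add)
        moreover have "p * (s / (s + 1)) = r0" by (simp add: r0_def p_sub_def)
        ultimately show ?case
          unfolding r0(3) powr_mult powr_powr by (simp add: mult.assoc)
      qed
    qed measurable
    also have "\<dots> \<le> (\<integral>x. norm (grad \<phi> x) powr p * w x \<partial>M) powr (s / (s + 1)) * W powr (1 - s / (s + 1))"
      unfolding W_def by (rule Hoelder_powr(2)[OF integrable_grad_energy[OF \<phi>] nn ws _ a]) simp
    finally show ?thesis by (simp add: r0 mult.commute)
  qed
  show ?thesis
  proof (cases "r = r0")
    case True
    show ?thesis
      by (rule that[of "W powr (1 / (s + 1))"]) (use top eqM True r in auto)
  next
    case False
    then have rr: "r < r0" using r by (simp add: r0_def)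
    have b: "0 < r / r0" "r / r0 < 1" using r rr by auto
    interpret finite_measure M by (rule finite_measure_M)
    show ?thesis
    proof (rule that[of "(W powr (1 / (s + 1))) powr (r / r0) * measure M \<Omega> powr (1 - r / r0)"])
      fix \<phi> assume \<phi>: "\<phi> \<in> Cc1 \<Omega>"
      note [measurable] = Cc1_measurable[OF \<phi>]
      have i: "integrable M (\<lambda>x. norm (grad \<phi> x) powr r0)"
        using integrable_lebesgue_on_lborel[OF integrable_Cc1(2)[OF \<phi> r0(1)]] by simp
      have "(\<integral>x. norm (grad \<phi> x) powr r \<partial>M)
          = (\<integral>x. (norm (grad \<phi> x) powr r0) powr (r / r0) * (1::real) powr (1 - r / r0) \<partial>M)"
        using r0 by (simp add: powr_powr)
      also have "\<dots> \<le> (\<integral>x. norm (grad \<phi> x) powr r0 \<partial>M) powr (r / r0) * (\<integral>x. 1 \<partial>M) powr (1 - r / r0)"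
        by (rule Hoelder_powr(2)[OF i _ _ _ b]) auto
      also have "\<dots> \<le> (W powr (1 / (s + 1)) * (\<integral>x. norm (grad \<phi> x) powr p * w x \<partial>M) powr (r0 / p)) powr (r / r0) * (\<integral>x. 1 \<partial>M) powr (1 - r / r0)"
        using b top[OF \<phi>] by (intro mult_right_mono powr_mono2) auto
      also have "\<dots> = (W powr (1 / (s + 1))) powr (r / r0) * measure M \<Omega> powr (1 - r / r0) * (\<integral>x. norm (grad \<phi> x) powr p * w x \<partial>M) powr (r / p)"
        using r0(1) by (simp add: powr_mult powr_powr)
      finally show "(\<integral>x. norm (grad \<phi> x) powr r \<partial>lborel) \<le> (W powr (1 / (s + 1))) powr (r / r0) * measure M \<Omega> powr (1 - r / r0) * (\<integral>x. norm (grad \<phi> x) powr p * w x \<partial>M) powr (r / p)"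
        using eqM[OF \<phi> r(1)] by simp
    qed simp
  qed
qed

lemma embeds_sobolev_conj:
  assumes dim: "DIM('a) \<ge> 2" and s: "0 < s" and ws: "integrable M (\<lambda>x. w x powr - s)"
    and r: "1 \<le> r" "r \<le> p_sub p s" "r < real DIM('a)"
  obtains C where "0 \<le> C" "embeds (sobolev_conj (real DIM('a)) r) C"
proof -
  define q where "q = sobolev_conj (real DIM('a)) r"
  have q: "0 < q" using r by (simp add: q_def sobolev_conj_def)
  obtain C where C: "0 \<le> C" "\<And>\<phi>. \<phi> \<in> Cc1 \<Omega> \<Longrightarrow>
    (\<integral>x. \<bar>\<phi> x\<bar> powr sobolev_conj (real DIM('a)) r \<partial>lborel)
      \<le> C * (\<integral>x. norm (grad \<phi> x) powr r \<partial>lborel) powr (sobolev_conj (real DIM('a)) r / r)"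
    by (rule Sobolev_inequality[where \<Omega> = \<Omega>, OF dim r(1,3)]) (rule that; assumption)
  note C = C[folded q_def]
  obtain K where K: "0 \<le> K" "\<And>\<phi>. \<phi> \<in> Cc1 \<Omega> \<Longrightarrow>
    (\<integral>x. norm (grad \<phi> x) powr r \<partial>lborel) \<le> K * (\<integral>x. norm (grad \<phi> x) powr p * w x \<partial>M) powr (r / p)"
    by (rule grad_Lr_le[OF s ws _ r(2)]) (use r that in auto)
  have "embeds q (C * K powr (q / r))"
    unfolding embeds_def
  proof
    fix \<phi> assume "\<phi> \<in> Cc_infty \<Omega>"
    then have \<phi>: "\<phi> \<in> Cc1 \<Omega>" using Cc_infty_subset_Cc1 by auto
    have "(\<integral>x. \<bar>\<phi> x\<bar> powr q \<partial>lborel) \<le> C * (\<integral>x. norm (grad \<phi> x) powr r \<partial>lborel) powr (q / r)"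
      by (rule C(2)[OF \<phi>])
    also have "\<dots> \<le> C * (K * (\<integral>x. norm (grad \<phi> x) powr p * w x \<partial>M) powr (r / p)) powr (q / r)"
      using K(2)[OF \<phi>] C q r by (intro mult_left_mono powr_mono2) auto
    also have "\<dots> = C * K powr (q / r) * (\<integral>x. norm (grad \<phi> x) powr p * w x \<partial>M) powr (q / p)"
      using r by (simp add: powr_mult powr_powr)
    finally show "(\<integral>x. \<bar>\<phi> x\<bar> powr q \<partial>lborel) \<le> C * K powr (q / r) * (\<integral>x. norm (grad \<phi> x) powr p * w x \<partial>M) powr (q / p)" .
  qed
  then show ?thesis using C(1) by (intro that[of "C * K powr (q / r)"]) (simp_all add: q_def)
qed

text \<open>The approximating test functions have bounded weighted energies, hence gradients bounded
  in an unweighted norm of exponent above N. They share one supremum bound, which the pointwise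
  limit inherits.\<close>

lemma X0_bounded:
  assumes dim: "DIM('a) \<ge> 2" and s: "0 < s" and ws: "integrable M (\<lambda>x. w x powr - s)"
    and r: "real DIM('a) < p_sub p s" and X: "X0 u g"
  obtains C where "AE x in M. \<bar>u x\<bar> \<le> C"
proof -
  define r where "r = p_sub p s"
  have r0: "0 < r" using r by (simp add: r_def le_less_trans[OF of_nat_0_le_iff])
  obtain K where K: "0 \<le> K" "\<And>\<phi>. \<phi> \<in> Cc1 \<Omega> \<Longrightarrow>
    (\<integral>x. norm (grad \<phi> x) powr r \<partial>lborel) \<le> K * (\<integral>x. norm (grad \<phi> x) powr p * w x \<partial>M) powr (r / p)"
    by (rule grad_Lr_le[OF s ws r0]) (use that in \<open>auto simp: r_def\<close>)
  obtain \<phi> a where \<phi>: "\<And>j::nat. \<phi> j \<in> Cc_infty \<Omega>" "AE x in M. (\<lambda>j. \<phi> j x) \<longlonglongrightarrow> u x"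
    "\<And>j. (\<integral>x. norm (grad (\<phi> j) x) powr p * w x \<partial>M) \<le> 2 powr p * ((\<integral>x. norm (g x) powr p * w x \<partial>M) + a j)"
    "a \<longlonglongrightarrow> 0" "\<And>j. 0 \<le> a j"
    by (rule X0_grad_sequence[OF X]) (rule that; assumption)
  obtain A where A: "\<And>j. a j \<le> A"
    using convergent_imp_Bseq[OF convergentI[OF \<phi>(4)]] unfolding Bseq_def by (metis abs_le_D1 real_norm_def)
  define E where "E = 2 powr p * ((\<integral>x. norm (g x) powr p * w x \<partial>M) + A)"
  have bound: "(\<integral>x. norm (grad (\<phi> j) x) powr r \<partial>lborel) \<le> K * E powr (r / p)" for j
  proof -
    have "\<phi> j \<in> Cc1 \<Omega>" using \<phi>(1) Cc_infty_subset_Cc1 by auto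
    then have "(\<integral>x. norm (grad (\<phi> j) x) powr r \<partial>lborel) \<le> K * (\<integral>x. norm (grad (\<phi> j) x) powr p * w x \<partial>M) powr (r / p)"
      by (rule K(2))
    also have "\<dots> \<le> K * E powr (r / p)"
    proof (intro mult_left_mono powr_mono2 K(1) weighted_integral_nonneg)
      show "(\<integral>x. norm (grad (\<phi> j) x) powr p * w x \<partial>M) \<le> E"
        unfolding E_def by (rule order_trans[OF \<phi>(3)]) (use A[of j] in auto)
    qed (use r0 p in auto)
    finally show ?thesis .
  qed
  obtain C where C: "0 \<le> C"
    "\<And>\<phi> x. \<phi> \<in> Cc1 \<Omega> \<Longrightarrow> (\<integral>x. norm (grad \<phi> x) powr r \<partial>lborel) \<le> K * E powr (r / p) \<Longrightarrow> \<bar>\<phi> x\<bar> \<le> C"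
    by (rule Sobolev_sup[OF dim bounded_\<Omega> r[folded r_def], of "K * E powr (r / p)"]) (use K that in auto)
  have "\<bar>\<phi> j x\<bar> \<le> C" for j x
    by (rule C(2)[OF subsetD[OF Cc_infty_subset_Cc1 \<phi>(1)] bound])
  then have "AE x in M. \<bar>u x\<bar> \<le> C"
    using \<phi>(2)
  proof (elim eventually_mono)
    fix x assume "(\<lambda>j. \<phi> j x) \<longlonglongrightarrow> u x"
    then have "(\<lambda>j. \<bar>\<phi> j x\<bar>) \<longlonglongrightarrow> \<bar>u x\<bar>" by (rule tendsto_rabs)
    then show "\<bar>u x\<bar> \<le> C" by (rule LIMSEQ_le_const2) (use \<open>\<And>j x. \<bar>\<phi> j x\<bar> \<le> C\<close> in auto)
  qed
  then show ?thesis by (rule that)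
qed

end

subsection \<open>A priori estimates for the approximating solutions\<close>

text \<open>Measurability of \<open>A\<close> in \<open>x\<close> is given for fixed vectors only.
  For a simple function the composition is a finite sum over its values; continuity in the second
  argument handles the limit.\<close>

lemma caratheodory_measurable:
  assumes A: "caratheodory \<Omega> A" and \<Omega>: "\<Omega> \<in> sets lebesgue"
    and g: "g \<in> borel_measurable (lebesgue_on \<Omega>)"
  shows "(\<lambda>x. A x (g x)) \<in> borel_measurable (lebesgue_on \<Omega>)"
proof -
  let ?M = "lebesgue_on \<Omega>"
  obtain s where s: "\<And>i. simple_function ?M (s i)" "\<And>x. x \<in> space ?M \<Longrightarrow> (\<lambda>i. s i x) \<longlonglongrightarrow> g x"
    using borel_measurable_implies_sequence_metric[OF g, of 0] by metis
  have "(\<lambda>x. A x (s i x)) \<in> borel_measurable ?M" for i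
  proof -
    have fin: "finite (s i ` space ?M)" using s(1) by (rule simple_functionD)
    have "(\<lambda>x. \<Sum>y\<in>s i ` space ?M. indicator (s i -` {y} \<inter> space ?M) x *\<^sub>R A x y) \<in> borel_measurable ?M"
      using A simple_functionD(2)[OF s(1)]
      by (intro borel_measurable_sum borel_measurable_scaleR borel_measurable_indicator) (auto simp: caratheodory_def)
    moreover have "(\<Sum>y\<in>s i ` space ?M. indicator (s i -` {y} \<inter> space ?M) x *\<^sub>R A x y) = A x (s i x)"
      if x: "x \<in> space ?M" for x
    proof -
      have "(\<Sum>y\<in>s i ` space ?M. indicator (s i -` {y} \<inter> space ?M) x *\<^sub>R A x y)
          = (\<Sum>y\<in>{s i x}. indicator (s i -` {y} \<inter> space ?M) x *\<^sub>R A x y)"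
        using fin x by (intro sum.mono_neutral_right) auto
      also have "\<dots> = A x (s i x)" using x by simp
      finally show ?thesis .
    qed
    ultimately show ?thesis by (subst (asm) measurable_cong[where g = "\<lambda>x. A x (s i x)"]) auto
  qed
  moreover have "AE x in ?M. (\<lambda>i. A x (s i x)) \<longlonglongrightarrow> A x (g x)"
  proof -
    have "AE x in ?M. continuous_on UNIV (A x)" using A by (simp add: caratheodory_def)
    then show ?thesis
      using AE_space
    proof eventually_elim
      case (elim x)
      then have "isCont (A x) (g x)" by (simp add: continuous_on_eq_continuous_at)
      then show ?case using s(2)[OF elim(2)] by (rule isCont_tendsto_compose)
    qed
  qed
  ultimately show ?thesis by (rule measurable_lebesgue_on_AE_LIMSEQ[OF \<Omega>])
qed

lemma integrable_Fatou:
  fixes v :: "nat \<Rightarrow> 'b \<Rightarrow> real"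
  assumes u: "u \<in> borel_measurable M" and v: "\<And>n. integrable M (v n)" "\<And>n. AE x in M. 0 \<le> v n x"
    and Z: "\<And>n. (\<integral>x. v n x \<partial>M) \<le> Z" and lim: "AE x in M. (\<lambda>n. v n x) \<longlonglongrightarrow> u x"
  shows "integrable M u"
proof -
  note [measurable] = u borel_measurable_integrable[OF v(1)]
  have pos: "AE x in M. \<forall>n. 0 \<le> v n x" using v(2) by (simp add: AE_all_countable)
  have u0: "AE x in M. 0 \<le> u x"
    using pos lim by eventually_elim (auto intro: LIMSEQ_le_const)
  have "(\<integral>\<^sup>+x. ennreal (norm (u x)) \<partial>M) = (\<integral>\<^sup>+x. liminf (\<lambda>n. ennreal (v n x)) \<partial>M)"
  proof (rule nn_integral_cong_AE)
    show "AE x in M. ennreal (norm (u x)) = liminf (\<lambda>n. ennreal (v n x))"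
      using u0 lim
    proof eventually_elim
      case (elim x)
      then show ?case using lim_imp_Liminf[OF sequentially_bot tendsto_ennrealI[OF elim(2)]] by simp
    qed
  qed
  also have "\<dots> \<le> liminf (\<lambda>n. \<integral>\<^sup>+x. ennreal (v n x) \<partial>M)"
    by (rule nn_integral_liminf) measurable
  also have "\<dots> \<le> liminf (\<lambda>n. ennreal Z)"
    using v Z by (intro Liminf_mono always_eventually allI) (simp add: nn_integral_eq_integral ennreal_leI)
  also have "\<dots> = ennreal Z" by (rule lim_imp_Liminf[OF sequentially_bot tendsto_const])
  finally have "(\<integral>\<^sup>+x. ennreal (norm (u x)) \<partial>M) < \<infinity>" by (auto intro: le_less_trans)
  then show ?thesis by (simp add: integrable_iff_bounded)
qed

locale singular_problem = weighted_domain \<Omega> p w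
  for \<Omega> :: "'a::euclidean_space set" and p w +
  fixes A :: "'a \<Rightarrow> 'a \<Rightarrow> 'a" and \<delta> :: real and f :: "'a \<Rightarrow> real"
  assumes A: "structure_conditions p \<Omega> w A" and \<delta>: "1 < \<delta>"
    and f_int: "integrable M f" and f_nonneg: "AE x in M. 0 \<le> f x"
begin

lemma measurable_f [measurable]: "f \<in> borel_measurable M"
  using f_int by auto

lemma approx_solution_facts:
  assumes v: "approx_solution p \<Omega> w A \<delta> f n v"
  obtains B where "X0 v (wgrad \<Omega> v)" "0 < B" "AE x in M. \<bar>v x\<bar> \<le> B" "AE x in M. 0 < v x"
proof -
  obtain B where "AE x in M. \<bar>v x\<bar> \<le> B"
    using v by (auto simp: approx_solution_def L_infty_def)
  then have "AE x in M. \<bar>v x\<bar> \<le> max 1 B" by eventually_elim auto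
  then show ?thesis
    using v by (intro that[of "max 1 B"] W1p_0_imp_X0) (auto simp: approx_solution_def)
qed

text \<open>Continuity alone bounds \<open>G'\<close> along \<open>v\<close>, because
  \<open>v\<close> takes values in a compact interval almost everywhere.\<close>

lemma integrable_bounded_mult_energy:
  assumes X: "X0 v g" and bd: "AE x in M. \<bar>v x\<bar> \<le> B" and G': "continuous_on UNIV G'"
  obtains K where "0 \<le> K" "AE x in M. \<bar>G' (v x)\<bar> \<le> K"
    "integrable M (\<lambda>x. G' (v x) * (norm (g x) powr p * w x))"
proof -
  note [measurable] = X0_measurable[OF X]
  have [measurable]: "G' \<in> borel_measurable borel" using G' by (rule borel_measurable_continuous_onI)
  have "bounded (G' ` {- B..B})"
    by (intro compact_imp_bounded compact_continuous_image continuous_on_subset[OF G']) auto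
  then obtain K where K: "\<forall>y\<in>G' ` {- B..B}. norm y \<le> K" unfolding bounded_iff by blast
  define K' where "K' = max 0 K"
  have ae: "AE x in M. \<bar>G' (v x)\<bar> \<le> K'"
    using bd
  proof eventually_elim
    case (elim x)
    then have "G' (v x) \<in> G' ` {- B..B}" by (intro imageI) auto
    then show ?case using K by (force simp: K'_def)
  qed
  have gi: "integrable M (\<lambda>x. norm (g x) powr p * w x)"
    using X0_energy_finite(2)[OF X] by (simp add: energy_finite_iff)
  have "integrable M (\<lambda>x. G' (v x) * (norm (g x) powr p * w x))"
  proof (rule Bochner_Integration.integrable_bound)
    show "integrable M (\<lambda>x. K' * (norm (g x) powr p * w x))" using gi by simp
    show "AE x in M. norm (G' (v x) * (norm (g x) powr p * w x)) \<le> norm (K' * (norm (g x) powr p * w x))"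
      using ae by eventually_elim (auto simp: abs_mult K'_def intro!: mult_right_mono)
  qed measurable
  then show ?thesis using ae by (intro that[of K']) (auto simp: K'_def)
qed

text \<open>Boundedness of \<open>v\<close> makes \<open>G (v x)\<close> an element of X, hence an
  admissible test function. Degeneracy bounds the left side of the equation from below by the
  weighted gradient term, \<open>h\<close> bounds the right side from above.\<close>

lemma approx_test:
  assumes v: "approx_solution p \<Omega> w A \<delta> f n v"
    and G: "\<And>t. (G has_real_derivative G' t) (at t)" "continuous_on UNIV G'" "G 0 = 0"
    and G'_nonneg: "\<And>t. 0 \<le> t \<Longrightarrow> 0 \<le> G' t"
    and h: "integrable M h" "AE x in M. 0 \<le> h x"
      "AE x in M. min (f x) (real n) / (v x + 1 / real n) powr \<delta> * G (v x) \<le> h x"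
  shows "(\<integral>x. G' (v x) * (norm (wgrad \<Omega> v x) powr p * w x) \<partial>M) \<le> (\<integral>x. h x \<partial>M)"
proof -
  define g where "g = wgrad \<Omega> v"
  obtain B where X: "X0 v (wgrad \<Omega> v)" and B: "AE x in M. \<bar>v x\<bar> \<le> B" and pos: "AE x in M. 0 < v x"
    by (rule approx_solution_facts[OF v]) (rule that; assumption)
  note X = X[folded g_def]
  note [measurable] = X0_measurable[OF X]
  have [measurable]: "G' \<in> borel_measurable borel" using G(2) by (rule borel_measurable_continuous_onI)
  obtain K where K: "0 \<le> K" "AE x in M. \<bar>G' (v x)\<bar> \<le> K"
    "integrable M (\<lambda>x. G' (v x) * (norm (g x) powr p * w x))"
    by (rule integrable_bounded_mult_energy[OF X B G(2)]) (rule that; assumption)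
  have gi: "integrable M (\<lambda>x. norm (g x) powr p * w x)"
    using X0_energy_finite(2)[OF X] by (simp add: energy_finite_iff)
  note X' = X0_compose_C1[OF X B G]
  have eq: "AE x in M. wgrad \<Omega> (\<lambda>x. G (v x)) x = G' (v x) *\<^sub>R g x" by (rule X0_wgrad_eq[OF X'])
  have Am[measurable]: "(\<lambda>x. A x (g x)) \<in> borel_measurable M"
    by (rule caratheodory_measurable[OF _ sets_\<Omega> X0_measurable(2)[OF X]])
       (use A in \<open>simp add: structure_conditions_def\<close>)
  have growth: "AE x in M. norm (A x (g x)) \<le> norm (g x) powr (p - 1) * w x"
    using A unfolding structure_conditions_def by (auto elim!: eventually_mono)
  have "AE x in M. \<forall>\<zeta>. norm \<zeta> powr p * w x \<le> A x \<zeta> \<bullet> \<zeta>"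
    using A by (simp add: structure_conditions_def)
  then have coer: "AE x in M. norm (g x) powr p * w x \<le> A x (g x) \<bullet> g x"
    by (auto elim!: eventually_mono)
  \<comment> \<open>Growth and the bound on \<open>G'\<close> give an integrable majorant; otherwise
    the integral of the flux could be 0 by default, and the lower bound would be lost.\<close>
  have Ai: "integrable M (\<lambda>x. A x (g x) \<bullet> (G' (v x) *\<^sub>R g x))"
  proof (rule Bochner_Integration.integrable_bound)
    show "integrable M (\<lambda>x. K * (norm (g x) powr p * w x))" using gi by simp
    show "AE x in M. norm (A x (g x) \<bullet> (G' (v x) *\<^sub>R g x)) \<le> norm (K * (norm (g x) powr p * w x))"
      using growth K(2) w_pos
    proof eventually_elim
      case (elim x)
      have "\<bar>A x (g x) \<bullet> g x\<bar> \<le> norm (A x (g x)) * norm (g x)" by (rule Cauchy_Schwarz_ineq2)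
      also have "\<dots> \<le> (norm (g x) powr (p - 1) * w x) * norm (g x)"
        using elim by (intro mult_right_mono) auto
      also have "\<dots> = norm (g x) powr p * w x"
        by (cases "g x = 0") (auto simp: powr_diff)
      finally have "\<bar>G' (v x)\<bar> * \<bar>A x (g x) \<bullet> g x\<bar> \<le> K * (norm (g x) powr p * w x)"
        using elim K(1) by (intro mult_mono) auto
      then show ?case using K(1) elim by (simp add: abs_mult)
    qed
  qed measurable
  have "(\<integral>x. G' (v x) * (norm (g x) powr p * w x) \<partial>M) \<le> (\<integral>x. A x (g x) \<bullet> (G' (v x) *\<^sub>R g x) \<partial>M)"
  proof (rule integral_mono_AE[OF K(3) Ai])
    show "AE x in M. G' (v x) * (norm (g x) powr p * w x) \<le> A x (g x) \<bullet> (G' (v x) *\<^sub>R g x)"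
      using coer pos by eventually_elim (auto intro!: mult_left_mono G'_nonneg)
  qed
  also have "\<dots> = (\<integral>x. A x (wgrad \<Omega> v x) \<bullet> wgrad \<Omega> (\<lambda>x. G (v x)) x \<partial>M)"
  proof (rule integral_cong_AE)
    have "wgrad \<Omega> (\<lambda>x. G (v x)) \<in> borel_measurable M"
      by (rule X0_measurable(2)[OF X0_wgrad[OF X']])
    then show "(\<lambda>x. A x (wgrad \<Omega> v x) \<bullet> wgrad \<Omega> (\<lambda>x. G (v x)) x) \<in> borel_measurable M"
      using Am by (simp add: g_def)
    show "AE x in M. A x (g x) \<bullet> (G' (v x) *\<^sub>R g x) = A x (wgrad \<Omega> v x) \<bullet> wgrad \<Omega> (\<lambda>x. G (v x)) x"
      using eq by eventually_elim (simp add: g_def)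
  qed (use Ai in auto)
  also have "\<dots> = (\<integral>x. min (f x) (real n) / (v x + 1 / real n) powr \<delta> * G (v x) \<partial>M)"
    using v X0_imp_W1p_0[OF X'] by (auto simp: approx_solution_def)
  also have "\<dots> \<le> (\<integral>x. h x \<partial>M)"
    \<comment> \<open>Only the majorant has to be integrable: a non-integrable left integrand would
      have integral 0, and \<open>h\<close> is nonnegative.\<close>
    by (rule integral_mono_AE'[OF h(1) h(3) h(2)])
  finally show ?thesis by (simp add: g_def)
qed

text \<open>The dependence on n disappears here, which makes all later bounds uniform in n.\<close>

lemma rhs_le:
  assumes "0 \<le> fx" "0 < t" "0 \<le> G" and n: "1 \<le> (n::nat)"
  shows "min fx (real n) / (t + 1 / real n) powr \<delta> * G \<le> fx * (G / t powr \<delta>)"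
proof -
  have "t powr \<delta> \<le> (t + 1 / real n) powr \<delta>"
    using assms \<delta> by (intro powr_mono2) auto
  then have "min fx (real n) / (t + 1 / real n) powr \<delta> \<le> fx / t powr \<delta>"
    using assms by (intro frac_le) auto
  then show ?thesis using assms mult_right_mono[of _ _ G] by fastforce
qed

text \<open>The constant \<open>Z0\<close> is obtained before n and \<open>v\<close>: it depends on
  the data and the embedding constant, but not on the supremum of \<open>v\<close>, which may grow
  with n.\<close>

lemma power_estimate:
  fixes m q :: real
  assumes emb: "embeds q C" "0 \<le> C" and pq: "p < q" and m: "1 < m" "m < q / (q - p)"
    and fm: "f \<in> Lp m \<Omega>"
  defines "\<gamma> \<equiv> (\<delta> + p - 1) * conj_exp m / (p * conj_exp m - q)"
  obtains Z0 where "\<And>n v. 1 \<le> n \<Longrightarrow> approx_solution p \<Omega> w A \<delta> f n v \<Longrightarrow>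
    integrable M (\<lambda>x. \<bar>v x\<bar> powr (q * \<gamma>)) \<and> (\<integral>x. \<bar>v x\<bar> powr (q * \<gamma>) \<partial>M) \<le> Z0"
proof -
  define m' where "m' = conj_exp m"
  have q: "0 < q" "1 < q" using p pq by auto
  have m': "1 / m' = 1 - 1 / m" "0 < m'" using m by (auto simp: m'_def conj_exp_def field_simps)
  have D: "0 < p * m' - q"
  proof -
    have "m * (q - p) < q" using m pq by (simp add: field_simps)
    then have "q * (m - 1) < p * m" by (simp add: algebra_simps)
    then have "q < p * m / (m - 1)" using m by (simp add: field_simps)
    then show ?thesis by (simp add: m'_def conj_exp_def)
  qed
  have \<gamma>_eq: "\<gamma> * (p * m' - q) = (\<delta> + p - 1) * m'" using D by (simp add: \<gamma>_def m'_def)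
  have \<gamma>: "1 < \<gamma>"
  proof -
    have "0 < (\<delta> - 1) * m'" using \<delta> m' by simp
    then have "1 * (p * m' - q) < \<gamma> * (p * m' - q)"
      unfolding \<gamma>_eq using q by (simp add: algebra_simps)
    then show ?thesis using D by (simp only: mult_less_cancel_right_pos)
  qed
  \<comment> \<open>Testing with v^\<theta> produces v^(\<theta> - 1) = v^(p (\<gamma> - 1)), the
    factor in the energy of v^\<gamma>.\<close>
  define \<theta> where "\<theta> = p * (\<gamma> - 1) + 1"
  have \<theta>: "1 < \<theta>" using \<gamma> p by (simp add: \<theta>_def)
  \<comment> \<open>The right side f v^(\<theta> - \<delta>) thus splits under Hoelder with
    exponents m and m' into the norm of f and the very integral of v^(q \<gamma>) that is to be
    bounded.\<close>
  have \<theta>\<delta>: "\<theta> - \<delta> = q * \<gamma> * (1 - 1 / m)"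
  proof -
    have "(\<theta> - \<delta>) * m' = \<gamma> * (p * m' - q) - (\<delta> + p - 1) * m' + q * \<gamma>" by (simp add: \<theta>_def algebra_simps)
    then have "(\<theta> - \<delta>) * m' = q * \<gamma>" by (simp add: \<gamma>_eq)
    then have "\<theta> - \<delta> = q * \<gamma> * (1 / m')" using m'(2) by (simp add: field_simps)
    then show ?thesis unfolding m'(1) .
  qed
  \<comment> \<open>Hoelder contributes 1 - 1/m and the embedding q/p; the product is below 1
    exactly when m < q/(q - p), so absorption is possible.\<close>
  define a where "a = (1 - 1 / m) * (q / p)"
  have a: "a < 1"
  proof -
    have "a = q / (p * m')" by (simp add: a_def m'(1)[symmetric])
    then show ?thesis using D p m' by simp
  qed
  define F where "F = (\<integral>x. \<bar>f x\<bar> powr m \<partial>M)"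
  have fi: "integrable M (\<lambda>x. \<bar>f x\<bar> powr m)" using fm by (simp add: Lp_def)
  have F: "0 \<le> F" by (simp add: F_def)
  define c where "c = C * (2 powr p * (\<gamma> powr p * (F powr (1 / m) / \<theta>))) powr (q / p)"
  show ?thesis
  proof (rule that[of "c powr (1 / (1 - a))"])
    fix n :: nat and v assume n: "1 \<le> n" and v: "approx_solution p \<Omega> w A \<delta> f n v"
    define g where "g = wgrad \<Omega> v"
    obtain B where X: "X0 v (wgrad \<Omega> v)" and B: "0 < B" "AE x in M. \<bar>v x\<bar> \<le> B" and pos: "AE x in M. 0 < v x"
      by (rule approx_solution_facts[OF v]) (rule that; assumption)
    note X = X[folded g_def]
    note [measurable] = X0_measurable[OF X]
    have q\<gamma>: "0 < q * \<gamma>" using q \<gamma> by simp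
    define Z where "Z = (\<integral>x. \<bar>v x\<bar> powr (q * \<gamma>) \<partial>M)"
    \<comment> \<open>The bound \<open>B\<close> on this particular \<open>v\<close> serves only to
      make \<open>Z\<close> finite before it is absorbed.\<close>
    have Zi: "integrable M (\<lambda>x. \<bar>v x\<bar> powr (q * \<gamma>))"
    proof (rule finite_measure.integrable_const_bound[OF finite_measure_M])
      show "AE x in M. norm (\<bar>v x\<bar> powr (q * \<gamma>)) \<le> B powr (q * \<gamma>)"
        using B(2) by eventually_elim (use q\<gamma> in \<open>auto intro!: powr_mono2\<close>)
    qed measurable
    have Z: "0 \<le> Z" by (simp add: Z_def)
    have m1: "0 < 1 / m" "1 / m < 1" using m by auto
    define h where "h x = (\<bar>f x\<bar> powr m) powr (1 / m) * (\<bar>v x\<bar> powr (q * \<gamma>)) powr (1 - 1 / m)" for x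
    have h: "integrable M h" "(\<integral>x. h x \<partial>M) \<le> F powr (1 / m) * Z powr (1 - 1 / m)"
      unfolding h_def[abs_def] F_def Z_def
      by (rule Hoelder_powr[OF fi _ Zi _ m1]; simp)+
    define E where "E = (\<integral>x. \<bar>v x\<bar> powr (\<theta> - 1) * (norm (g x) powr p * w x) \<partial>M)"
    have "(\<integral>x. \<theta> * (\<bar>v x\<bar> powr (\<theta> - 1) * sgn (v x)) * (norm (g x) powr p * w x) \<partial>M) \<le> (\<integral>x. h x \<partial>M)"
      unfolding g_def
    proof (rule approx_test[OF v, where G = "\<lambda>t. \<bar>t\<bar> powr \<theta>"])
      show "((\<lambda>t. \<bar>t\<bar> powr \<theta>) has_real_derivative \<theta> * (\<bar>t\<bar> powr (\<theta> - 1) * sgn t)) (at t)" for t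
        by (rule abs_powr_has_derivative[OF \<theta>])
      show "continuous_on UNIV (\<lambda>t. \<theta> * (\<bar>t\<bar> powr (\<theta> - 1) * sgn t))"
        using \<theta> by (intro continuous_on_mult continuous_on_const continuous_abs_powr_sgn) simp
      show "AE x in M. 0 \<le> h x" by (simp add: h_def)
      show "AE x in M. min (f x) (real n) / (v x + 1 / real n) powr \<delta> * \<bar>v x\<bar> powr \<theta> \<le> h x"
        using pos f_nonneg
      proof eventually_elim
        case (elim x)
        have "min (f x) (real n) / (v x + 1 / real n) powr \<delta> * \<bar>v x\<bar> powr \<theta> \<le> f x * (\<bar>v x\<bar> powr \<theta> / v x powr \<delta>)"
          by (rule rhs_le) (use elim n in auto)
        also have "\<dots> = f x * v x powr (\<theta> - \<delta>)" using elim by (simp add: powr_diff)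
        also have "\<dots> = h x" using elim m by (simp add: h_def powr_powr \<theta>\<delta>)
        finally show ?case .
      qed
    qed (use \<theta> h in \<open>auto intro!: mult_nonneg_nonneg\<close>)
    also have "(\<integral>x. \<theta> * (\<bar>v x\<bar> powr (\<theta> - 1) * sgn (v x)) * (norm (g x) powr p * w x) \<partial>M)
        = (\<integral>x. \<theta> * (\<bar>v x\<bar> powr (\<theta> - 1) * (norm (g x) powr p * w x)) \<partial>M)"
    proof (rule integral_cong_AE)
      show "AE x in M. \<theta> * (\<bar>v x\<bar> powr (\<theta> - 1) * sgn (v x)) * (norm (g x) powr p * w x)
          = \<theta> * (\<bar>v x\<bar> powr (\<theta> - 1) * (norm (g x) powr p * w x))"
        using pos by eventually_elim simp
    qed measurable
    also have "\<dots> = \<theta> * E" by (simp add: E_def)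
    finally have "\<theta> * E \<le> F powr (1 / m) * Z powr (1 - 1 / m)" using h(2) by linarith
    then have E: "E \<le> F powr (1 / m) / \<theta> * Z powr (1 - 1 / m)" using \<theta> by (simp add: field_simps)
    have X': "X0 (\<lambda>x. \<bar>v x\<bar> powr \<gamma>) (\<lambda>x. (\<gamma> * (\<bar>v x\<bar> powr (\<gamma> - 1) * sgn (v x))) *\<^sub>R g x)"
      using \<gamma> by (intro X0_compose_C1[OF X B(2)] abs_powr_has_derivative continuous_on_mult
          continuous_on_const continuous_abs_powr_sgn) auto
    have "Z = (\<integral>x. \<bar>\<bar>v x\<bar> powr \<gamma>\<bar> powr q \<partial>M)" by (simp add: Z_def powr_powr mult.commute)
    also have "\<dots> \<le> C * (2 powr p * (\<integral>x. norm ((\<gamma> * (\<bar>v x\<bar> powr (\<gamma> - 1) * sgn (v x))) *\<^sub>R g x) powr p * w x \<partial>M)) powr (q / p)"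
      by (rule X0_embedding(2)[OF emb(1) q(1) emb(2) X'])
    also have "(\<integral>x. norm ((\<gamma> * (\<bar>v x\<bar> powr (\<gamma> - 1) * sgn (v x))) *\<^sub>R g x) powr p * w x \<partial>M) = \<gamma> powr p * E"
    proof -
      have "(\<integral>x. norm ((\<gamma> * (\<bar>v x\<bar> powr (\<gamma> - 1) * sgn (v x))) *\<^sub>R g x) powr p * w x \<partial>M)
          = (\<integral>x. \<gamma> powr p * (\<bar>v x\<bar> powr (\<theta> - 1) * (norm (g x) powr p * w x)) \<partial>M)"
      proof (rule integral_cong_AE)
        show "AE x in M. norm ((\<gamma> * (\<bar>v x\<bar> powr (\<gamma> - 1) * sgn (v x))) *\<^sub>R g x) powr p * w x
            = \<gamma> powr p * (\<bar>v x\<bar> powr (\<theta> - 1) * (norm (g x) powr p * w x))"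
          using pos by eventually_elim (use \<gamma> in \<open>simp add: abs_mult powr_mult powr_powr \<theta>_def mult.commute mult.left_commute\<close>)
      qed measurable
      then show ?thesis by (simp add: E_def)
    qed
    also have "C * (2 powr p * (\<gamma> powr p * E)) powr (q / p)
        \<le> C * (2 powr p * (\<gamma> powr p * (F powr (1 / m) / \<theta> * Z powr (1 - 1 / m)))) powr (q / p)"
    proof -
      have "0 \<le> E" unfolding E_def
        by (rule integral_nonneg_AE) (use w_pos in eventually_elim, simp)
      then show ?thesis using E emb q p by (intro mult_left_mono powr_mono2) auto
    qed
    also have "\<dots> = c * Z powr a"
    proof -
      have "2 powr p * (\<gamma> powr p * (F powr (1 / m) / \<theta> * Z powr (1 - 1 / m)))
          = 2 powr p * (\<gamma> powr p * (F powr (1 / m) / \<theta>)) * Z powr (1 - 1 / m)" by simp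
      then show ?thesis by (simp only: c_def powr_mult powr_powr a_def mult.assoc)
    qed
    finally have "Z \<le> c powr (1 / (1 - a))"
      using Z a emb by (intro le_powr_absorb) (auto simp: c_def)
    then show "integrable M (\<lambda>x. \<bar>v x\<bar> powr (q * \<gamma>)) \<and> (\<integral>x. \<bar>v x\<bar> powr (q * \<gamma>) \<partial>M) \<le> c powr (1 / (1 - a))"
      using Zi by (simp add: Z_def)
  qed
qed

text \<open>For the soft excess G(v) over a level k, the energy is bounded by the integral of f
  G(v). Hoelder is used twice: f restricted to the superlevel set is put into exponent q', G(v) into
  exponent q, and the norm of f in exponent q' is estimated by that in exponent m times a power of
  the measure of the set.\<close>

lemma bounded_estimate:
  fixes m q :: real
  assumes emb: "embeds q C" "0 \<le> C" and pq: "p < q" and m: "q / (q - p) < m" and fm: "f \<in> Lp m \<Omega>"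
  obtains D where "\<And>n v. 1 \<le> n \<Longrightarrow> approx_solution p \<Omega> w A \<delta> f n v \<Longrightarrow> AE x in M. v x \<le> D"
proof -
  interpret finite_measure M by (rule finite_measure_M)
  have q: "0 < q" "1 < q" using p pq by auto
  \<comment> \<open>The conjugate exponent of q.\<close>
  define a where "a = q / (q - 1)"
  have mq: "q < m * (q - p)" using m pq by (simp add: field_simps)
  have m0: "1 < m"
  proof -
    have "1 < q / (q - p)" using p pq by simp
    then show ?thesis using m by simp
  qed
  have a: "1 < a" "a < m" "1 / a = 1 - 1 / q"
  proof -
    show "1 < a" using q by (simp add: a_def)
    have "q - p \<le> q - 1" using p by simp
    then have "q < m * (q - 1)" using mq m0 mult_left_mono[of "q - p" "q - 1" m] by linarith
    then show "a < m" using q by (simp add: a_def field_simps)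
    show "1 / a = 1 - 1 / q" using q by (simp add: a_def field_simps)
  qed
  define F where "F = (\<integral>x. \<bar>f x\<bar> powr m \<partial>M)"
  have fi: "integrable M (\<lambda>x. \<bar>f x\<bar> powr m)" using fm by (simp add: Lp_def)
  have F: "0 \<le> F" by (simp add: F_def)
  \<comment> \<open>The power of the measure of the superlevel set in the estimate of
    \<open>Z\<close> before the factor \<open>Z powr (1 / p)\<close> is absorbed.\<close>
  define \<kappa> where "\<kappa> = (1 - a / m) * (1 / a) * (q / p)"
  define P where "P = 1 / (1 - 1 / p)"
  \<comment> \<open>Absorption raises everything to the power P = p/(p - 1), which makes \<beta> =
    (q - 1 - q/m)/(p - 1). This exceeds 1 exactly when q/m < q - p, the assumption on m.\<close>
  define \<beta> where "\<beta> = \<kappa> * P"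
  have \<beta>: "1 < \<beta>"
  proof -
    have "(1 - a / m) * (1 / a) = 1 / a - 1 / m"
      using a(1) by (simp add: diff_divide_distrib)
    then have "\<kappa> = (1 - 1 / q - 1 / m) * (q / p)" by (simp only: \<kappa>_def a(3))
    also have "\<dots> = (q - 1 - q / m) / p"
      using q by (simp add: left_diff_distrib diff_divide_distrib)
    finally have "\<kappa> = (q - 1 - q / m) / p" .
    moreover have "P = p / (p - 1)" using p by (simp add: P_def field_simps)
    ultimately have "\<beta> = (q - 1 - q / m) / (p - 1)"
      using p by (simp add: \<beta>_def)
    moreover have "q / m < q - p" using mq m0 by (simp add: field_simps)
    then have "p - 1 < q - 1 - q / m" by linarith
    ultimately show ?thesis using p by (simp add: less_divide_eq_1_pos)
  qed
  define c0 where "c0 = sqrt 2 - 1"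
  have c0: "0 < c0" by (simp add: c0_def)
  define c where "c = C * (2 powr p * (F powr (a / m)) powr (1 / a)) powr (q / p)"
  have c: "0 \<le> c" using emb by (simp add: c_def)
  define K where "K = c powr P * c0 powr - q"
  define V where "V = measure M \<Omega> + 1"
  have KV: "0 \<le> K" "0 < V" by (simp_all add: K_def V_def add_nonneg_pos)
  \<comment> \<open>The iteration constant depends on the data alone and is fixed before n and
    \<open>v\<close>; the levels start at 1.\<close>
  obtain d where d: "0 \<le> d"
    "\<And>\<mu>. \<lbrakk>\<And>k. 1 \<le> k \<Longrightarrow> 0 \<le> \<mu> k; \<And>h k. 1 \<le> k \<Longrightarrow> k \<le> h \<Longrightarrow> \<mu> h \<le> \<mu> k; \<mu> 1 \<le> V;
       \<And>k e. 1 \<le> k \<Longrightarrow> 0 < e \<Longrightarrow> \<mu> (k + e) \<le> K * e powr - q * \<mu> k powr \<beta>\<rbrakk> \<Longrightarrow> \<mu> (1 + d) = 0"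
    by (rule Stampacchia[OF KV(2,1) q(1) \<beta>, of 1]) blast
  show ?thesis
  proof (rule that[of "1 + d"])
    fix n :: nat and v assume n: "1 \<le> n" and v: "approx_solution p \<Omega> w A \<delta> f n v"
    define g where "g = wgrad \<Omega> v"
    obtain B where X: "X0 v (wgrad \<Omega> v)" and B: "0 < B" "AE x in M. \<bar>v x\<bar> \<le> B" and pos: "AE x in M. 0 < v x"
      by (rule approx_solution_facts[OF v]) (rule that; assumption)
    note X = X[folded g_def]
    note [measurable] = X0_measurable[OF X]
    define S where "S k = {x \<in> \<Omega>. k < v x}" for k
    have Sm[measurable]: "S k \<in> sets M" for k
    proof -
      have "{x \<in> space M. k < v x} \<in> sets M" by measurable
      then show ?thesis by (simp add: S_def)
    qed
    have S_Int: "S k \<inter> \<Omega> = S k" for k by (auto simp: S_def)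
    define \<mu> where "\<mu> k = measure M (S k)" for k
    have "\<mu> (1 + d) = 0"
    proof (rule d(2))
      show "0 \<le> \<mu> k" for k by (simp add: \<mu>_def)
      show "\<mu> h \<le> \<mu> k" if "k \<le> h" for h k
        unfolding \<mu>_def using that by (intro finite_measure_mono Sm) (auto simp: S_def)
      have "\<mu> 1 \<le> measure M \<Omega>"
        unfolding \<mu>_def by (intro finite_measure_mono) (auto simp: S_def)
      then show "\<mu> 1 \<le> V" by (simp add: V_def)
      fix k e :: real assume k: "1 \<le> k" and e: "0 < e"
      define G where "G = soft_excess e k"
      define G' where "G' = soft_excess_deriv e k"
      note G_bd = soft_excess_bounds[OF e, where k = k, folded G_def G'_def]
      have G: "\<And>t. (G has_real_derivative G' t) (at t)" "continuous_on UNIV G'" "G 0 = 0"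
        using soft_excess_has_derivative[OF e] continuous_soft_excess_deriv[OF e] soft_excess_bounds(2)[OF e, of 0 k] k
        by (auto simp: G_def G'_def)
      have contG: "continuous_on UNIV G"
        using G(1) by (auto intro!: continuous_at_imp_continuous_on DERIV_isCont)
      have [measurable]: "G \<in> borel_measurable borel" "G' \<in> borel_measurable borel"
        using contG G(2) by (auto intro: borel_measurable_continuous_onI)
      note X' = X0_compose_C1[OF X B(2) G]
      define Z where "Z = (\<integral>x. \<bar>G (v x)\<bar> powr q \<partial>M)"
      have Z: "0 \<le> Z" by (simp add: Z_def)
      have Zi: "integrable M (\<lambda>x. \<bar>G (v x)\<bar> powr q)"
        by (rule X0_embedding(1)[OF emb(1) q(1) emb(2) X'])
      have am: "0 < a / m" "a / m < 1" and a1: "0 < 1 / a" "1 / a < 1" using a(1,2) by auto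
      have Si: "integrable M (indicat_real (S k))" by (simp add: emeasure_eq_measure)
      define f1 where "f1 x = (\<bar>f x\<bar> powr m) powr (a / m) * indicat_real (S k) x powr (1 - a / m)" for x
      have f1: "integrable M f1" "(\<integral>x. f1 x \<partial>M) \<le> F powr (a / m) * \<mu> k powr (1 - a / m)"
        using Hoelder_powr[OF fi _ Si _ am] unfolding f1_def[abs_def] F_def \<mu>_def by (simp_all add: S_Int)
      have f1_nn: "0 \<le> f1 x" for x by (simp add: f1_def)
      define h where "h x = f1 x powr (1 / a) * (\<bar>G (v x)\<bar> powr q) powr (1 - 1 / a)" for x
      have h: "integrable M h" "(\<integral>x. h x \<partial>M) \<le> (\<integral>x. f1 x \<partial>M) powr (1 / a) * Z powr (1 - 1 / a)"
        unfolding h_def[abs_def] Z_def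
        by (rule Hoelder_powr[OF f1(1) _ Zi _ a1]; simp add: f1_nn)+
      define Y where "Y = (\<integral>x. norm (G' (v x) *\<^sub>R g x) powr p * w x \<partial>M)"
      have "Y \<le> (\<integral>x. G' (v x) * (norm (g x) powr p * w x) \<partial>M)"
        unfolding Y_def
      proof (rule integral_mono_AE)
        show "integrable M (\<lambda>x. norm (G' (v x) *\<^sub>R g x) powr p * w x)"
          using X0_energy_finite(2)[OF X'] X0_measurable(2)[OF X']
          by (intro energy_finite_iff[THEN iffD1]) auto
        show "integrable M (\<lambda>x. G' (v x) * (norm (g x) powr p * w x))"
          by (rule integrable_bounded_mult_energy[OF X B(2) G(2)])
        show "AE x in M. norm (G' (v x) *\<^sub>R g x) powr p * w x \<le> G' (v x) * (norm (g x) powr p * w x)"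
          using w_pos
        proof eventually_elim
          case (elim x)
          \<comment> \<open>The slope of the truncation lies in [0, 1] and p > 1. So the energy of
            G(v), with factor G'^p, is dominated by what testing with G(v) controls, with factor
            G'.\<close>
          have "G' (v x) powr p \<le> G' (v x) powr 1"
            using G_bd(3,4)[of "v x"] p by (intro powr_mono') auto
          then have "G' (v x) powr p \<le> G' (v x)" using G_bd(3)[of "v x"] by simp
          then have "G' (v x) powr p * (norm (g x) powr p * w x) \<le> G' (v x) * (norm (g x) powr p * w x)"
            using elim by (intro mult_right_mono) auto
          then show ?case using G_bd(3)[of "v x"] by (simp add: powr_mult mult.assoc)
        qed
      qed
      also have "\<dots> \<le> (\<integral>x. h x \<partial>M)"
        unfolding g_def
      proof (rule approx_test[OF v G])
        show "AE x in M. 0 \<le> h x" by (simp add: h_def)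
        show "AE x in M. min (f x) (real n) / (v x + 1 / real n) powr \<delta> * G (v x) \<le> h x"
          using pos f_nonneg AE_space
        proof eventually_elim
          case (elim x)
          show ?case
          proof (cases "k < v x")
            case True
            then have x: "x \<in> S k" using elim by (simp add: S_def)
            have "1 \<le> v x powr \<delta>" using True k \<delta> by (intro ge_one_powr_ge_zero) auto
            then have "G (v x) / v x powr \<delta> \<le> G (v x) / 1"
              using G_bd(1)[of "v x"] by (intro divide_left_mono) auto
            then have "G (v x) / v x powr \<delta> \<le> G (v x)" by simp
            then have "f x * (G (v x) / v x powr \<delta>) \<le> f x * G (v x)"
              using elim by (intro mult_left_mono) auto
            moreover have "min (f x) (real n) / (v x + 1 / real n) powr \<delta> * G (v x) \<le> f x * (G (v x) / v x powr \<delta>)"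
              by (rule rhs_le) (use elim n G_bd in auto)
            moreover have "f x * G (v x) = h x"
            proof -
              have "q * (1 - 1 / a) = 1" using q by (simp add: a)
              then have "(\<bar>G (v x)\<bar> powr q) powr (1 - 1 / a) = G (v x)"
                using G_bd(1)[of "v x"] by (simp only: powr_powr) simp
              moreover have "f1 x powr (1 / a) = f x"
                using x elim a(1) m0 by (simp add: f1_def powr_powr)
              ultimately show ?thesis by (simp add: h_def)
            qed
            ultimately show ?thesis by linarith
          next
            case False
            then show ?thesis using G_bd(2)[of "v x"] by (simp add: h_def)
          qed
        qed
      qed (use G_bd h in auto)
      also have "\<dots> \<le> (F powr (a / m) * \<mu> k powr (1 - a / m)) powr (1 / a) * Z powr (1 / q)"
      proof -
        have "(\<integral>x. f1 x \<partial>M) powr (1 / a) \<le> (F powr (a / m) * \<mu> k powr (1 - a / m)) powr (1 / a)"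
          using f1(2) a1 by (intro powr_mono2) (auto intro!: integral_nonneg_AE simp: f1_nn)
        moreover have "1 - 1 / a = 1 / q" by (simp add: a)
        ultimately show ?thesis using h(2) mult_right_mono[of "(\<integral>x. f1 x \<partial>M) powr (1 / a)" _ "Z powr (1 / q)"]
          by force
      qed
      finally have Y: "Y \<le> (F powr (a / m) * \<mu> k powr (1 - a / m)) powr (1 / a) * Z powr (1 / q)" .
      have "Z \<le> C * (2 powr p * Y) powr (q / p)"
        unfolding Z_def Y_def by (rule X0_embedding(2)[OF emb(1) q(1) emb(2) X'])
      also have "\<dots> \<le> C * (2 powr p * ((F powr (a / m) * \<mu> k powr (1 - a / m)) powr (1 / a) * Z powr (1 / q))) powr (q / p)"
        using Y emb q p weighted_integral_nonneg[of "\<lambda>x. G' (v x) *\<^sub>R g x"]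
        by (intro mult_left_mono powr_mono2) (auto simp: Y_def)
      also have "\<dots> = c * \<mu> k powr \<kappa> * Z powr (1 / p)"
      proof -
        have "1 / q * (q / p) = 1 / p" using q by simp
        then have "Z powr (1 / q * (q / p)) = Z powr (1 / p)" by (simp only:)
        then show ?thesis
          by (simp only: c_def \<kappa>_def powr_mult powr_powr[of "\<mu> k"] powr_powr[of Z] mult_ac)
      qed
      finally have "Z \<le> (c * \<mu> k powr \<kappa>) powr P"
        unfolding P_def using Z c p by (intro le_powr_absorb) auto
      also have "\<dots> = c powr P * \<mu> k powr \<beta>" by (simp add: powr_mult powr_powr \<beta>_def)
      finally have Z_le: "Z \<le> c powr P * \<mu> k powr \<beta>" .
      have "\<mu> (k + e) * (c0 * e) powr q = (\<integral>x. indicat_real (S (k + e)) x * (c0 * e) powr q \<partial>M)"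
        by (simp add: \<mu>_def S_Int)
      also have "\<dots> \<le> Z"
        unfolding Z_def
      proof (rule integral_mono)
        show "integrable M (\<lambda>x. indicat_real (S (k + e)) x * (c0 * e) powr q)"
          by (intro integrable_mult_left) (simp add: emeasure_eq_measure)
        show "indicat_real (S (k + e)) x * (c0 * e) powr q \<le> \<bar>G (v x)\<bar> powr q" for x
          using G_bd(6)[of "v x"] G_bd(1)[of "v x"] c0 e q
          by (auto simp: indicator_def S_def c0_def intro!: powr_mono2)
      qed (rule Zi)
      finally have "\<mu> (k + e) * (c0 * e) powr q \<le> c powr P * \<mu> k powr \<beta>" using Z_le by linarith
      then have "\<mu> (k + e) \<le> c powr P * \<mu> k powr \<beta> / (c0 * e) powr q"
        using c0 e by (simp add: field_simps)
      also have "\<dots> = K * e powr - q * \<mu> k powr \<beta>"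
        using c0 e by (simp add: K_def powr_mult powr_minus divide_inverse)
      finally show "\<mu> (k + e) \<le> K * e powr - q * \<mu> k powr \<beta>" .
    qed
    then have "S (1 + d) \<in> null_sets M"
      using Sm by (simp add: null_sets_def \<mu>_def emeasure_eq_measure)
    from AE_not_in[OF this] AE_space show "AE x in M. v x \<le> 1 + d"
      by eventually_elim (auto simp: S_def)
  qed
qed

end

subsection \<open>The regularity theorem\<close>

text \<open>The weight is integrable over the compact closure of \<Omega>, its dual power over a
  ball containing \<Omega>; both restrict to \<Omega>.\<close>

lemma As_weight_imp_weighted_domain:
  assumes "open \<Omega>" "bounded \<Omega>" "1 < p" and w: "As_weight p s \<Omega> w"
  shows "weighted_domain \<Omega> p w"
proof
  have Ap: "Ap_weight p w" using w by (simp add: As_weight_def)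
  have S: "\<Omega> \<in> sets lebesgue" using assms(1) by auto
  have K: "compact (closure \<Omega>)" using assms(2) by (simp add: compact_closure)
  then have "integrable (lebesgue_on (closure \<Omega>)) w"
    using Ap by (auto simp: Ap_weight_def locally_integrable_on_def)
  then show "integrable (lebesgue_on \<Omega>) w"
    by (rule integrable_lebesgue_on_subset[OF _ closure_subset S]) auto
  have "AE x in lebesgue. 0 < w x" using Ap by (simp add: Ap_weight_def)
  then show "AE x in lebesgue_on \<Omega>. 0 < w x"
    using S by (simp add: AE_restrict_space_iff) (auto elim: eventually_mono)
  obtain r where r: "0 < r" "\<Omega> \<subseteq> ball 0 r"
    using bounded_subset_ballD[OF assms(2)] by blast
  then have "integrable (lebesgue_on (ball 0 r)) (\<lambda>x. w x powr (- 1 / (p - 1)))"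
    using Ap by (auto simp: Ap_weight_def)
  then show "integrable (lebesgue_on \<Omega>) (\<lambda>x. w x powr (- 1 / (p - 1)))"
    by (rule integrable_lebesgue_on_subset[OF _ r(2) S]) auto
qed (use assms in auto)

theorem theorem3p7:
  fixes \<Omega> :: "'a::euclidean_space set"
    and w f u :: "'a \<Rightarrow> real"
    and A :: "'a \<Rightarrow> 'a \<Rightarrow> 'a"
    and v :: "nat \<Rightarrow> 'a \<Rightarrow> real"
    and p s \<delta> N ps pstar :: real
  defines "N \<equiv> real DIM('a)"
    and "ps \<equiv> p_sub p s"
    and "pstar \<equiv> sobolev_conj N ps"
  assumes dim: "DIM('a) \<ge> 2"
    and dom: "bounded_smooth_domain \<Omega>"
    and p: "1 < p"
    and s: "s \<in> {1 / (p - 1)..} \<inter> {N / p<..}"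
    and w: "As_weight p s \<Omega> w"
    and A: "structure_conditions p \<Omega> w A"
    and \<delta>: "\<delta> > 1"
    and f: "f \<in> Lp 1 \<Omega>" "AE x in lebesgue_on \<Omega>. 0 \<le> f x"
      "\<not> (AE x in lebesgue_on \<Omega>. f x = 0)"
    and v: "\<And>n. n \<ge> 1 \<Longrightarrow> approx_solution p \<Omega> w A \<delta> f n (v n)"
    and lim: "AE x in lebesgue_on \<Omega>. (\<lambda>n. v n x) \<longlonglongrightarrow> u x"
    and u: "weak_solution p \<Omega> w A \<delta> f u"
      "(\<lambda>x. u x powr ((\<delta> + p - 1) / p)) \<in> W1p_0 p \<Omega> w"
  shows
    "(1 \<le> ps \<and> ps < N \<longrightarrow>
        (\<forall>m. 1 < m \<and> m < pstar / (pstar - p) \<and> f \<in> Lp m \<Omega> \<longrightarrow>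
           (let \<gamma> = (\<delta> + p - 1) * conj_exp m / (p * conj_exp m - pstar)
            in u \<in> Lp (pstar * \<gamma>) \<Omega>)) \<and>
        (\<forall>m. m > pstar / (pstar - p) \<and> f \<in> Lp m \<Omega> \<longrightarrow> u \<in> L_infty \<Omega>)) \<and>
     (ps = N \<longrightarrow>
        (\<forall>q>p. \<forall>m. 1 < m \<and> m < q / (q - p) \<and> f \<in> Lp m \<Omega> \<longrightarrow>
           (let \<gamma> = (\<delta> + p - 1) * conj_exp m / (p * conj_exp m - q)
            in u \<in> Lp (q * \<gamma>) \<Omega>))) \<and>
     (ps > N \<longrightarrow> u \<in> L_infty \<Omega>)"
proof -
  interpret weighted_domain \<Omega> p w
    using dom p w by (intro As_weight_imp_weighted_domain) (auto simp: bounded_smooth_domain_def)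
  have f_int: "integrable M f"
  proof -
    have [measurable]: "f \<in> borel_measurable M" and "integrable M (\<lambda>x. \<bar>f x\<bar> powr 1)"
      using f(1) by (auto simp: Lp_def)
    then have "integrable M (\<lambda>x. norm (f x))" by simp
    then show ?thesis by (subst (asm) integrable_norm_iff) measurable
  qed
  interpret singular_problem \<Omega> p w A \<delta> f
    by unfold_locales (use A \<delta> f_int f(2) in auto)
  have N: "2 \<le> N" using dim by (simp add: N_def)
  have s0: "0 < s"
  proof -
    have "0 < 1 / (p - 1)" using p by simp
    moreover have "1 / (p - 1) \<le> s" using s by simp
    ultimately show ?thesis by linarith
  qed
  have ws: "integrable M (\<lambda>x. w x powr - s)" using w by (simp add: As_weight_def)
  have sp: "N < s * p" using s p by (simp add: field_simps)
  have vm: "v (Suc n) \<in> borel_measurable M" for n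
    using v[of "Suc n"] by (auto simp: approx_solution_def L_infty_def)
  have lim': "AE x in M. (\<lambda>n. v (Suc n) x) \<longlonglongrightarrow> u x"
    \<comment> \<open>Nothing is assumed about \<open>v 0\<close>, so the sequence is shifted to
      start at index 1.\<close>
    using lim by eventually_elim (rule LIMSEQ_Suc)
  have um: "u \<in> borel_measurable M"
    by (rule measurable_lebesgue_on_AE_LIMSEQ[OF sets_\<Omega> vm lim'])
  have u_pos: "AE x in M. 0 < u x" using u(1) by (simp add: weak_solution_def)
  have in_Lp: "u \<in> Lp (q * ((\<delta> + p - 1) * conj_exp m / (p * conj_exp m - q))) \<Omega>"
    if emb: "embeds q C" "0 \<le> C" and q: "p < q" and m: "1 < m" "m < q / (q - p)" and fm: "f \<in> Lp m \<Omega>" for q C m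
  proof -
    let ?t = "q * ((\<delta> + p - 1) * conj_exp m / (p * conj_exp m - q))"
    obtain Z where Z: "\<And>n v. 1 \<le> n \<Longrightarrow> approx_solution p \<Omega> w A \<delta> f n v \<Longrightarrow>
      integrable M (\<lambda>x. \<bar>v x\<bar> powr ?t) \<and> (\<integral>x. \<bar>v x\<bar> powr ?t \<partial>M) \<le> Z"
      by (rule power_estimate[OF emb q m fm]) blast
    have Zn: "integrable M (\<lambda>x. \<bar>v (Suc n) x\<bar> powr ?t)" "(\<integral>x. \<bar>v (Suc n) x\<bar> powr ?t \<partial>M) \<le> Z" for n
      using Z[OF _ v, of "Suc n"] by (simp_all only: Suc_le_mono le_add1 One_nat_def zero_le)
    have "integrable M (\<lambda>x. \<bar>u x\<bar> powr ?t)"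
    proof (rule integrable_Fatou[where v = "\<lambda>n x. \<bar>v (Suc n) x\<bar> powr ?t" and Z = Z])
      show "(\<lambda>x. \<bar>u x\<bar> powr ?t) \<in> borel_measurable M" using um by measurable
      \<comment> \<open>Convergence of the powers uses that the limit \<open>u x\<close> is
        nonzero.\<close>
      show "AE x in M. (\<lambda>n. \<bar>v (Suc n) x\<bar> powr ?t) \<longlonglongrightarrow> \<bar>u x\<bar> powr ?t"
        using lim' u_pos by eventually_elim (intro tendsto_powr tendsto_rabs tendsto_const, auto)
    qed (rule Zn AE_I2 powr_ge_zero)+
    then show ?thesis using um by (simp add: Lp_def)
  qed
  have in_Linf: "u \<in> L_infty \<Omega>" if "AE x in M. u x \<le> D" for D
  proof -
    have "AE x in M. \<bar>u x\<bar> \<le> D" using that u_pos by eventually_elim auto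
    then show ?thesis using um by (auto simp: L_infty_def)
  qed
  show ?thesis
  proof (intro conjI impI allI)
    assume ps: "1 \<le> ps \<and> ps < N"
    obtain C where C: "0 \<le> C" "embeds pstar C"
      using embeds_sobolev_conj[OF dim s0 ws, of ps] ps by (auto simp: ps_def pstar_def N_def)
    \<comment> \<open>The inequality reads p N < (p + N) p_s, and for p_s = p s/(s + 1) this is
      exactly N < s p.\<close>
    have pstar: "p < pstar"
    proof -
      have "p * (N - ps) < N * ps"
      proof -
        have "p * N * (s + 1) < (p + N) * (p * s)"
          using mult_strict_left_mono[OF sp, of p] p by (simp add: algebra_simps)
        then have "p * N < (p + N) * ps" using s0 by (simp add: ps_def p_sub_def field_simps)
        then show ?thesis by (simp add: algebra_simps)
      qed
      then show ?thesis using ps by (simp add: pstar_def sobolev_conj_def field_simps)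
    qed
    show "let \<gamma> = (\<delta> + p - 1) * conj_exp m / (p * conj_exp m - pstar) in u \<in> Lp (pstar * \<gamma>) \<Omega>"
      if "1 < m \<and> m < pstar / (pstar - p) \<and> f \<in> Lp m \<Omega>" for m
      using in_Lp[OF C(2,1) pstar] that by (simp add: Let_def)
    show "u \<in> L_infty \<Omega>" if m: "pstar / (pstar - p) < m \<and> f \<in> Lp m \<Omega>" for m
    proof -
      obtain D where D: "\<And>n v. 1 \<le> n \<Longrightarrow> approx_solution p \<Omega> w A \<delta> f n v \<Longrightarrow> AE x in M. v x \<le> D"
        using m by (elim conjE) (rule bounded_estimate[OF C(2,1) pstar], auto)
      have "AE x in M. \<forall>n. v (Suc n) x \<le> D"
        by (subst AE_all_countable) (auto intro!: D[OF _ v])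
      with lim' have "AE x in M. u x \<le> D"
        by eventually_elim (auto intro: LIMSEQ_le_const2)
      then show ?thesis by (rule in_Linf)
    qed
  next
    fix q m assume ps: "ps = N" and q: "p < q" and m: "1 < m \<and> m < q / (q - p) \<and> f \<in> Lp m \<Omega>"
    \<comment> \<open>The solution of N r/(N - r) = q, so the given q is the Sobolev conjugate of an
      exponent below N = p_s.\<close>
    define r where "r = N * q / (N + q)"
    have "p * s = N * (s + 1)" using ps s0 by (simp add: ps_def p_sub_def field_simps)
    then have "N * s < p * s" using N by (simp add: algebra_simps)
    then have "N < p" using s0 by simp
    then have q2: "2 < q" "0 < N + q" using N q by auto
    \<comment> \<open>Equivalent to (N - 1) (q - 1) \<ge> 1. Here q > 2, because p_s = N forces p >
      N \<ge> 2.\<close>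
    have "1 \<le> r"
    proof -
      have "1 * 1 \<le> (N - 1) * (q - 1)" using N q2 by (intro mult_mono) auto
      then have "N + q \<le> N * q" by (simp add: algebra_simps)
      then show ?thesis using q2 by (simp add: r_def)
    qed
    moreover have rN: "r < N" using q2 N by (simp add: r_def field_simps)
    moreover have "sobolev_conj N r = q"
    proof -
      have "N - r = N * N / (N + q)" using q2 by (simp add: r_def field_simps)
      then show ?thesis using N q2 by (simp add: sobolev_conj_def r_def)
    qed
    ultimately obtain C where "0 \<le> C" "embeds q C"
      using embeds_sobolev_conj[OF dim s0 ws, of r] ps by (auto simp: ps_def N_def)
    then show "let \<gamma> = (\<delta> + p - 1) * conj_exp m / (p * conj_exp m - q) in u \<in> Lp (q * \<gamma>) \<Omega>"
      using in_Lp[of q C m] q m by (simp add: Let_def)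
  next
    assume ps: "N < ps"
    \<comment> \<open>By assumption the power u^a lies in X, so it is bounded; taking the root of
      order a > 0 bounds \<open>u\<close> itself.\<close>
    define a where "a = (\<delta> + p - 1) / p"
    have a: "0 < a" using p \<delta> by (simp add: a_def)
    obtain C where C: "AE x in M. \<bar>u x powr a\<bar> \<le> C"
      by (rule X0_bounded[OF dim s0 ws _ W1p_0_imp_X0[OF u(2)]])
         (use ps that in \<open>auto simp: ps_def N_def a_def\<close>)
    have "AE x in M. u x \<le> C powr (1 / a)"
      using C u_pos
    proof eventually_elim
      case (elim x)
      have "(u x powr a) powr (1 / a) \<le> C powr (1 / a)"
        using elim a by (intro powr_mono2) auto
      then show ?case using elim a by (simp add: powr_powr)
    qed
    then show "u \<in> L_infty \<Omega>" by (rule in_Linf)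
  qed
qed

end
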